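(* Let $(X,d)$ be a compact metric space and let $\{\xi_n\}_{n\ge1}$ be an exponentially mixing stationary process on a probability space $(\Omega,\mathscr{A},\mathbb{P})$ taking values in $X$, with distribution $\mu$ (that is, $\mu(A)=\mathbb{P}(\xi_1\in A)$ for all Borel sets $A\subset X$). Assume that $\mu$ is Ahlfors $s$-regular with $0<s<\infty$. Let $\{\ell_n\}_{n\ge1}$ be a sequence of positive numbers decreasing to zero whose upper Besicovitch-Taylor index $\alpha$ satisfies $\alpha<s$, and let $E=\limsup_{n\to\infty}B(\xi_n,\ell_n)=\{y\in X: y\in B(\xi_n,\ell_n)\text{ for infinitely many }n\}$. Then for every analytic set $G\subset X$, with probability one: (i) $\dim_{\rm H}(E\cap G)\le\dim_{\rm P}(G)+\alpha-s$ if $\dim_{\rm P}(G)\ge s-\alpha$; (ii) $\dim_{\rm H}(E\cap G)=-\infty$ if $\dim_{\rm P}(G)<s-\alpha$; (iii) $\dim_{\rm H}(E\cap G)\ge\dim_{\rm H}(G)+\alpha-s$ if $\dim_{\rm H}(G)>s-\alpha$.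
   Context: $B(x,r)$ denotes the closed ball with center $x$ and radius $r$. A stationary process $\{\xi_n\}_{n\ge1}$ is exponentially mixing if there are constants $C>0$ and $0<\rho<1$ such that $|\mathbb{P}(\xi_1\in A\mid D)-\mathbb{P}(\xi_1\in A)|\le C\rho^n$ for all $n\ge1$, all balls $A\subset X$ and all $D\in\mathscr{A}^{n+1}$ (with $\mathbb{P}(D)>0$), where $\mathscr{A}^{n+1}$ is the sub-$\sigma$-field generated by $\{\xi_{n+i}\}_{i\ge1}$. $\mu$ is Ahlfors $s$-regular if there is a constant $1\le c_1<\infty$ with $c_1^{-1}r^s\le\mu(B(x,r))\le c_1r^s$ for all $x\in X$ and $0<r\le\operatorname{diam}X$. The upper Besicovitch-Taylor index of $\{\ell_n\}$ is $\alpha=\inf\{t\le s:\sum_{n=1}^\infty\ell_n^t<\infty\}=\sup\{t\le s:\sum_{n=1}^\infty\ell_n^t=\infty\}$. $\dim_{\rm H}$ and $\dim_{\rm P}$ denote Hausdorff and packing dimension in $(X,d)$; by convention both equal $-\infty$ for the empty set.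
   Formalization: The formal theorem also assumes that X has at least two points; for a one-point X the regularity condition on 0 < r ≤ diam X is vacuous and (ii) fails with G = X. *)

theory Defs
  imports "HOL-Probability.Probability"
begin

section \<open>Hausdorff dimension\<close>

text \<open>\<open>diam(U)\<^sup>t\<close> with the usual conventions \<open>diam({})\<^sup>t = 0\<close> and \<open>diam(U)\<^sup>0 = 1\<close> for
  nonempty \<open>U\<close>. The separate case is needed because \<open>0 powr 0 = 0\<close>, so that a singleton would
  otherwise have zero-dimensional measure 0.\<close>

definition diam_pow :: "real \<Rightarrow> 'a::metric_space set \<Rightarrow> ennreal" where
  "diam_pow t U = (if U = {} then 0 else if t = 0 then 1 else ennreal (diameter U powr t))"

text \<open>Boundedness of the covering sets is required because the library's real-valued
  \<open>diameter\<close> is meaningless on unbounded sets.\<close>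

definition hausdorff_content :: "real \<Rightarrow> real \<Rightarrow> 'a::metric_space set \<Rightarrow> ennreal" where
  "hausdorff_content t \<delta> A =
     (INF U \<in> {U :: nat \<Rightarrow> 'a set. (\<forall>i. bounded (U i) \<and> diameter (U i) \<le> \<delta>) \<and> A \<subseteq> (\<Union>i. U i)}.
        (\<Sum>i. diam_pow t (U i)))"

definition hausdorff_measure :: "real \<Rightarrow> 'a::metric_space set \<Rightarrow> ennreal" where
  "hausdorff_measure t A = (SUP \<delta> \<in> {0<..}. hausdorff_content t \<delta> A)"

definition hausdorff_dim :: "'a::metric_space set \<Rightarrow> ereal" where
  "hausdorff_dim A =
     (if A = {} then - \<infinity> else Inf (ereal ` {t. 0 \<le> t \<and> hausdorff_measure t A = 0}))"


section \<open>Packing dimension\<close>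

text \<open>Packings of \<open>A\<close> by pairwise disjoint closed balls centred in \<open>A\<close>, a ball being given by its
  centre and radius. The supremum over finite packings equals the one over countable packings,
  since the summands are nonnegative.\<close>

definition packing_premeasure_at :: "real \<Rightarrow> real \<Rightarrow> 'a::metric_space set \<Rightarrow> ennreal" where
  "packing_premeasure_at t \<delta> A =
     (SUP F \<in> {F :: ('a \<times> real) set. finite F \<and> F \<subseteq> A \<times> {0<..\<delta>} \<and>
                 pairwise (\<lambda>(x, r) (y, q). disjnt (cball x r) (cball y q)) F}.
        (\<Sum>(x, r)\<in>F. ennreal ((2 * r) powr t)))"

definition packing_premeasure :: "real \<Rightarrow> 'a::metric_space set \<Rightarrow> ennreal" where
  "packing_premeasure t A = (INF \<delta> \<in> {0<..}. packing_premeasure_at t \<delta> A)"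

definition packing_measure :: "real \<Rightarrow> 'a::metric_space set \<Rightarrow> ennreal" where
  "packing_measure t A =
     (INF S \<in> {S :: nat \<Rightarrow> 'a set. A \<subseteq> (\<Union>i. S i)}. (\<Sum>i. packing_premeasure t (S i)))"

definition packing_dim :: "'a::metric_space set \<Rightarrow> ereal" where
  "packing_dim A =
     (if A = {} then - \<infinity> else Inf (ereal ` {t. 0 \<le> t \<and> packing_measure t A = 0}))"


section \<open>Analytic sets\<close>

text \<open>Continuous images of the Baire space: \<open>nat \<Rightarrow> nat\<close> carries the product of the discrete
  topologies.\<close>

definition analytic_set :: "'a::topological_space set \<Rightarrow> bool" where
  "analytic_set A \<longleftrightarrow> A = {} \<or> (\<exists>f :: (nat \<Rightarrow> nat) \<Rightarrow> 'a. continuous_on UNIV f \<and> range f = A)"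


section \<open>Stationary and exponentially mixing processes, Ahlfors regularity\<close>

text \<open>Processes are indexed by \<open>n \<ge> 1\<close>; the value \<open>\<xi> 0\<close> is never used.\<close>

definition stationary_process ::
    "'w measure \<Rightarrow> (nat \<Rightarrow> 'w \<Rightarrow> 'a::topological_space) \<Rightarrow> bool" where
  "stationary_process M \<xi> \<longleftrightarrow>
     (\<forall>n\<ge>1. \<xi> n \<in> measurable M borel) \<and>
     (\<forall>k. distr M (\<Pi>\<^sub>M i\<in>{1..}. borel) (\<lambda>\<omega>. \<lambda>i\<in>{1..}. \<xi> (i + k) \<omega>) =
          distr M (\<Pi>\<^sub>M i\<in>{1..}. borel) (\<lambda>\<omega>. \<lambda>i\<in>{1..}. \<xi> i \<omega>))"

definition future_events ::
    "'w measure \<Rightarrow> (nat \<Rightarrow> 'w \<Rightarrow> 'a::topological_space) \<Rightarrow> nat \<Rightarrow> 'w set set" where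
  "future_events M \<xi> n =
     sigma_sets (space M) {\<xi> (n + i) -` A \<inter> space M | i A. 1 \<le> i \<and> A \<in> sets borel}"

definition exponentially_mixing ::
    "'w measure \<Rightarrow> (nat \<Rightarrow> 'w \<Rightarrow> 'a::metric_space) \<Rightarrow> bool" where
  "exponentially_mixing M \<xi> \<longleftrightarrow>
     (\<exists>C>0. \<exists>\<rho>. 0 < \<rho> \<and> \<rho> < 1 \<and>
       (\<forall>n\<ge>1. \<forall>x. \<forall>r>0. \<forall>D \<in> future_events M \<xi> n. measure M D > 0 \<longrightarrow>
          \<bar>cond_prob M (\<lambda>\<omega>. \<xi> 1 \<omega> \<in> cball x r) (\<lambda>\<omega>. \<omega> \<in> D)
             - measure M {\<omega> \<in> space M. \<xi> 1 \<omega> \<in> cball x r}\<bar> \<le> C * \<rho> ^ n))"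

text \<open>If the space is a single point then its diameter is 0 and the condition is vacuous for every
  \<open>s\<close>; results assuming regularity with \<open>s > 0\<close> have to exclude this case separately.\<close>

definition ahlfors_regular :: "'a::metric_space measure \<Rightarrow> real \<Rightarrow> bool" where
  "ahlfors_regular \<mu> s \<longleftrightarrow>
     (\<exists>c\<ge>1. \<forall>x. \<forall>r. 0 < r \<and> r \<le> diameter (UNIV :: 'a set) \<longrightarrow>
        inverse c * r powr s \<le> measure \<mu> (cball x r) \<and> measure \<mu> (cball x r) \<le> c * r powr s)"


section \<open>Besicovitch--Taylor index and the covering set\<close>

text \<open>The supremum is over a nonempty set bounded by \<open>s\<close>, also in the case where
  \<open>\<Sum>\<^sub>n \<ell>\<^sub>n\<^sup>s\<close> diverges; the infimum in the lemma below would then be over the empty set.\<close>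

definition upper_BT_index :: "real \<Rightarrow> (nat \<Rightarrow> real) \<Rightarrow> real" where
  "upper_BT_index s l = Sup {t. t \<le> s \<and> \<not> summable (\<lambda>n. l (Suc n) powr t)}"

lemma upper_BT_index_eq_Inf:
  fixes l :: "nat \<Rightarrow> real"
  assumes pos: "\<And>n. n \<ge> 1 \<Longrightarrow> l n > 0" and lim: "l \<longlonglongrightarrow> 0"
    and s: "0 \<le> s" and conv: "summable (\<lambda>n. l (Suc n) powr s)"
  shows "upper_BT_index s l = Inf {t. t \<le> s \<and> summable (\<lambda>n. l (Suc n) powr t)}"
proof -
  define S where "S = {t. t \<le> s \<and> \<not> summable (\<lambda>n. l (Suc n) powr t)}"
  define T where "T = {t. t \<le> s \<and> summable (\<lambda>n. l (Suc n) powr t)}"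
  have mono: "summable (\<lambda>n. l (Suc n) powr u)"
    if "summable (\<lambda>n. l (Suc n) powr t)" "t \<le> u" for t u
  proof (rule summable_comparison_test_ev[OF _ that(1)])
    have "eventually (\<lambda>n. l n < 1) sequentially"
      using lim by (rule order_tendstoD) simp
    then have "eventually (\<lambda>n. l (Suc n) < 1) sequentially"
      by (rule eventually_compose_filterlim[OF _ filterlim_Suc])
    then show "eventually (\<lambda>n. norm (l (Suc n) powr u) \<le> l (Suc n) powr t) sequentially"
    proof eventually_elim
      case (elim n)
      then show ?case
        using powr_mono'[of t u "l (Suc n)"] pos[of "Suc n"] that(2) by simp
    qed
  qed
  have lt: "a < b" if "a \<in> S" "b \<in> T" for a b
    using that mono[of b a] unfolding S_def T_def by force
  have "(\<lambda>n. l (Suc n) powr 0) = (\<lambda>n. 1)"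
    using pos by (force simp: less_imp_neq[symmetric])
  then have S0: "0 \<in> S"
    using s by (simp add: S_def summable_const_iff)
  have Ts: "s \<in> T"
    using conv by (simp add: T_def)
  have bS: "bdd_above S" and bT: "bdd_below T"
    using lt[OF _ Ts] lt[OF S0] by (meson bdd_above.I bdd_below.I less_imp_le)+
  have "Sup S \<le> Inf T"
    using S0 Ts lt by (intro cSup_least cInf_greatest) (auto intro: less_imp_le)
  moreover have "\<not> Sup S < Inf T"
  proof
    assume "Sup S < Inf T"
    then obtain c where c: "Sup S < c" "c < Inf T"
      using dense by blast
    have "c \<le> s"
      using c(2) cInf_lower[OF Ts bT] by simp
    then have "c \<in> S \<or> c \<in> T"
      by (auto simp: S_def T_def)
    then show False
      using cSup_upper[OF _ bS, of c] cInf_lower[OF _ bT, of c] c by auto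
  qed
  ultimately show ?thesis
    unfolding upper_BT_index_def S_def T_def by simp
qed

definition limsup_balls ::
    "(nat \<Rightarrow> 'w \<Rightarrow> 'a::metric_space) \<Rightarrow> (nat \<Rightarrow> real) \<Rightarrow> 'w \<Rightarrow> 'a set" where
  "limsup_balls \<xi> l \<omega> = {y. \<exists>\<^sub>\<infinity>n. y \<in> cball (\<xi> n \<omega>) (l n)}"

end

theory Submission
  imports Defs "HOL-Real_Asymp.Real_Asymp"
begin

text \<open>
  Write \<open>E\<close> for the random limsup set. The two inequalities have independent proofs.

  For the upper bounds, let \<open>G\<close> have \<open>t\<close>-dimensional packing measure zero. Then \<open>G\<close> is a countable
  union of sets whose covering numbers at scale \<open>r\<close> are \<open>O(r\<^sup>-\<^sup>t)\<close>, and the \<open>n\<close>-th random ball meets such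
  a set with probability \<open>O(l n powr (s - t))\<close>. If \<open>\<theta> + s - t > \<alpha>\<close>, the expected sum of \<open>(2 * l n)\<^sup>\<theta>\<close>
  over the balls that meet the set is finite, so almost surely \<open>E \<inter> G\<close> has \<open>\<theta>\<close>-dimensional Hausdorff measure
  zero (\<open>AE_hausdorff_null\<close>). Letting \<open>\<theta>\<close> and \<open>t\<close> decrease gives the upper
  bound for the dimension; for \<open>\<theta> = 0\<close> the conclusion says that \<open>E \<inter> G\<close> is empty.

  For the lower bound, let \<open>0 < \<theta> < dim G + \<alpha> - s\<close>, and let \<open>G\<close> be the image of Baire space under a
  continuous map \<open>f\<close>. A net content on a tree of cells is continuous along increasing unions
  (\<open>net_content_UN_increasing\<close>), so there are boxes in Baire space that decrease to a compact box and whose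
  images have contents bounded away from zero. On the image of each box there are finitely supported
  probability weights that satisfy a Frostman condition down to any prescribed resolution
  (\<open>frostman_on_boxes\<close>).

  Since the series of the \<open>l n powr u\<close> diverges for some \<open>u\<close> with \<open>\<beta> < u\<close>, where \<open>\<beta> < \<alpha>\<close> is close to \<open>\<alpha>\<close>, there are
  arbitrarily small \<open>r\<close> with about \<open>r\<^sup>-\<^sup>\<beta>\<close> times at which the ball has radius at least \<open>r\<close> and which are so far
  apart that mixing makes them almost independent (\<open>exists_spaced_block\<close>). The normalised number of times
  in such a block whose point of the process hits the ball of radius \<open>r\<close> around \<open>x\<close> is a random density of mean
  almost 1. Multiplying these densities over a sequence of blocks with rapidly decreasing
  scales gives random measures that are carried by the points covered in each block. Two
  points are correlated in a block only if they are within \<open>2 * r\<close>, and then by a factor of order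
  \<open>r\<^sup>\<beta>\<^sup>-\<^sup>s\<close>; the Frostman condition makes the total contribution of these pairs to the second moment and
  to the expected \<open>\<theta>\<close>-energy as small as desired (\<open>weighted_pair_sum\<close>).

  Hence with probability close to 1, for infinitely many numbers of blocks the random measure has
  mass at least 1/2 and bounded energy (\<open>mass_energy_high_probability\<close>). By compactness and the
  Cauchy-Schwarz inequality, the set of points of the limiting compact image that are covered in every block cannot
  have \<open>\<theta>\<close>-dimensional Hausdorff measure zero (\<open>hausdorff_measure_pos_of_energy\<close>). This argument uses the finitely
  supported measures directly, without passing to a weak limit.
\<close>


section \<open>Auxiliary estimates\<close>

lemma ennreal_pos_obtain_real:
  assumes "0 < (\<eta> :: ennreal)"
  obtains q where "0 < q" "ennreal q < \<eta>"
proof -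
  obtain e where e: "0 < e" "e < \<eta>"
    using dense[OF assms] by auto
  then have "e < top" using top.not_eq_extremum by fastforce
  with e show ?thesis using that[of "enn2real e"] by (simp add: enn2real_positive_iff)
qed

lemma sum_half_powers_le:
  assumes "0 \<le> (c :: real)"
  shows "(\<Sum>k<n. c / 2 * (1/2) ^ k) \<le> c"
proof -
  have "(\<Sum>k<n. (1/2::real) ^ k) \<le> 2"
    using sum_gp_strict[of "1/2::real" n] by simp
  then have "c / 2 * (\<Sum>k<n. (1/2) ^ k) \<le> c"
    using assms mult_left_mono[of "\<Sum>k<n. (1/2::real) ^ k" 2 "c / 2"] by simp
  then show ?thesis by (simp only: sum_distrib_left)
qed

text \<open>Locates a radius between two consecutive powers of \<open>a\<close>. The lower end \<open>a ^ m\<close> is allowed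
  as the value of \<open>r\<close> itself, which is why the conclusion has \<open>\<le>\<close> on both sides.\<close>

lemma geometric_scale:
  fixes a r :: real
  assumes "0 < a" "a < 1" "a ^ m \<le> r" "r \<le> 1"
  obtains k where "k \<le> m" "r \<le> a ^ k" "a ^ Suc k \<le> r"
proof -
  have "\<exists>k\<le>m. r \<le> a ^ k \<and> a ^ Suc k \<le> r"
    using assms(3)
  proof (induction m)
    case 0
    then show ?case using assms by (intro exI[of _ 0]) (auto intro: order_trans[of a 1])
  next
    case (Suc m)
    show ?case
    proof (cases "a ^ m \<le> r")
      case True
      then show ?thesis using Suc.IH by (metis le_Suc_eq)
    next
      case False
      then show ?thesis using Suc.prems by (intro exI[of _ m]) auto
    qed
  qed
  then show ?thesis using that by blast
qed

lemma exists_half_power_below: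
  fixes r :: "nat \<Rightarrow> real"
  assumes "\<And>j. 0 < r j"
  obtains m where "J \<le> m" "\<And>j. j < J \<Longrightarrow> (1/2) ^ m \<le> r j"
proof -
  have "\<exists>m. (1/2) ^ m < r j" for j using real_arch_pow_inv[of "r j" "1/2"] assms[of j] by simp
  then obtain m where m: "\<And>j. (1/2) ^ m j < r j" by metis
  have "(1/2) ^ (J + (\<Sum>j<J. m j)) \<le> r j" if "j < J" for j
  proof -
    have "m j \<le> (\<Sum>j<J. m j)" using that by (intro member_le_sum) auto
    then have "(1/2::real) ^ (J + (\<Sum>j<J. m j)) \<le> (1/2) ^ m j" by (intro power_decreasing) auto
    then show ?thesis using less_imp_le[OF m[of j]] by (rule order_trans)
  qed
  then show ?thesis using that[of "J + (\<Sum>j<J. m j)"] by simp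
qed

section \<open>Null sets of Hausdorff measures\<close>

lemma hausdorff_measure_eq_0_iff:
  fixes A :: "'a::metric_space set"
  shows "hausdorff_measure t A = 0 \<longleftrightarrow>
    (\<forall>\<delta>>0. \<forall>\<eta>>0. \<exists>U. (\<forall>i::nat. bounded (U i) \<and> diameter (U i) \<le> \<delta>) \<and> A \<subseteq> (\<Union>i. U i) \<and>
        (\<Sum>i. diam_pow t (U i)) < \<eta>)" (is "_ = ?R")
proof -
  have "hausdorff_measure t A = 0 \<longleftrightarrow> (\<forall>\<delta>\<in>{0<..}. hausdorff_content t \<delta> A = 0)"
    unfolding hausdorff_measure_def bot_ennreal[symmetric] SUP_bot_conv ..
  moreover have "hausdorff_content t \<delta> A = 0 \<longleftrightarrow> (\<forall>\<eta>>0. hausdorff_content t \<delta> A < \<eta>)" for \<delta>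
    by (metis gr_zeroI less_irrefl)
  ultimately show ?thesis
    unfolding hausdorff_content_def INF_less_iff by auto
qed

lemma diameter_le_metric:
  fixes U :: "'a::metric_space set"
  assumes "0 \<le> d" "\<And>x y. x \<in> U \<Longrightarrow> y \<in> U \<Longrightarrow> dist x y \<le> d"
  shows "diameter U \<le> d"
  unfolding diameter_def using assms by (auto intro!: cSUP_least)

lemma diameter_cball_le:
  fixes x :: "'a::metric_space"
  assumes "0 \<le> r"
  shows "diameter (cball x r) \<le> 2 * r"
proof (rule diameter_le_metric)
  show "dist y z \<le> 2 * r" if "y \<in> cball x r" "z \<in> cball x r" for y z
    using that dist_triangle3[of y z x] by simp
qed (use assms in simp)

lemma diam_pow_antimono_exponent:
  assumes "0 \<le> t" "t \<le> u" "bounded U" "diameter U \<le> 1"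
  shows "diam_pow u U \<le> diam_pow t U"
  using assms powr_mono'[of t u "diameter U"] diameter_ge_0[of U]
  by (auto simp: diam_pow_def powr_le1 intro!: ennreal_leI)

text \<open>Only coverings by sets of diameter at most 1 are used; on these \<open>diam\<^sup>t\<close> decreases in \<open>t\<close>.\<close>

lemma hausdorff_measure_null_mono_exponent:
  fixes A :: "'a::metric_space set"
  assumes "0 \<le> t" "t \<le> u" "hausdorff_measure t A = 0"
  shows "hausdorff_measure u A = 0"
  unfolding hausdorff_measure_eq_0_iff
proof (intro allI impI)
  fix \<delta> :: real and \<eta> :: ennreal
  assume "\<delta> > 0" "\<eta> > 0"
  then have "min \<delta> 1 > 0" by simp
  with assms(3) \<open>\<eta> > 0\<close> obtain U where U: "\<And>i::nat. bounded (U i) \<and> diameter (U i) \<le> min \<delta> 1"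
      "A \<subseteq> (\<Union>i. U i)" "(\<Sum>i. diam_pow t (U i)) < \<eta>"
    unfolding hausdorff_measure_eq_0_iff by meson
  have "(\<Sum>i. diam_pow u (U i)) \<le> (\<Sum>i. diam_pow t (U i))"
    using U(1) assms(1,2) by (intro suminf_le diam_pow_antimono_exponent) auto
  then show "\<exists>U. (\<forall>i::nat. bounded (U i) \<and> diameter (U i) \<le> \<delta>) \<and> A \<subseteq> (\<Union>i. U i) \<and>
        (\<Sum>i. diam_pow u (U i)) < \<eta>"
    using U by (intro exI[of _ U]) (auto intro: le_less_trans)
qed

lemma hausdorff_measure_null_UN:
  fixes A :: "'a::metric_space set"
  assumes "A \<subseteq> (\<Union>j::nat. S j)" and null: "\<And>j. hausdorff_measure t (S j) = 0"
  shows "hausdorff_measure t A = 0"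
  unfolding hausdorff_measure_eq_0_iff
proof (intro allI impI)
  fix \<delta> :: real and \<eta> :: ennreal
  assume d: "\<delta> > 0" and e: "\<eta> > 0"
  obtain r where r: "0 < r" "ennreal r < \<eta>" using ennreal_pos_obtain_real[OF e] .
  have "\<exists>U. (\<forall>i::nat. bounded (U i) \<and> diameter (U i) \<le> \<delta>) \<and> S j \<subseteq> (\<Union>i. U i) \<and>
        (\<Sum>i. diam_pow t (U i)) < ennreal (r * (1/2)^Suc j)" for j
    using null[of j] d r(1) unfolding hausdorff_measure_eq_0_iff by (auto simp del: power_Suc)
  then obtain U where U: "\<And>j i. bounded (U j (i::nat)) \<and> diameter (U j i) \<le> \<delta>"
      "\<And>j. S j \<subseteq> (\<Union>i. U j i)" "\<And>j. (\<Sum>i. diam_pow t (U j i)) < ennreal (r * (1/2)^Suc j)"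
    by metis
  define V where "V = (\<lambda>n. case prod_decode n of (j, i) \<Rightarrow> U j i)"
  have "(\<Sum>n. diam_pow t (V n)) = (\<Sum>n. (\<lambda>(j,i). diam_pow t (U j i)) (prod_decode n))"
    by (simp add: V_def case_prod_beta)
  also have "\<dots> = (\<Sum>j. \<Sum>i. diam_pow t (U j i))"
    by (intro suminf_ennreal_2dimen) auto
  also have "\<dots> \<le> (\<Sum>j. ennreal (r * (1/2)^Suc j))"
    using U(3) by (intro suminf_le) (auto intro: less_imp_le)
  also have "\<dots> = ennreal (\<Sum>j. r * (1/2)^Suc j)"
    using r(1) sums_mult[OF power_half_series, of r]
    by (intro suminf_ennreal2) (auto simp: sums_iff)
  also have "\<dots> = ennreal r"
    using sums_mult[OF power_half_series, of r] by (simp add: sums_iff del: power_Suc)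
  also have "\<dots> < \<eta>" by (rule r(2))
  finally have "(\<Sum>n. diam_pow t (V n)) < \<eta>" .
  moreover have "A \<subseteq> (\<Union>n. V n)"
  proof
    fix x assume "x \<in> A"
    then obtain j i where "x \<in> U j i" using assms(1) U(2) by blast
    then have "x \<in> V (prod_encode (j, i))" by (simp add: V_def)
    then show "x \<in> (\<Union>n. V n)" by blast
  qed
  ultimately show "\<exists>U. (\<forall>i::nat. bounded (U i) \<and> diameter (U i) \<le> \<delta>) \<and> A \<subseteq> (\<Union>i. U i) \<and>
        (\<Sum>i. diam_pow t (U i)) < \<eta>"
    using U(1) by (intro exI[of _ V]) (auto simp: V_def split: prod.split)
qed

text \<open>With \<open>diam\<^sup>0 = 1\<close> on nonempty sets, zero-dimensional measure counts points. This turns the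
  statement that the intersection is empty into the case \<open>\<theta> = 0\<close> of a null-measure statement.\<close>

lemma hausdorff_measure_0_eq_0:
  fixes A :: "'a::metric_space set"
  assumes "hausdorff_measure 0 A = 0"
  shows "A = {}"
proof (rule ccontr)
  assume "A \<noteq> {}"
  obtain U where U: "A \<subseteq> (\<Union>i::nat. U i)" "(\<Sum>i. diam_pow 0 (U i)) < 1"
    using assms unfolding hausdorff_measure_eq_0_iff by (metis zero_less_one)
  with \<open>A \<noteq> {}\<close> obtain i where "U i \<noteq> {}" by blast
  then have "1 = (\<Sum>i\<in>{i}. diam_pow 0 (U i))" by (simp add: diam_pow_def)
  also have "\<dots> \<le> (\<Sum>i. diam_pow 0 (U i))" by (intro sum_le_suminf) auto
  finally show False using U(2) by simp
qed

lemma hausdorff_measure_empty [simp]: "hausdorff_measure t {} = 0"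
  unfolding hausdorff_measure_eq_0_iff
  by (intro allI impI exI[of _ "\<lambda>_. {}"]) (auto simp: diam_pow_def)

lemma hausdorff_dim_le:
  assumes "0 \<le> t" "hausdorff_measure t A = 0"
  shows "hausdorff_dim A \<le> ereal t"
  unfolding hausdorff_dim_def using assms by (auto intro!: Inf_lower)

text \<open>It suffices to test real exponents below the bound: the exponents of measure zero form an up-set.\<close>

lemma hausdorff_dim_ge:
  fixes A :: "'a::metric_space set"
  assumes "0 < d" and pos: "\<And>t. 0 < t \<Longrightarrow> ereal t < d \<Longrightarrow> hausdorff_measure t A \<noteq> 0"
  shows "d \<le> hausdorff_dim A"
proof -
  obtain t0 where t0: "0 < ereal t0" "ereal t0 < d" using ereal_dense2[OF assms(1)] by auto
  then have "A \<noteq> {}" using pos[of t0] by auto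
  moreover have "d \<le> ereal t" if "0 \<le> t" "hausdorff_measure t A = 0" for t
  proof (rule ccontr)
    assume "\<not> d \<le> ereal t"
    then obtain u where u: "ereal t < ereal u" "ereal u < d" using ereal_dense2[of "ereal t" d] by (auto simp: not_le)
    then show False
      using pos[of u] hausdorff_measure_null_mono_exponent[OF that(1) _ that(2), of u] that(1) by simp
  qed
  ultimately show ?thesis
    unfolding hausdorff_dim_def by (auto intro!: Inf_greatest)
qed

lemma hausdorff_measure_pos_if_less_dim:
  fixes A :: "'a::metric_space set"
  assumes "0 \<le> t" "ereal t < hausdorff_dim A"
  shows "hausdorff_measure t A \<noteq> 0"
  using hausdorff_dim_le[OF assms(1), of A] assms(2) by (auto simp: not_less[symmetric])

section \<open>Packing measure and covering numbers\<close>

text \<open>A packing by disjoint balls of the common radius \<open>r\<close> has boundedly many members, so there is a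
  largest one; doubling its radii covers \<open>S\<close>, since any uncovered point could be added.\<close>

lemma covering_of_packing_premeasure_at:
  fixes S :: "'a::metric_space set"
  assumes r: "0 < r" "r \<le> \<delta>" and fin: "packing_premeasure_at t \<delta> S \<le> ennreal K" and "0 \<le> K"
  obtains F where "finite F" "F \<subseteq> S" "real (card F) * (2 * r) powr t \<le> K"
    "S \<subseteq> (\<Union>x\<in>F. cball x (2 * r))"
proof -
  define P where "P F \<longleftrightarrow> finite F \<and> F \<subseteq> S \<and> pairwise (\<lambda>x y. disjnt (cball x r) (cball y r)) F" for F
  have bound: "real (card F) * (2 * r) powr t \<le> K" if "P F" for F
  proof -
    have "(\<Sum>(x, q)\<in>F \<times> {r}. ennreal ((2 * q) powr t)) \<le> packing_premeasure_at t \<delta> S"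
      unfolding packing_premeasure_at_def
      using that r by (intro SUP_upper) (auto simp: P_def pairwise_def)
    also note fin
    finally have "(\<Sum>(x, q)\<in>F \<times> {r}. ennreal ((2 * q) powr t)) \<le> ennreal K" .
    moreover have "(\<Sum>(x, q)\<in>F \<times> {r}. ennreal ((2 * q) powr t)) = ennreal (real (card F) * (2 * r) powr t)"
      by (subst sum.cartesian_product[symmetric]) (simp add: ennreal_mult' ennreal_of_nat_eq_real_of_nat)
    ultimately show ?thesis using \<open>0 \<le> K\<close> by simp
  qed
  have "card F \<le> nat \<lfloor>K / (2 * r) powr t\<rfloor>" if "P F" for F
    using bound[OF that] r by (simp add: le_nat_floor field_simps)
  then have "\<forall>F. P F \<longrightarrow> card F < Suc (nat \<lfloor>K / (2 * r) powr t\<rfloor>)" by (simp add: le_imp_less_Suc)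
  moreover have "P {}" by (simp add: P_def)
  ultimately obtain F where F: "P F" "\<And>F'. P F' \<Longrightarrow> card F' \<le> card F"
    using ex_has_greatest_nat[of P "{}" card] by blast
  have "S \<subseteq> (\<Union>x\<in>F. cball x (2 * r))"
  proof
    fix y assume y: "y \<in> S"
    show "y \<in> (\<Union>x\<in>F. cball x (2 * r))"
    proof (rule ccontr)
      assume n: "y \<notin> (\<Union>x\<in>F. cball x (2 * r))"
      have far: "disjnt (cball x r) (cball y r)" if "x \<in> F" for x
      proof (rule ccontr)
        assume "\<not> ?thesis"
        then obtain z where "dist x z \<le> r" "dist y z \<le> r" by (auto simp: disjnt_iff)
        then have "dist x y \<le> 2 * r" using dist_triangle2[of x y z] by simp
        with n that show False by auto
      qed
      have "P (insert y F)"
        using F(1) y far by (auto simp: P_def pairwise_insert disjnt_sym)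
      then have "card (insert y F) \<le> card F" by (rule F(2))
      moreover have "y \<notin> F" using n r by auto
      ultimately show False using F(1) by (simp add: P_def)
    qed
  qed
  then show ?thesis using that[of F] F(1) bound[OF F(1)] by (simp add: P_def)
qed

text \<open>Packing measure zero is used only through this countable decomposition: each piece has covering
  numbers \<open>O(r\<^sup>-\<^sup>t)\<close>, that is, upper box dimension at most \<open>t\<close>.\<close>

lemma packing_measure_null_cover:
  fixes G :: "'a::metric_space set"
  assumes "packing_measure t G = 0"
  obtains S :: "nat \<Rightarrow> 'a set" where "G \<subseteq> (\<Union>i. S i)" "\<And>i. \<exists>\<delta>>0. \<exists>K\<ge>0. packing_premeasure_at t \<delta> (S i) \<le> ennreal K"
proof -
  have "packing_measure t G < 1" using assms by simp
  then obtain S :: "nat \<Rightarrow> 'a set" where S: "G \<subseteq> (\<Union>i. S i)" "(\<Sum>i. packing_premeasure t (S i)) < 1"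
    unfolding packing_measure_def INF_less_iff by auto
  have "\<exists>\<delta>>0. \<exists>K\<ge>0. packing_premeasure_at t \<delta> (S i) \<le> ennreal K" for i
  proof -
    have "packing_premeasure t (S i) = (\<Sum>i\<in>{i}. packing_premeasure t (S i))" by simp
    also have "\<dots> \<le> (\<Sum>i. packing_premeasure t (S i))" by (intro sum_le_suminf) auto
    also have "\<dots> < 1" by (rule S(2))
    finally obtain \<delta> where "\<delta> > 0" "packing_premeasure_at t \<delta> (S i) < 1"
      unfolding packing_premeasure_def INF_less_iff by auto
    then show ?thesis by (intro exI[of _ \<delta>] conjI exI[of _ 1]) auto
  qed
  then show ?thesis using that S(1) by blast
qed

lemma packing_dim_null:
  assumes "packing_dim G < d" "G \<noteq> {}"
  obtains t where "0 \<le> t" "ereal t < d" "packing_measure t G = 0"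
  using assms unfolding packing_dim_def by (auto simp: Inf_less_iff)


section \<open>The covering process\<close>

text \<open>The process in the form in which it is used: mixing is stated for an arbitrary starting time
  \<open>Suc k\<close> and without conditional probabilities, and the two bounds for the measure of balls hold
  for all radii that can occur, not only for those below the diameter.\<close>

locale covering_process = prob_space M for M :: "'w measure" +
  fixes \<xi> :: "nat \<Rightarrow> 'w \<Rightarrow> 'a::metric_space" and \<mu> :: "'a measure" and s C \<rho> c :: real
  assumes measurable_process: "\<And>n. 1 \<le> n \<Longrightarrow> \<xi> n \<in> measurable M borel"
    and distr_process: "\<And>n. 1 \<le> n \<Longrightarrow> distr M borel (\<xi> n) = \<mu>"
    and s_pos: "0 < s" and c_ge_1: "1 \<le> c" and C_pos: "0 < C" and \<rho>: "0 < \<rho>" "\<rho> < 1"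
    and ball_upper: "\<And>x r. 0 < r \<Longrightarrow> measure \<mu> (cball x r) \<le> c * r powr s"
    and ball_lower: "\<And>x r. 0 < r \<Longrightarrow> r \<le> 1 \<Longrightarrow> r powr s / c \<le> measure \<mu> (cball x r)"
    and mixing: "\<And>k g x r D. 1 \<le> g \<Longrightarrow> 0 < r \<Longrightarrow> D \<in> future_events M \<xi> (k + g) \<Longrightarrow>
      \<bar>measure M ({\<omega> \<in> space M. \<xi> (Suc k) \<omega> \<in> cball x r} \<inter> D) - measure \<mu> (cball x r) * measure M D\<bar>
        \<le> C * \<rho> ^ g * measure M D"
begin

lemma measure_ball_process:
  assumes "1 \<le> n"
  shows "measure M {\<omega> \<in> space M. \<xi> n \<omega> \<in> cball x r} = measure \<mu> (cball x r)"
proof -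
  have "measure (distr M borel (\<xi> n)) (cball x r) = measure M (\<xi> n -` cball x r \<inter> space M)"
    using measurable_process[OF assms] by (intro measure_distr) auto
  moreover have "\<xi> n -` cball x r \<inter> space M = {\<omega> \<in> space M. \<xi> n \<omega> \<in> cball x r}" by auto
  ultimately show ?thesis using distr_process[OF assms] by simp
qed

lemma sets_ball_process [measurable]:
  assumes "1 \<le> n"
  shows "{\<omega> \<in> space M. \<xi> n \<omega> \<in> cball x r} \<in> events"
proof -
  have "\<xi> n -` cball x r \<inter> space M \<in> events"
    using measurable_process[OF assms] by (rule measurable_sets) auto
  moreover have "\<xi> n -` cball x r \<inter> space M = {\<omega> \<in> space M. \<xi> n \<omega> \<in> cball x r}" by auto
  ultimately show ?thesis by simp
qed

section \<open>The upper bound\<close>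

text \<open>A piece \<open>S\<close> with covering numbers \<open>O(r\<^sup>-\<^sup>t)\<close> meets the \<open>n\<close>-th ball only if \<open>\<xi> n\<close> lies in one of
  \<open>O(l n powr - t)\<close> balls of radius \<open>3 * l n\<close>, an event of probability \<open>O(l n powr (s - t))\<close>.
  Hence the sum of \<open>(2 * l n)\<^sup>\<theta>\<close> over the \<open>n\<close> for which this happens has finite expectation.
  Almost surely it converges, and its tails bound the Hausdorff sums of the natural coverings
  of the limsup set within \<open>S\<close>.\<close>

lemma AE_hausdorff_null_piece:
  fixes l :: "nat \<Rightarrow> real" and S :: "'a set"
  assumes l_pos: "\<And>n. 1 \<le> n \<Longrightarrow> 0 < l n" and l_lim: "l \<longlonglongrightarrow> 0"
    and \<theta>: "0 \<le> \<theta>" and sm: "summable (\<lambda>n. l (Suc n) powr (\<theta> + s - t))"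
    and \<delta>: "0 < \<delta>" and K: "0 \<le> K" "packing_premeasure_at t \<delta> S \<le> ennreal K"
  shows "AE \<omega> in M. hausdorff_measure \<theta> (limsup_balls \<xi> l \<omega> \<inter> S) = 0"
proof -
  have "eventually (\<lambda>n. l n < \<delta>) sequentially"
    using l_lim \<delta> by (rule order_tendstoD)
  then obtain n0 where n0: "\<And>n. n \<ge> n0 \<Longrightarrow> l n < \<delta>"
    by (auto simp: eventually_sequentially)
  define n1 where "n1 = Suc n0"
  have ln: "0 < l n" "l n \<le> \<delta>" "1 \<le> n" if "n \<ge> n1" for n
    using that l_pos[of n] n0[of n] by (auto simp: n1_def)
  have "\<exists>F. finite F \<and> F \<subseteq> S \<and> real (card F) * (2 * l n) powr t \<le> K \<and> S \<subseteq> (\<Union>x\<in>F. cball x (2 * l n))"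
    if "n \<ge> n1" for n
    by (rule covering_of_packing_premeasure_at[OF ln(1,2)[OF that] K(2,1)]) (intro exI conjI)
  then obtain F where F: "\<And>n. n \<ge> n1 \<Longrightarrow> finite (F n)"
      "\<And>n. n \<ge> n1 \<Longrightarrow> real (card (F n)) * (2 * l n) powr t \<le> K"
      "\<And>n. n \<ge> n1 \<Longrightarrow> S \<subseteq> (\<Union>x\<in>F n. cball x (2 * l n))"
    by metis
  define Ev where "Ev n = (\<Union>x\<in>F n. {\<omega> \<in> space M. \<xi> n \<omega> \<in> cball x (3 * l n)})" for n
  have Ev[measurable]: "Ev n \<in> events" if "n \<ge> n1" for n
    unfolding Ev_def using F(1)[OF that] ln(3)[OF that] by (intro sets.finite_UN sets_ball_process) auto
  define K' where "K' = K * c * 3 powr s * 2 powr (- t)"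
  have prob_Ev: "measure M (Ev n) \<le> K' * l n powr (s - t)" if n: "n \<ge> n1" for n
  proof -
    have "measure M (Ev n) \<le> (\<Sum>x\<in>F n. measure M {\<omega> \<in> space M. \<xi> n \<omega> \<in> cball x (3 * l n)})"
      unfolding Ev_def using F(1)[OF n] ln(3)[OF n]
      by (intro finite_measure_subadditive_finite) (auto simp del: mem_cball intro: sets_ball_process)
    also have "\<dots> \<le> (\<Sum>x\<in>F n. c * (3 * l n) powr s)"
      using ln[OF n] ball_upper[of "3 * l n"] by (intro sum_mono) (simp add: measure_ball_process del: mem_cball)
    also have "\<dots> = real (card (F n)) * (2 * l n) powr t * (c * (3 * l n) powr s * (2 * l n) powr (- t))"
      using ln[OF n] by (simp add: powr_minus)
    also have "\<dots> \<le> K * (c * (3 * l n) powr s * (2 * l n) powr (- t))"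
      using F(2)[OF n] c_ge_1 by (intro mult_right_mono) auto
    also have "\<dots> = K' * l n powr (s - t)"
      using ln[OF n] by (simp add: K'_def powr_mult powr_diff powr_minus field_simps)
    finally show ?thesis .
  qed
  define a where "a i \<omega> = (2 * l (n1 + i)) powr \<theta> * indicator (Ev (n1 + i)) \<omega>" for i \<omega>
  have a_nonneg: "0 \<le> a i \<omega>" for i \<omega> by (simp add: a_def)
  have a_meas[measurable]: "(\<lambda>\<omega>. ennreal (a i \<omega>)) \<in> borel_measurable M" for i
    unfolding a_def by simp
  have "(\<integral>\<^sup>+\<omega>. (\<Sum>i. ennreal (a i \<omega>)) \<partial>M) = (\<Sum>i. \<integral>\<^sup>+\<omega>. ennreal (a i \<omega>) \<partial>M)"
    by (rule nn_integral_suminf) auto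
  also have "\<dots> \<le> (\<Sum>i. ennreal (2 powr \<theta> * K' * l (n1 + i) powr (\<theta> + s - t)))"
  proof (intro suminf_le allI)
    fix i
    have "(\<integral>\<^sup>+\<omega>. ennreal (a i \<omega>) \<partial>M) = ennreal ((2 * l (n1 + i)) powr \<theta>) * emeasure M (Ev (n1 + i))"
      unfolding a_def by (simp add: ennreal_mult' ennreal_indicator nn_integral_cmult_indicator)
    also have "\<dots> = ennreal ((2 * l (n1 + i)) powr \<theta> * measure M (Ev (n1 + i)))"
      by (simp add: emeasure_eq_measure ennreal_mult')
    also have "\<dots> \<le> ennreal ((2 * l (n1 + i)) powr \<theta> * (K' * l (n1 + i) powr (s - t)))"
      by (intro ennreal_leI mult_left_mono prob_Ev) auto
    also have "(2 * l (n1 + i)) powr \<theta> * (K' * l (n1 + i) powr (s - t))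
        = 2 powr \<theta> * K' * l (n1 + i) powr (\<theta> + s - t)"
      using ln(1)[of "n1 + i"] by (simp add: powr_mult powr_add[symmetric] algebra_simps)
    finally show "(\<integral>\<^sup>+\<omega>. ennreal (a i \<omega>) \<partial>M) \<le> ennreal (2 powr \<theta> * K' * l (n1 + i) powr (\<theta> + s - t))" .
  qed auto
  also have "\<dots> < \<infinity>"
  proof -
    have "summable (\<lambda>i. l (Suc (i + n0)) powr (\<theta> + s - t))"
      using sm by (subst summable_iff_shift)
    then have "summable (\<lambda>i. 2 powr \<theta> * K' * l (n1 + i) powr (\<theta> + s - t))"
      by (intro summable_mult) (simp add: n1_def add.commute)
    moreover have "0 \<le> K'" using K c_ge_1 by (simp add: K'_def)
    ultimately show ?thesis by (subst suminf_ennreal2) auto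
  qed
  finally have "(\<integral>\<^sup>+\<omega>. (\<Sum>i. ennreal (a i \<omega>)) \<partial>M) \<noteq> \<infinity>" by simp
  then have "AE \<omega> in M. (\<Sum>i. ennreal (a i \<omega>)) \<noteq> \<infinity>"
    by (intro nn_integral_noteq_infinite) auto
  then show ?thesis
  proof (rule AE_mp, intro AE_I2 impI)
    fix \<omega> assume \<omega>: "\<omega> \<in> space M" "(\<Sum>i. ennreal (a i \<omega>)) \<noteq> \<infinity>"
    have sa: "summable (\<lambda>i. a i \<omega>)"
      using \<omega>(2) a_nonneg by (intro summable_suminf_not_top) auto
    show "hausdorff_measure \<theta> (limsup_balls \<xi> l \<omega> \<inter> S) = 0"
      unfolding hausdorff_measure_eq_0_iff
    proof (intro allI impI)
      fix d :: real and \<eta> :: ennreal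
      assume d: "d > 0" and "\<eta> > 0"
      obtain q where q: "0 < q" "ennreal q < \<eta>" using ennreal_pos_obtain_real[OF \<open>\<eta> > 0\<close>] .
      obtain N1 where N1: "\<And>n. n \<ge> N1 \<Longrightarrow> norm (\<Sum>i. a (i + n) \<omega>) < q"
        using suminf_exist_split[OF q(1) sa] by blast
      have "eventually (\<lambda>n. l n < d / 2) sequentially"
        using l_lim d by (intro order_tendstoD(2)) auto
      then obtain N2 where N2: "\<And>n. n \<ge> N2 \<Longrightarrow> l n < d / 2"
        by (auto simp: eventually_sequentially)
      define m where "m = max N1 N2"
      define U where "U i = (if \<omega> \<in> Ev (n1 + (i + m)) then cball (\<xi> (n1 + (i + m)) \<omega>) (l (n1 + (i + m))) else {})"
        for i
      have diam: "diameter (U i) \<le> 2 * l (n1 + (i + m))" for i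
        unfolding U_def using ln(1)[of "n1 + (i + m)"] by (auto intro: diameter_cball_le)
      show "\<exists>U. (\<forall>i::nat. bounded (U i) \<and> diameter (U i) \<le> d) \<and> limsup_balls \<xi> l \<omega> \<inter> S \<subseteq> (\<Union>i. U i) \<and>
          (\<Sum>i. diam_pow \<theta> (U i)) < \<eta>"
      proof (intro exI[of _ U] conjI allI)
        fix i
        show "bounded (U i)" by (simp add: U_def)
        have "l (n1 + (i + m)) < d / 2" by (rule N2) (simp add: m_def)
        then show "diameter (U i) \<le> d" using diam[of i] by simp
      next
        show "limsup_balls \<xi> l \<omega> \<inter> S \<subseteq> (\<Union>i. U i)"
        proof
          fix y assume y: "y \<in> limsup_balls \<xi> l \<omega> \<inter> S"
          then obtain n where n: "n \<ge> n1 + m" "y \<in> cball (\<xi> n \<omega>) (l n)"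
            unfolding limsup_balls_def INFM_nat_le by auto
          then have n': "n \<ge> n1" by simp
          obtain x where x: "x \<in> F n" "dist x y \<le> 2 * l n" using y F(3)[OF n'] by auto
          have "dist x (\<xi> n \<omega>) \<le> 3 * l n"
            using x(2) n(2) dist_triangle[of x "\<xi> n \<omega>" y] by (simp add: dist_commute)
          then have "\<omega> \<in> Ev n" using x(1) \<omega>(1) by (auto simp: Ev_def)
          moreover have "n1 + (n - n1 - m + m) = n" using n(1) by simp
          ultimately have "y \<in> U (n - n1 - m)" using n(2) by (simp add: U_def)
          then show "y \<in> (\<Union>i. U i)" by blast
        qed
      next
        have "diam_pow \<theta> (U i) \<le> ennreal (a (i + m) \<omega>)" for i
        proof (cases "\<omega> \<in> Ev (n1 + (i + m))")
          case True
          have "diameter (U i) powr \<theta> \<le> (2 * l (n1 + (i + m))) powr \<theta>"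
            using diam[of i] \<theta> diameter_ge_0[of "U i"] by (intro powr_mono2) (auto simp: U_def)
          then show ?thesis using True ln(1)[of "n1 + (i + m)"]
            by (auto simp: diam_pow_def a_def ennreal_leI)
        qed (simp add: U_def diam_pow_def)
        then have "(\<Sum>i. diam_pow \<theta> (U i)) \<le> (\<Sum>i. ennreal (a (i + m) \<omega>))"
          by (intro suminf_le) auto
        also have "\<dots> = ennreal (\<Sum>i. a (i + m) \<omega>)"
          using a_nonneg by (intro suminf_ennreal2 summable_ignore_initial_segment[OF sa])
        also have "\<dots> \<le> ennreal q"
          using N1[of m] by (intro ennreal_leI) (simp add: m_def)
        finally show "(\<Sum>i. diam_pow \<theta> (U i)) < \<eta>" using q(2) by simp
      qed
    qed
  qed
qed

lemma AE_hausdorff_null: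
  fixes l :: "nat \<Rightarrow> real" and G :: "'a set"
  assumes "\<And>n. 1 \<le> n \<Longrightarrow> 0 < l n" "l \<longlonglongrightarrow> 0" "0 \<le> \<theta>"
    and "summable (\<lambda>n. l (Suc n) powr (\<theta> + s - t))" "packing_measure t G = 0"
  shows "AE \<omega> in M. hausdorff_measure \<theta> (limsup_balls \<xi> l \<omega> \<inter> G) = 0"
proof -
  obtain S :: "nat \<Rightarrow> 'a set" where S: "G \<subseteq> (\<Union>i. S i)"
      "\<And>i. \<exists>\<delta>>0. \<exists>K\<ge>0. packing_premeasure_at t \<delta> (S i) \<le> ennreal K"
    using packing_measure_null_cover[OF assms(5)] by blast
  have "AE \<omega> in M. hausdorff_measure \<theta> (limsup_balls \<xi> l \<omega> \<inter> S i) = 0" for i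
    using S(2)[of i] AE_hausdorff_null_piece[OF assms(1-4)] by blast
  then have "AE \<omega> in M. \<forall>i. hausdorff_measure \<theta> (limsup_balls \<xi> l \<omega> \<inter> S i) = 0"
    by (simp add: AE_all_countable)
  then show ?thesis
  proof eventually_elim
    case (elim \<omega>)
    show ?case
      by (rule hausdorff_measure_null_UN[where S="\<lambda>i. limsup_balls \<xi> l \<omega> \<inter> S i"]) (use S(1) elim in auto)
  qed
qed

end


section \<open>Net content on a tree of cells\<close>

text \<open>The address of a point in a tree of cells: \<open>q i\<close> rounds a point to a net of mesh \<open>a ^ Suc i\<close>,
  and the cell of \<open>x\<close> at depth \<open>k\<close> consists of the points with the same first \<open>k\<close> roundings.
  Cells defined in this way are nested for any choice of the roundings.\<close>

definition node :: "(nat \<Rightarrow> 'a \<Rightarrow> 'a) \<Rightarrow> nat \<Rightarrow> 'a \<Rightarrow> 'a list" where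
  "node q k x = map (\<lambda>i. q i x) [0..<k]"

lemma length_node [simp]: "length (node q k x) = k"
  by (simp add: node_def)

lemma take_node [simp]: "k \<le> m \<Longrightarrow> take k (node q m x) = node q k x"
  by (simp add: node_def take_map)

lemma node_0 [simp]: "node q 0 x = []"
  by (simp add: node_def)

lemma node_Suc: "node q (Suc k) x = node q k x @ [q k x]"
  by (simp add: node_def)

lemma node_eq_mono: "node q m x = node q m y \<Longrightarrow> k \<le> m \<Longrightarrow> node q k x = node q k y"
  using take_node by metis

locale cell_tree =
  fixes q :: "nat \<Rightarrow> 'a::metric_space \<Rightarrow> 'a" and a t :: real
  assumes a: "0 < a" "a < 1" and t_pos: "0 < t"
begin

definition covers :: "'a list set \<Rightarrow> 'a set \<Rightarrow> bool" where
  "covers \<C> A \<longleftrightarrow> (\<forall>x\<in>A. \<exists>k. node q k x \<in> \<C>)"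

definition weight :: "'a list \<Rightarrow> real" where
  "weight v = (a ^ length v) powr t"

lemma weight_nonneg [simp]: "0 \<le> weight v" and weight_Nil [simp]: "weight [] = 1"
  by (simp_all add: weight_def)

definition cost :: "'a list set \<Rightarrow> ennreal" where
  "cost \<C> = (\<integral>\<^sup>+v. ennreal (weight v) * indicator \<C> v \<partial>count_space UNIV)"

text \<open>Hausdorff content with respect to coverings by cells, where a cell of depth \<open>k\<close> has weight
  \<open>(a ^ k)\<^sup>t\<close>. The tree structure makes it strongly subadditive, so that it passes to increasing
  unions of arbitrary sets.\<close>

definition net_content :: "'a set \<Rightarrow> ennreal" where
  "net_content A = (INF \<C>\<in>{\<C>. covers \<C> A}. cost \<C>)"

text \<open>The maximal cells of a family, that is, those whose address has no proper prefix in the family.\<close>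

definition top_nodes :: "'a list set \<Rightarrow> 'a list set" where
  "top_nodes \<C> = {v \<in> \<C>. \<forall>k<length v. take k v \<notin> \<C>}"

lemma covers_mono: "covers \<C> B \<Longrightarrow> A \<subseteq> B \<Longrightarrow> covers \<C> A"
  by (auto simp: covers_def)

lemma net_content_le_cost: "covers \<C> A \<Longrightarrow> net_content A \<le> cost \<C>"
  unfolding net_content_def by (intro INF_lower) simp

lemma cost_finite:
  assumes "finite \<C>"
  shows "cost \<C> = ennreal (\<Sum>v\<in>\<C>. weight v)"
proof -
  have "cost \<C> = (\<Sum>v\<in>\<C>. ennreal (weight v) * indicator \<C> v)"
    unfolding cost_def using assms by (intro nn_integral_count_space') auto
  also have "\<dots> = (\<Sum>v\<in>\<C>. ennreal (weight v))"
    by (intro sum.cong) auto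
  finally show ?thesis by simp
qed

lemma net_content_le_1: "net_content A \<le> 1"
proof -
  have "net_content A \<le> cost {[]}"
    by (intro net_content_le_cost) (auto simp: covers_def intro: exI[of _ 0])
  also have "\<dots> = 1" by (simp add: cost_finite)
  finally show ?thesis .
qed

lemma covers_top_nodes_le:
  assumes "node q k x \<in> \<C>"
  obtains j where "j \<le> k" "node q j x \<in> top_nodes \<C>"
proof -
  define j where "j = (LEAST j. node q j x \<in> \<C>)"
  have "node q j x \<in> \<C>" "j \<le> k" unfolding j_def using assms by (auto intro: LeastI Least_le)
  moreover have "node q i x \<notin> \<C>" if "i < j" for i
    using that not_less_Least[of i "\<lambda>j. node q j x \<in> \<C>"] by (simp add: j_def)
  ultimately show ?thesis using that by (auto simp: top_nodes_def)
qed

lemma covers_top_nodes: "covers \<C> A \<Longrightarrow> covers (top_nodes \<C>) A"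
  unfolding covers_def by (metis covers_top_nodes_le)

text \<open>Strong subadditivity. The family \<open>\<I>\<close> of cells of one family contained in a cell of the other
  again covers \<open>A\<close>, because two cells containing the same point are comparable. A cell of
  \<open>\<U> \<union> \<V>\<close> lies in \<open>\<I>\<close> and among the maximal cells at the same time only if it belongs to
  both families.\<close>

lemma cost_submodular:
  assumes "covers \<U> A" "covers \<V> A"
  shows "cost (top_nodes (\<U> \<union> \<V>)) + net_content A \<le> cost \<U> + cost \<V>"
proof -
  define \<I> where "\<I> = {v \<in> \<U>. \<exists>k\<le>length v. take k v \<in> \<V>} \<union> {v \<in> \<V>. \<exists>k\<le>length v. take k v \<in> \<U>}"
  have "covers \<I> A"
    unfolding covers_def
  proof
    fix x assume "x \<in> A"
    then obtain i j where ij: "node q i x \<in> \<U>" "node q j x \<in> \<V>"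
      using assms \<open>x \<in> A\<close> unfolding covers_def by blast
    show "\<exists>k. node q k x \<in> \<I>"
    proof (cases "i \<le> j")
      case True
      then have "node q j x \<in> \<I>" using ij by (auto simp: \<I>_def intro!: exI[of _ i])
      then show ?thesis ..
    next
      case False
      then have "node q i x \<in> \<I>" using ij by (auto simp: \<I>_def intro!: exI[of _ j])
      then show ?thesis ..
    qed
  qed
  then have "cost (top_nodes (\<U> \<union> \<V>)) + net_content A \<le> cost (top_nodes (\<U> \<union> \<V>)) + cost \<I>"
    by (intro add_left_mono net_content_le_cost)
  also have "\<dots> = (\<integral>\<^sup>+v. ennreal (weight v) * indicator (top_nodes (\<U> \<union> \<V>)) v
      + ennreal (weight v) * indicator \<I> v \<partial>count_space UNIV)"
    unfolding cost_def by (intro nn_integral_add[symmetric]) auto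
  also have "\<dots> \<le> (\<integral>\<^sup>+v. ennreal (weight v) * indicator \<U> v
      + ennreal (weight v) * indicator \<V> v \<partial>count_space UNIV)"
  proof (intro nn_integral_mono)
    fix v :: "'a list"
    have eq: "take k v = v" if "k \<le> length v" "\<not> k < length v" for k using that by simp
    have "indicator (top_nodes (\<U> \<union> \<V>)) v + indicator \<I> v \<le> (indicator \<U> v + indicator \<V> v :: ennreal)"
    proof (cases "v \<in> \<U> \<and> v \<in> \<V>")
      case True
      then show ?thesis by (auto simp: indicator_def)
    next
      case False
      then have "v \<notin> top_nodes (\<U> \<union> \<V>) \<or> v \<notin> \<I>"
        unfolding top_nodes_def \<I>_def using eq by (auto simp: le_less) 
      moreover have "v \<in> \<U> \<union> \<V>" if "v \<in> top_nodes (\<U> \<union> \<V>) \<or> v \<in> \<I>"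
        using that by (auto simp: top_nodes_def \<I>_def)
      ultimately show ?thesis by (auto simp: indicator_def)
    qed
    then show "ennreal (weight v) * indicator (top_nodes (\<U> \<union> \<V>)) v
        + ennreal (weight v) * indicator \<I> v
        \<le> ennreal (weight v) * indicator \<U> v + ennreal (weight v) * indicator \<V> v"
      by (simp add: distrib_left[symmetric] mult_left_mono)
  qed
  also have "\<dots> = cost \<U> + cost \<V>"
    unfolding cost_def by (intro nn_integral_add) auto
  finally show ?thesis .
qed

text \<open>The increasing sets lemma. Nearly optimal coverings \<open>\<V> n\<close> of \<open>A n\<close> are merged into
  \<open>\<U> (Suc n) = top_nodes (\<U> n \<union> \<V> (Suc n))\<close>. Strong subadditivity, applied with the set \<open>A n\<close> covered by
  both families, shows that every merger loses only the error of the new covering. The cells that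
  eventually stay in \<open>\<U> n\<close> cover the union, since the depth of the cell around a given point
  can only decrease and so stabilises; Fatou's lemma bounds their cost.\<close>

lemma net_content_UN_increasing:
  assumes inc: "\<And>n. A n \<subseteq> A (Suc n)" and bd: "\<And>n. net_content (A n) \<le> L"
  shows "net_content (\<Union>n. A n) \<le> L"
proof (rule ennreal_le_epsilon)
  fix e :: real assume e: "e > 0"
  have fin: "net_content B < \<infinity>" for B
    using net_content_le_1[of B] by (rule le_less_trans) simp
  have "\<exists>\<V>. covers \<V> (A n) \<and> cost \<V> \<le> net_content (A n) + ennreal (e / 2 * (1/2) ^ n)" for n
  proof -
    have "net_content (A n) < net_content (A n) + ennreal (e / 2 * (1/2) ^ n)"
      using fin[of "A n"] e ennreal_add_left_cancel_less[of "net_content (A n)" 0 "ennreal (e / 2 * (1/2) ^ n)"]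
      by simp
    then obtain \<V> where "covers \<V> (A n)" "cost \<V> < net_content (A n) + ennreal (e / 2 * (1/2) ^ n)"
      unfolding net_content_def[of "A n"] INF_less_iff by auto
    then show ?thesis by (auto intro: less_imp_le)
  qed
  then obtain \<V> where \<V>: "\<And>n. covers (\<V> n) (A n)"
      "\<And>n. cost (\<V> n) \<le> net_content (A n) + ennreal (e / 2 * (1/2) ^ n)" by metis
  define \<U> where "\<U> = rec_nat (\<V> 0) (\<lambda>n U. top_nodes (U \<union> \<V> (Suc n)))"
  have \<U>0: "\<U> 0 = \<V> 0" and \<U>S: "\<U> (Suc n) = top_nodes (\<U> n \<union> \<V> (Suc n))" for n
    by (simp_all add: \<U>_def)
  have cov: "covers (\<U> n) (A n)" for n
  proof (cases n)
    case 0
    then show ?thesis using \<V>(1)[of 0] by (simp add: \<U>0)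
  next
    case (Suc m)
    have "covers (\<U> m \<union> \<V> (Suc m)) (A (Suc m))" using \<V>(1)[of "Suc m"] by (auto simp: covers_def)
    then show ?thesis unfolding Suc \<U>S by (rule covers_top_nodes)
  qed
  have costU: "cost (\<U> n) \<le> net_content (A n) + ennreal (\<Sum>k\<le>n. e / 2 * (1/2) ^ k)" for n
  proof (induction n)
    case 0
    then show ?case using \<V>(2)[of 0] by (simp add: \<U>0)
  next
    case (Suc n)
    have "cost (\<U> (Suc n)) + net_content (A n) \<le> cost (\<U> n) + cost (\<V> (Suc n))"
      unfolding \<U>S using inc[of n] by (intro cost_submodular cov covers_mono[OF \<V>(1)[of "Suc n"]])
    also have "\<dots> \<le> (net_content (A n) + ennreal (\<Sum>k\<le>n. e / 2 * (1/2) ^ k)) +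
        (net_content (A (Suc n)) + ennreal (e / 2 * (1/2) ^ Suc n))"
      using Suc \<V>(2)[of "Suc n"] by (intro add_mono)
    also have "\<dots> = (net_content (A (Suc n)) +
        (ennreal (\<Sum>k\<le>n. e / 2 * (1/2) ^ k) + ennreal (e / 2 * (1/2) ^ Suc n))) + net_content (A n)"
      by (simp add: ac_simps)
    also have "ennreal (\<Sum>k\<le>n. e / 2 * (1/2) ^ k) + ennreal (e / 2 * (1/2) ^ Suc n)
        = ennreal (\<Sum>k\<le>Suc n. e / 2 * (1/2) ^ k)"
      using e by (subst ennreal_plus[symmetric]) (auto intro!: sum_nonneg)
    finally show ?case using fin[of "A n"] by (auto simp: ennreal_add_left_cancel_le add.commute[of _ "net_content (A n)"])
  qed
  have costU': "cost (\<U> n) \<le> L + ennreal e" for n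
  proof -
    have "(\<Sum>k\<le>n. e / 2 * (1/2) ^ k) \<le> e"
      using sum_half_powers_le[of e "Suc n"] e unfolding lessThan_Suc_atMost by simp
    then show ?thesis
      using costU[of n] bd[of n] by (meson add_mono ennreal_leI order_trans)
  qed
  define \<W> where "\<W> = {v. \<exists>N. \<forall>n\<ge>N. v \<in> \<U> n}"
  have "covers \<W> (\<Union>n. A n)"
    unfolding covers_def
  proof
    fix x assume "x \<in> (\<Union>n. A n)"
    then obtain n where n: "x \<in> A n" by blast
    have xA: "x \<in> A m" if "m \<ge> n" for m
      using that lift_Suc_mono_le[of A n m] inc n by blast
    define \<kappa> where "\<kappa> m = (LEAST k. node q k x \<in> \<U> m)" for m
    have \<kappa>: "node q (\<kappa> m) x \<in> \<U> m" if "m \<ge> n" for m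
      unfolding \<kappa>_def using cov[of m] xA[OF that] by (auto simp: covers_def intro: LeastI_ex)
    have step: "\<kappa> (Suc m) \<le> \<kappa> m" if "m \<ge> n" for m
    proof -
      have "node q (\<kappa> m) x \<in> \<U> m \<union> \<V> (Suc m)" using \<kappa>[OF that] by simp
      then obtain j where "j \<le> \<kappa> m" "node q j x \<in> \<U> (Suc m)"
        unfolding \<U>S by (rule covers_top_nodes_le)
      then show ?thesis unfolding \<kappa>_def[of "Suc m"] by (meson Least_le order_trans)
    qed
    obtain m0 where m0: "m0 \<ge> n" "\<And>m. m \<ge> n \<Longrightarrow> \<kappa> m0 \<le> \<kappa> m"
      using ex_has_least_nat[of "\<lambda>m. m \<ge> n" n \<kappa>] by auto
    have "\<kappa> m \<le> \<kappa> m0" if "m \<ge> m0" for m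
      using that
    proof (induction m rule: dec_induct)
      case (step m)
      then show ?case using \<open>\<And>m. m \<ge> n \<Longrightarrow> \<kappa> (Suc m) \<le> \<kappa> m\<close>[of m] m0(1) by simp
    qed simp
    then have "\<kappa> m0 = \<kappa> m" if "m \<ge> m0" for m
      using that m0(1) m0(2)[of m] by (intro antisym) auto
    then have "node q (\<kappa> m0) x \<in> \<U> m" if "m \<ge> m0" for m
      using \<kappa>[of m] m0(1) that by (metis order_trans)
    then have "node q (\<kappa> m0) x \<in> \<W>" by (auto simp: \<W>_def)
    then show "\<exists>k. node q k x \<in> \<W>" ..
  qed
  then have "net_content (\<Union>n. A n) \<le> cost \<W>" by (rule net_content_le_cost)
  also have "\<dots> \<le> (\<integral>\<^sup>+v. liminf (\<lambda>n. ennreal (weight v) * indicator (\<U> n) v) \<partial>count_space UNIV)"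
    unfolding cost_def
  proof (intro nn_integral_mono)
    fix v
    show "ennreal (weight v) * indicator \<W> v
        \<le> liminf (\<lambda>n. ennreal (weight v) * indicator (\<U> n) v)"
    proof (cases "v \<in> \<W>")
      case True
      then obtain N where "\<And>n. n \<ge> N \<Longrightarrow> v \<in> \<U> n" by (auto simp: \<W>_def)
      then have "eventually (\<lambda>n. ennreal (weight v)
          \<le> ennreal (weight v) * indicator (\<U> n) v) sequentially"
        unfolding eventually_sequentially by (intro exI[of _ N]) simp
      then show ?thesis using True by (simp add: Liminf_bounded)
    qed simp
  qed
  also have "\<dots> \<le> liminf (\<lambda>n. cost (\<U> n))"
    unfolding cost_def by (intro nn_integral_liminf) simp
  also have "\<dots> \<le> L + ennreal e"
    using costU' by (intro Liminf_le) auto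
  finally show "net_content (\<Union>n. A n) \<le> L + ennreal e" .
qed

text \<open>Capacitability of analytic sets: bounding one coordinate after the other keeps the content above
  \<open>L\<close>, because each time the image is an increasing union over the bound. The boxes obtained
  decrease to a compact set.\<close>

lemma net_content_compact_boxes:
  fixes f :: "(nat \<Rightarrow> nat) \<Rightarrow> 'a"
  assumes "L < net_content (range f)"
  obtains k where "\<And>n. L < net_content (f ` {\<sigma>. \<forall>i<n. \<sigma> i \<le> k i})"
proof -
  have "\<exists>g. \<forall>n. L < net_content (f ` {\<sigma>. \<forall>i<n. \<sigma> i \<le> g n i}) \<and> (\<forall>i<n. g (Suc n) i = g n i)"
  proof (rule dependent_nat_choice)
    show "\<exists>k. L < net_content (f ` {\<sigma>. \<forall>i<0::nat. \<sigma> i \<le> k i})" using assms by simp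
  next
    fix k :: "nat \<Rightarrow> nat" and n :: nat
    assume k: "L < net_content (f ` {\<sigma>. \<forall>i<n. \<sigma> i \<le> k i})"
    define B where "B j = f ` {\<sigma>. (\<forall>i<n. \<sigma> i \<le> k i) \<and> \<sigma> n \<le> j}" for j
    have "(\<Union>j. B j) = f ` {\<sigma>. \<forall>i<n. \<sigma> i \<le> k i}" by (auto simp: B_def)
    moreover have "B j \<subseteq> B (Suc j)" for j by (auto simp: B_def)
    ultimately obtain j where j: "L < net_content (B j)"
      using net_content_UN_increasing[of B L] k by (metis leD not_le)
    have "B j = f ` {\<sigma>. \<forall>i<Suc n. \<sigma> i \<le> (k(n := j)) i}"
      by (auto simp: B_def less_Suc_eq intro!: image_eqI)
    then show "\<exists>k'. L < net_content (f ` {\<sigma>. \<forall>i<Suc n. \<sigma> i \<le> k' i}) \<and> (\<forall>i<n. k' i = k i)"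
      using j by (intro exI[of _ "k(n := j)"]) simp
  qed
  then obtain g where "\<forall>n. L < net_content (f ` {\<sigma>. \<forall>i<n. \<sigma> i \<le> g n i}) \<and> (\<forall>i<n. g (Suc n) i = g n i)"
    by (elim exE)
  then have g: "L < net_content (f ` {\<sigma>. \<forall>i<n. \<sigma> i \<le> g n i})"
      "i < n \<Longrightarrow> g (Suc n) i = g n i" for n i by simp_all
  have eq: "g n i = g (Suc i) i" if "i < n" for n i
    using that
  proof (induction n)
    case (Suc n)
    show ?case
    proof (cases "i = n")
      case True
      show ?thesis unfolding True ..
    next
      case False
      have "i < n" using Suc.prems False by simp
      show ?thesis by (rule trans[OF g(2)[OF \<open>i < n\<close>] Suc.IH[OF \<open>i < n\<close>]])
    qed
  qed simp
  then have "{\<sigma>. \<forall>i<n. \<sigma> i \<le> g n i} = {\<sigma>. \<forall>i<n. \<sigma> i \<le> g (Suc i) i}" for n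
    by (intro Collect_cong) (metis eq)
  then show ?thesis using that[of "\<lambda>i. g (Suc i) i"] g(1) by simp
qed

end

section \<open>Discrete Frostman measures\<close>

text \<open>Points are processed one by one and receive the largest weight that violates no capacity;
  the constraint that stops the weight from growing is then tight and remains so.\<close>

lemma greedy_weights:
  fixes cap :: "'v \<Rightarrow> real" and inc :: "'x \<Rightarrow> 'v set"
  assumes "finite P" and cap: "\<And>v. 0 \<le> cap v" and inc: "\<And>x. finite (inc x)" "\<And>x. inc x \<noteq> {}"
  shows "\<exists>w. (\<forall>x. 0 \<le> w x) \<and> (\<forall>v. (\<Sum>x | x \<in> P \<and> v \<in> inc x. w x) \<le> cap v) \<and>
    (\<forall>x\<in>P. \<exists>v\<in>inc x. (\<Sum>x | x \<in> P \<and> v \<in> inc x. w x) = cap v)"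
  using \<open>finite P\<close>
proof (induction P rule: finite_induct)
  case empty
  then show ?case using cap by (intro exI[of _ "\<lambda>_. 0"]) auto
next
  case (insert z P)
  from insert.IH obtain w where w': "\<forall>x. 0 \<le> w x" "\<forall>v. (\<Sum>x | x \<in> P \<and> v \<in> inc x. w x) \<le> cap v"
      "\<forall>x\<in>P. \<exists>v\<in>inc x. (\<Sum>x | x \<in> P \<and> v \<in> inc x. w x) = cap v" by (elim exE conjE)
  note w = w'(1)[rule_format] w'(2)[rule_format] bspec[OF w'(3)]
  define load where "load v = (\<Sum>x | x \<in> P \<and> v \<in> inc x. w x)" for v
  define d where "d = Min ((\<lambda>v. cap v - load v) ` inc z)"
  have d: "d \<le> cap v - load v" if "v \<in> inc z" for v
    unfolding d_def using inc that by (intro Min_le) auto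
  obtain u where u: "u \<in> inc z" "d = cap u - load u"
    using Min_in[of "(\<lambda>v. cap v - load v) ` inc z"] inc unfolding d_def by blast
  have d0: "0 \<le> d" using u w(2)[of u] by (simp add: load_def)
  have new: "(\<Sum>x | x \<in> insert z P \<and> v \<in> inc x. (w(z := d)) x) = load v + (if v \<in> inc z then d else 0)" for v
  proof -
    have eq: "(\<Sum>x | x \<in> P \<and> v \<in> inc x. (w(z := d)) x) = load v"
      unfolding load_def using insert.hyps(2) by (intro sum.cong) auto
    have "{x. x \<in> insert z P \<and> v \<in> inc x} = (if v \<in> inc z then insert z {x. x \<in> P \<and> v \<in> inc x} else {x. x \<in> P \<and> v \<in> inc x})"
      by auto
    then show ?thesis using insert.hyps eq by simp
  qed
  have feas: "load v + (if v \<in> inc z then d else 0) \<le> cap v" for v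
    using d[of v] w(2)[of v] by (auto simp: load_def[symmetric])
  show ?case
  proof (intro exI[of _ "w(z := d)"] conjI ballI allI)
    show "0 \<le> (w(z := d)) x" for x using w(1) d0 by simp
    show "(\<Sum>x | x \<in> insert z P \<and> v \<in> inc x. (w(z := d)) x) \<le> cap v" for v
      unfolding new by (rule feas)
  next
    fix x assume "x \<in> insert z P"
    then consider "x = z" | "x \<in> P" by blast
    then show "\<exists>v\<in>inc x. (\<Sum>x | x \<in> insert z P \<and> v \<in> inc x. (w(z := d)) x) = cap v"
    proof cases
      case 1
      then show ?thesis unfolding new using u by (intro bexI[of _ u]) auto
    next
      case 2
      then obtain v where v: "v \<in> inc x" "load v = cap v" using w(3)[of x] by (auto simp: load_def)
      have "load v + (if v \<in> inc z then d else 0) = cap v"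
        using feas[of v] v(2) d0 by (auto split: if_splits)
      then show ?thesis unfolding new using v(1) by blast
    qed
  qed
qed

context cell_tree
begin

text \<open>Frostman's lemma at finite resolution. One point is taken from each cell of depth \<open>m\<close>
  meeting \<open>A\<close>, and the weights of the cells down to depth \<open>m\<close> serve as capacities. The maximal
  tight cells are disjoint and cover \<open>A\<close>, so the total weight of the points, which is the sum of
  the weights of these cells, is at least the net content of \<open>A\<close>.\<close>

lemma discrete_frostman:
  assumes fin: "finite (range (node q m))"
  obtains P w where "finite P" "P \<subseteq> A" "\<And>x. (0::real) \<le> w x" "net_content A \<le> ennreal (\<Sum>x\<in>P. w x)"
    "\<And>k v. k \<le> m \<Longrightarrow> (\<Sum>x | x \<in> P \<and> node q k x = v. w x) \<le> (a ^ k) powr t"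
proof -
  have "\<exists>P. finite P \<and> P \<subseteq> A \<and> (\<forall>x\<in>A. \<exists>y\<in>P. node q m y = node q m x)"
  proof -
    have "finite (node q m ` A)" using fin by (rule finite_subset[rotated]) auto
    then obtain P where "P \<subseteq> A" "finite P" "node q m ` A = node q m ` P"
      using finite_subset_image[of "node q m ` A" "node q m" A] by auto
    then show ?thesis by (intro exI[of _ P]) (metis image_iff)
  qed
  then obtain P where P: "finite P" "P \<subseteq> A" "\<And>x. x \<in> A \<Longrightarrow> \<exists>y\<in>P. node q m y = node q m x" by metis
  define inc where "inc x = (\<lambda>k. node q k x) ` {..m}" for x
  have inc_iff: "v \<in> inc x \<longleftrightarrow> length v \<le> m \<and> node q (length v) x = v" for v x
    unfolding inc_def by (auto intro!: image_eqI[of _ _ "length v"])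
  have "\<exists>w. (\<forall>x. 0 \<le> w x) \<and> (\<forall>v. (\<Sum>x | x \<in> P \<and> v \<in> inc x. w x) \<le> weight v) \<and>
    (\<forall>x\<in>P. \<exists>v\<in>inc x. (\<Sum>x | x \<in> P \<and> v \<in> inc x. w x) = weight v)"
    by (rule greedy_weights[OF P(1)]) (auto simp: inc_def)
  then obtain w where w': "\<forall>x. 0 \<le> w x"
      "\<forall>v. (\<Sum>x | x \<in> P \<and> v \<in> inc x. w x) \<le> weight v"
      "\<forall>x\<in>P. \<exists>v\<in>inc x. (\<Sum>x | x \<in> P \<and> v \<in> inc x. w x) = weight v"
    by (elim exE conjE)
  note w = w'(1)[rule_format] w'(2)[rule_format] bspec[OF w'(3)]
  define tight where "tight v \<longleftrightarrow> length v \<le> m \<and> (\<Sum>x | x \<in> P \<and> v \<in> inc x. w x) = weight v" for v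
  define \<kappa> where "\<kappa> x = (LEAST k. tight (node q k x))" for x
  have \<kappa>: "tight (node q (\<kappa> x) x)" if x: "x \<in> P" for x
  proof -
    obtain v where v: "v \<in> inc x" "(\<Sum>x | x \<in> P \<and> v \<in> inc x. w x) = weight v"
      using w(3)[OF x] by (rule bexE)
    then have "tight v" by (simp add: tight_def inc_iff)
    then have "tight (node q (length v) x)" using v(1) by (simp add: inc_iff)
    then show ?thesis unfolding \<kappa>_def by (rule LeastI)
  qed
  have \<kappa>m: "\<kappa> x \<le> m" if "x \<in> P" for x using \<kappa>[OF that] by (simp add: tight_def)
  define \<C> where "\<C> = (\<lambda>x. node q (\<kappa> x) x) ` P"
  have same: "node q (\<kappa> x) x = node q (\<kappa> y) y" if "x \<in> P" "y \<in> P" "node q (\<kappa> y) x = node q (\<kappa> y) y" for x y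
  proof -
    have le: "\<kappa> x \<le> \<kappa> y"
      unfolding \<kappa>_def[of x] using \<kappa>[OF that(2)] that(3) by (intro Least_le) simp
    have "node q (\<kappa> x) x = node q (\<kappa> x) y" by (rule node_eq_mono[OF that(3) le])
    then have "\<kappa> y \<le> \<kappa> x"
      unfolding \<kappa>_def[of y] using \<kappa>[OF that(1)] by (intro Least_le) simp
    then show ?thesis using le that(3) by (simp add: antisym)
  qed
  have "covers \<C> A"
    unfolding covers_def
  proof
    fix x assume "x \<in> A"
    then obtain y where y: "y \<in> P" "node q m y = node q m x" using P(3) by blast
    then have "node q (\<kappa> y) x = node q (\<kappa> y) y" using node_eq_mono[OF y(2) \<kappa>m] by simp
    then show "\<exists>k. node q k x \<in> \<C>" using y(1) by (auto simp: \<C>_def intro!: exI[of _ "\<kappa> y"])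
  qed
  then have "net_content A \<le> cost \<C>" by (rule net_content_le_cost)
  also have "\<dots> = ennreal (\<Sum>v\<in>\<C>. weight v)" using P(1) by (simp add: cost_finite \<C>_def)
  also have "(\<Sum>v\<in>\<C>. weight v) = (\<Sum>v\<in>\<C>. \<Sum>x | x \<in> P \<and> node q (\<kappa> x) x = v. w x)"
  proof (intro sum.cong refl)
    fix v assume "v \<in> \<C>"
    then obtain y where y: "y \<in> P" "v = node q (\<kappa> y) y" by (auto simp: \<C>_def)
    have "v \<in> inc x \<longleftrightarrow> node q (\<kappa> x) x = v" if x: "x \<in> P" for x
    proof
      assume "v \<in> inc x"
      then have "node q (\<kappa> y) x = node q (\<kappa> y) y" by (simp add: inc_iff y(2))
      then show "node q (\<kappa> x) x = v" unfolding y(2) by (rule same[OF x y(1)])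
    next
      assume "node q (\<kappa> x) x = v"
      then show "v \<in> inc x" using \<kappa>m[OF x] by (auto simp: inc_def)
    qed
    then have "{x. x \<in> P \<and> v \<in> inc x} = {x. x \<in> P \<and> node q (\<kappa> x) x = v}" by blast
    then show "weight v = (\<Sum>x | x \<in> P \<and> node q (\<kappa> x) x = v. w x)"
      using \<kappa>[OF y(1)] y(2) by (simp add: tight_def)
  qed
  also have "\<dots> = (\<Sum>x\<in>P. w x)"
    unfolding \<C>_def using P(1) by (rule sum.image_gen[symmetric])
  finally have "net_content A \<le> ennreal (\<Sum>x\<in>P. w x)" .
  moreover have "(\<Sum>x | x \<in> P \<and> node q k x = v. w x) \<le> (a ^ k) powr t" if "k \<le> m" for k v
  proof (cases "length v = k")
    case True
    then show ?thesis using w(2)[of v] that by (simp add: inc_iff weight_def)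
  next
    case False
    then have empty: "{x. x \<in> P \<and> node q k x = v} = {}" by auto
    show ?thesis unfolding empty by simp
  qed
  ultimately show ?thesis using that[of P w] P(1,2) w(1) by blast
qed

end


section \<open>Frostman weights on Ahlfors regular spaces\<close>

text \<open>A probability measure on a finite set that satisfies the Frostman condition with exponent \<open>t\<close> for
  radii not smaller than the resolution \<open>\<rho>0\<close>. Such weights replace a Frostman measure throughout, so
  that no limits of measures have to be taken.\<close>

definition frostman_weights :: "'a::metric_space set \<Rightarrow> ('a \<Rightarrow> real) \<Rightarrow> real \<Rightarrow> real \<Rightarrow> real \<Rightarrow> bool" where
  "frostman_weights P w \<rho>0 K t \<longleftrightarrow> finite P \<and> (\<forall>x. 0 \<le> w x) \<and> (\<Sum>x\<in>P. w x) = 1 \<and>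
     (\<forall>x r. \<rho>0 \<le> r \<longrightarrow> r \<le> 1 \<longrightarrow> (\<Sum>y | y \<in> P \<and> dist x y \<le> 2 * r. w y) \<le> K * r powr t)"

text \<open>Each of finitely many balls of radius \<open>\<rho> / 2\<close> covering the space contains at most one point of
  a separated set, so a separated set of maximal size exists, and maximality makes it a net.\<close>

lemma maximal_separated_net:
  fixes \<rho> :: real
  assumes cpt: "compact (UNIV :: 'a::metric_space set)" and \<rho>: "0 < \<rho>"
  obtains Z :: "'a::metric_space set" where "finite Z" "pairwise (\<lambda>x y. \<rho> < dist x y) Z" "\<And>x. \<exists>z\<in>Z. dist x z \<le> \<rho>"
proof -
  define P where "P Z \<longleftrightarrow> finite Z \<and> pairwise (\<lambda>x y. \<rho> < dist x y) Z" for Z :: "'a set"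
  obtain K :: "'a set" where K: "finite K" "UNIV \<subseteq> (\<Union>x\<in>K. ball x (\<rho> / 2))"
    using compactE_image[OF cpt, of UNIV "\<lambda>x. ball x (\<rho> / 2)"] \<rho> by (metis UNIV_I UN_I centre_in_ball half_gt_zero open_ball subsetI)
  have "card Z < Suc (card K)" if PZ: "P Z" for Z
  proof -
    have "\<forall>z. \<exists>x\<in>K. dist x z < \<rho> / 2" using K(2) by (auto simp: subset_iff)
    then obtain h where h: "\<And>z. h z \<in> K" "\<And>z. dist (h z) z < \<rho> / 2" by metis
    have "inj_on h Z"
    proof (rule inj_onI)
      fix y z assume yz': "y \<in> Z" "z \<in> Z" "h y = h z"
      show "y = z"
      proof (rule ccontr)
      assume "y \<noteq> z"
      note yz = yz' this
      have "\<rho> < dist y z" using PZ yz by (auto simp: P_def pairwise_def)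
      also have "\<dots> \<le> dist (h y) y + dist (h y) z" by (rule dist_triangle3)
      also have "\<dots> < \<rho>" using h(2)[of y] h(2)[of z] yz(3) by simp
      finally show False .
      qed
    qed
    then have "card Z \<le> card K" using h(1) K(1) by (intro card_inj_on_le[of h]) auto
    then show ?thesis by simp
  qed
  moreover have "P {}" by (simp add: P_def)
  ultimately obtain Z where Z: "P Z" "\<And>Z'. P Z' \<Longrightarrow> card Z' \<le> card Z"
    using ex_has_greatest_nat[of P "{}" card] by blast
  have "\<exists>z\<in>Z. dist x z \<le> \<rho>" for x
  proof (rule ccontr)
    assume n: "\<not> ?thesis"
    then have "P (insert x Z)" using Z(1) by (auto simp: P_def pairwise_insert dist_commute not_le)
    then have "card (insert x Z) \<le> card Z" by (rule Z(2))
    moreover have "x \<notin> Z" using n \<rho> by auto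
    ultimately show False using Z(1) by (simp add: P_def)
  qed
  then show ?thesis using that[of Z] Z(1) by (simp add: P_def)
qed

text \<open>The balls of half the separation are disjoint.\<close>

lemma (in covering_process) separated_mass_le:
  fixes Y V :: "'a set"
  assumes Y: "finite Y" "pairwise (\<lambda>x y. \<rho>' < dist x y) Y" and \<rho>': "0 < \<rho>'" "\<rho>' \<le> 1"
    and V: "V \<in> sets borel" "(\<Union>z\<in>Y. cball z (\<rho>' / 2)) \<subseteq> V"
  shows "real (card Y) * ((\<rho>' / 2) powr s / c) \<le> measure \<mu> V"
proof -
  interpret \<mu>: prob_space \<mu>
    using prob_space_distr[OF measurable_process[of 1]] distr_process[of 1] by simp
  have sets: "sets \<mu> = sets borel" using distr_process[of 1] by (metis order_refl sets_distr)
  have disj: "disjoint_family_on (\<lambda>z. cball z (\<rho>' / 2)) Y"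
    unfolding disjoint_family_on_def
  proof (intro ballI impI, rule ccontr)
    fix y z assume yz: "y \<in> Y" "z \<in> Y" "y \<noteq> z" "cball y (\<rho>' / 2) \<inter> cball z (\<rho>' / 2) \<noteq> {}"
    then obtain p where "dist y p \<le> \<rho>' / 2" "dist z p \<le> \<rho>' / 2" by auto
    then have "dist y z \<le> \<rho>'" using dist_triangle2[of y z p] by simp
    moreover have "\<rho>' < dist y z" using Y(2) yz by (auto simp: pairwise_def)
    ultimately show False by simp
  qed
  have "real (card Y) * ((\<rho>' / 2) powr s / c) = (\<Sum>z\<in>Y. (\<rho>' / 2) powr s / c)" by simp
  also have "\<dots> \<le> (\<Sum>z\<in>Y. measure \<mu> (cball z (\<rho>' / 2)))"
    using \<rho>' by (intro sum_mono ball_lower) auto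
  also have "\<dots> = measure \<mu> (\<Union>z\<in>Y. cball z (\<rho>' / 2))"
    using Y(1) disj by (intro \<mu>.finite_measure_finite_Union[symmetric]) (auto simp: sets)
  also have "\<dots> \<le> measure \<mu> V"
    using V by (intro \<mu>.finite_measure_mono) (auto simp: sets)
  finally show ?thesis .
qed

text \<open>The bound does not depend on the scale \<open>\<rho>'\<close>. This allows the ratio \<open>a\<close> of the cell tree to
  be chosen afterwards, depending on the bound.\<close>

lemma (in covering_process) card_separated_le:
  fixes Z :: "'a set"
  assumes Z: "finite Z" "pairwise (\<lambda>x y. \<rho>' < dist x y) Z" and \<rho>': "0 < \<rho>'" "\<rho>' \<le> 1"
  shows "real (card {z \<in> Z. dist x z \<le> 3 * \<rho>'}) \<le> c\<^sup>2 * 8 powr s"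
proof -
  define Y where "Y = {z \<in> Z. dist x z \<le> 3 * \<rho>'}"
  have "real (card Y) * ((\<rho>' / 2) powr s / c) \<le> measure \<mu> (cball x (4 * \<rho>'))"
  proof (rule separated_mass_le[OF _ _ \<rho>'])
    show "finite Y" using Z(1) by (simp add: Y_def)
    show "pairwise (\<lambda>x y. \<rho>' < dist x y) Y" using Z(2) by (auto simp: Y_def pairwise_def)
    show "(\<Union>z\<in>Y. cball z (\<rho>' / 2)) \<subseteq> cball x (4 * \<rho>')"
    proof (intro UN_least subsetI)
      fix z p assume "z \<in> Y" "p \<in> cball z (\<rho>' / 2)"
      then show "p \<in> cball x (4 * \<rho>')" using dist_triangle[of x p z] \<rho>' by (auto simp: Y_def)
    qed
  qed simp
  also have "\<dots> \<le> c * (4 * \<rho>') powr s" using \<rho>' by (intro ball_upper) simp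
  also have "\<dots> = (c\<^sup>2 * 8 powr s) * ((\<rho>' / 2) powr s / c)"
  proof -
    have "(4 * \<rho>') powr s = (8 * (\<rho>' / 2)) powr s" by simp
    also have "\<dots> = 8 powr s * (\<rho>' / 2) powr s" using \<rho>' by (subst powr_mult) auto
    finally show ?thesis using c_ge_1 by (simp add: power2_eq_square)
  qed
  finally show ?thesis
    using \<rho>' c_ge_1 by (subst (asm) mult_le_cancel_right_pos) (auto simp: Y_def)
qed

text \<open>The dimension of the space is at most \<open>s\<close>, so the hypothesis of the lower bound forces \<open>0 < \<alpha>\<close>.\<close>

lemma (in covering_process) hausdorff_measure_UNIV_null:
  assumes cpt: "compact (UNIV :: 'a set)" and t: "s < t"
  shows "hausdorff_measure t (UNIV :: 'a set) = 0"
  unfolding hausdorff_measure_eq_0_iff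
proof (intro allI impI)
  fix \<delta> :: real and \<eta> :: ennreal
  assume \<delta>: "\<delta> > 0" and \<eta>: "\<eta> > 0"
  obtain b where b: "0 < b" "ennreal b < \<eta>" using ennreal_pos_obtain_real[OF \<eta>] .
  define B where "B = c * 2 powr s * 2 powr t"
  have B: "0 < B" using c_ge_1 by (simp add: B_def)
  define q where "q = min 1 (min (\<delta> / 2) ((b / B) powr (1 / (t - s))))"
  have q: "0 < q" "q \<le> 1" "2 * q \<le> \<delta>" using \<delta> b B by (auto simp: q_def)
  have "q powr (t - s) \<le> ((b / B) powr (1 / (t - s))) powr (t - s)"
    using q t by (intro powr_mono2) (auto simp: q_def)
  also have "\<dots> = b / B" using t b B by (simp add: powr_powr)
  finally have qB: "B * q powr (t - s) \<le> b" using B by (simp add: field_simps)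
  obtain Z :: "'a set" where Z: "finite Z" "pairwise (\<lambda>x y. q < dist x y) Z" "\<And>x. \<exists>z\<in>Z. dist x z \<le> q"
    by (rule maximal_separated_net[OF cpt q(1)]) (rule that)
  interpret \<mu>: prob_space \<mu>
    using prob_space_distr[OF measurable_process[of 1]] distr_process[of 1] by simp
  have "real (card Z) * ((q / 2) powr s / c) \<le> 1"
    by (rule order_trans[OF separated_mass_le[OF Z(1,2) q(1,2), of UNIV] \<mu>.prob_le_1]) auto
  then have card: "real (card Z) \<le> c * 2 powr s * q powr (- s)"
    using q(1) c_ge_1 by (simp add: powr_divide powr_minus field_simps)
  obtain h where h: "bij_betw h {0..<card Z} Z" using ex_bij_betw_nat_finite[OF Z(1)] by blast
  define U where "U i = (if i < card Z then cball (h i) q else {})" for i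
  have diam: "diameter (U i) \<le> 2 * q" for i using q(1) by (auto simp: U_def intro: diameter_cball_le)
  show "\<exists>U. (\<forall>i::nat. bounded (U i) \<and> diameter (U i) \<le> \<delta>) \<and> (UNIV :: 'a set) \<subseteq> (\<Union>i. U i) \<and> (\<Sum>i. diam_pow t (U i)) < \<eta>"
  proof (intro exI[of _ U] conjI allI)
    show "bounded (U i)" for i by (simp add: U_def)
    show "diameter (U i) \<le> \<delta>" for i using diam[of i] q(3) by simp
    show "UNIV \<subseteq> (\<Union>i. U i)"
    proof
      fix x :: 'a
      obtain z where z: "z \<in> Z" "dist x z \<le> q" using Z(3) by blast
      have "z \<in> h ` {0..<card Z}" using h z(1) by (simp add: bij_betw_def)
      then obtain i where "i < card Z" "z = h i" by auto
      then have "x \<in> U i" using z(2) by (simp add: U_def dist_commute)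
      then show "x \<in> (\<Union>i. U i)" by blast
    qed
    have "(\<Sum>i. diam_pow t (U i)) = (\<Sum>i<card Z. diam_pow t (U i))"
      by (intro suminf_finite) (auto simp: U_def diam_pow_def)
    also have "\<dots> \<le> (\<Sum>i<card Z. ennreal ((2 * q) powr t))"
    proof (rule sum_mono)
      fix i
      have "diameter (U i) powr t \<le> (2 * q) powr t"
        using diam[of i] t s_pos diameter_ge_0[of "U i"] by (intro powr_mono2) (auto simp: U_def)
      then show "diam_pow t (U i) \<le> ennreal ((2 * q) powr t)"
        using t s_pos by (auto simp: diam_pow_def intro: ennreal_leI)
    qed
    also have "\<dots> = ennreal (real (card Z) * (2 * q) powr t)"
      by (simp add: ennreal_mult' ennreal_of_nat_eq_real_of_nat)
    also have "\<dots> \<le> ennreal ((c * 2 powr s * q powr (- s)) * (2 * q) powr t)"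
      by (intro ennreal_leI mult_right_mono card) auto
    also have "(c * 2 powr s * q powr (- s)) * (2 * q) powr t = B * q powr (t - s)"
      using q(1) by (simp add: B_def powr_mult powr_diff powr_minus field_simps)
    also have "ennreal \<dots> \<le> ennreal b" by (intro ennreal_leI qB)
    also have "\<dots> < \<eta>" by (rule b)
    finally show "(\<Sum>i. diam_pow t (U i)) < \<eta>" .
  qed
qed

text \<open>A cell of depth \<open>k\<close> has diameter \<open>O(a ^ k)\<close>, and a ball of radius \<open>2 * a ^ k\<close> meets at most \<open>N ^ k\<close>
  cells of depth \<open>k\<close>. This number grows with \<open>k\<close>, but \<open>N * a powr (t - t') \<le> 1\<close> absorbs it at the price of
  replacing the exponent \<open>t\<close> by the smaller \<open>t'\<close>.\<close>

locale net_cell_tree = cell_tree q a t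
  for q :: "nat \<Rightarrow> 'a::metric_space \<Rightarrow> 'a" and a t :: real +
  fixes Z :: "nat \<Rightarrow> 'a set" and N :: nat and t' :: real
  assumes Z: "\<And>j. finite (Z j)" "\<And>j x. q j x \<in> Z j" "\<And>j x. dist x (q j x) \<le> a ^ Suc j"
    and N: "\<And>j x. card {z \<in> Z j. dist x z \<le> 3 * a ^ Suc j} \<le> N"
    and t': "0 < t'" "t' < t" and Na: "real N * a powr (t - t') \<le> 1"
    and bdd: "bounded (UNIV :: 'a set)"
begin

lemma finite_nodes: "finite (range (node q k))"
proof (induction k)
  case 0
  have "range (node q 0) \<subseteq> {[]}" by auto
  then show ?case by (rule finite_subset) simp
next
  case (Suc k)
  have "range (node q (Suc k)) \<subseteq> (\<lambda>(v, z). v @ [z]) ` (range (node q k) \<times> Z k)"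
  proof
    fix v assume "v \<in> range (node q (Suc k))"
    then obtain x where "v = node q (Suc k) x" by blast
    then show "v \<in> (\<lambda>(v, z). v @ [z]) ` (range (node q k) \<times> Z k)"
      using Z(2) by (intro image_eqI[of _ _ "(node q k x, q k x)"]) (auto simp: node_Suc)
  qed
  then show ?case
    by (rule finite_subset) (intro finite_imageI finite_cartesian_product Suc Z(1))
qed

lemma card_nodes_ball:
  assumes "j \<le> k"
  shows "card (node q j ` cball x (2 * a ^ k)) \<le> N ^ j"
  using assms
proof (induction j)
  case 0
  have "node q 0 ` cball x (2 * a ^ k) \<subseteq> {[]}" by auto
  then have "card (node q 0 ` cball x (2 * a ^ k)) \<le> card {[] :: 'a list}" by (intro card_mono) auto
  then show ?case by simp
next
  case (Suc j)
  let ?B = "cball x (2 * a ^ k)"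
  have fin: "finite (node q j ` ?B)" using finite_nodes by (rule finite_subset[rotated]) auto
  have qB: "q j ` ?B \<subseteq> {z \<in> Z j. dist x z \<le> 3 * a ^ Suc j}"
  proof
    fix z assume "z \<in> q j ` ?B"
    then obtain y where y: "dist x y \<le> 2 * a ^ k" "z = q j y" by auto
    have "a ^ k \<le> a ^ Suc j" using a Suc.prems by (intro power_decreasing) auto
    then have "dist x z \<le> 3 * a ^ Suc j"
      using y Z(3)[of y j] dist_triangle[of x z y] by simp
    then show "z \<in> {z \<in> Z j. dist x z \<le> 3 * a ^ Suc j}" using y(2) Z(2) by simp
  qed
  have "node q (Suc j) ` ?B \<subseteq> (\<lambda>(v, z). v @ [z]) ` (node q j ` ?B \<times> {z \<in> Z j. dist x z \<le> 3 * a ^ Suc j})"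
  proof
    fix v assume "v \<in> node q (Suc j) ` ?B"
    then obtain y where y: "y \<in> ?B" "v = node q (Suc j) y" by blast
    then have "q j y \<in> {z \<in> Z j. dist x z \<le> 3 * a ^ Suc j}" using qB by blast
    then show "v \<in> (\<lambda>(v, z). v @ [z]) ` (node q j ` ?B \<times> {z \<in> Z j. dist x z \<le> 3 * a ^ Suc j})"
      unfolding y(2) using y(1)
      by (intro image_eqI[of _ _ "(node q j y, q j y)"]) (simp_all add: node_Suc del: mem_cball power_Suc)
  qed
  then have "card (node q (Suc j) ` ?B) \<le> card (node q j ` ?B \<times> {z \<in> Z j. dist x z \<le> 3 * a ^ Suc j})"
    using fin Z(1)[of j] by (intro surj_card_le) auto
  also have "\<dots> = card (node q j ` ?B) * card {z \<in> Z j. dist x z \<le> 3 * a ^ Suc j}"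
    by (rule card_cartesian_product)
  also have "\<dots> \<le> N ^ j * N" using Suc N by (intro mult_mono) auto
  finally show ?case by (simp add: mult.commute)
qed

lemma frostman_ball_bound:
  assumes P: "finite P" and w: "\<And>x. (0::real) \<le> w x"
    and cells: "\<And>k v. k \<le> m \<Longrightarrow> (\<Sum>x | x \<in> P \<and> node q k x = v. w x) \<le> (a ^ k) powr t"
    and r: "a ^ m \<le> r" "r \<le> 1"
  shows "(\<Sum>y | y \<in> P \<and> dist x y \<le> 2 * r. w y) \<le> a powr (- t') * r powr t'"
proof -
  obtain k where k: "k \<le> m" "r \<le> a ^ k" "a ^ Suc k \<le> r" using geometric_scale[OF a r] .
  let ?B = "cball x (2 * a ^ k)"
  let ?Q = "{y \<in> P. y \<in> ?B}"
  have r0: "0 < r" using r(1) a by (meson less_le_trans zero_less_power)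
  have "(\<Sum>y | y \<in> P \<and> dist x y \<le> 2 * r. w y) \<le> (\<Sum>y\<in>?Q. w y)"
    using k(2) P w by (intro sum_mono2) auto
  also have "\<dots> = (\<Sum>v\<in>node q k ` ?Q. \<Sum>y | y \<in> ?Q \<and> node q k y = v. w y)"
    using P by (intro sum.image_gen) auto
  also have "\<dots> \<le> (\<Sum>v\<in>node q k ` ?Q. (a ^ k) powr t)"
  proof (rule sum_mono)
    fix v
    have "(\<Sum>y | y \<in> ?Q \<and> node q k y = v. w y) \<le> (\<Sum>y | y \<in> P \<and> node q k y = v. w y)"
      using P w by (intro sum_mono2) auto
    also have "\<dots> \<le> (a ^ k) powr t" by (rule cells[OF k(1)])
    finally show "(\<Sum>y | y \<in> ?Q \<and> node q k y = v. w y) \<le> (a ^ k) powr t" .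
  qed
  also have "\<dots> = real (card (node q k ` ?Q)) * (a ^ k) powr t" by simp
  also have "\<dots> \<le> real N ^ k * (a ^ k) powr t"
  proof (rule mult_right_mono)
    have "card (node q k ` ?Q) \<le> card (node q k ` ?B)"
      using finite_nodes by (intro card_mono) (auto intro: finite_subset[of _ "range (node q k)"])
    also have "\<dots> \<le> N ^ k" by (rule card_nodes_ball) simp
    finally show "real (card (node q k ` ?Q)) \<le> real N ^ k" by (metis of_nat_le_iff of_nat_power)
  qed simp
  also have "\<dots> = (real N * a powr (t - t')) ^ k * (a ^ k) powr t'"
  proof -
    have "(a ^ k) powr t = (a powr (t - t')) ^ k * (a ^ k) powr t'"
      using a by (simp add: powr_powr powr_realpow[symmetric] powr_add[symmetric] algebra_simps)
    then show ?thesis by (simp add: power_mult_distrib)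
  qed
  also have "\<dots> \<le> 1 * (a ^ k) powr t'"
    using Na by (intro mult_right_mono power_le_one) auto
  also have "\<dots> \<le> 1 * (r / a) powr t'"
    using k(3) a t' by (intro mult_left_mono powr_mono2) (auto simp: field_simps)
  also have "\<dots> = a powr (- t') * r powr t'"
    using a r0 by (simp add: powr_divide powr_minus_divide)
  finally show ?thesis .
qed

text \<open>Cells are admissible covering sets. A covering of small total weight consists of cells of small
  diameter, so the restriction on diameters in the Hausdorff measure is automatic.\<close>

lemma hausdorff_null_if_net_content_0:
  assumes "net_content A = 0"
  shows "hausdorff_measure t A = 0"
  unfolding hausdorff_measure_eq_0_iff
proof (intro allI impI)
  fix \<delta> :: real and \<eta> :: ennreal
  assume \<delta>: "\<delta> > 0" and \<eta>: "\<eta> > 0"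
  define D where "D = max 2 (diameter (UNIV :: 'a set))"
  have D: "2 \<le> D" "dist x y \<le> D" for x y :: 'a
    using diameter_bounded_bound[OF bdd, of x y] by (auto simp: D_def)
  obtain e0 where e0: "0 < e0" "ennreal e0 < \<eta>" using ennreal_pos_obtain_real[OF \<eta>] .
  \<comment> \<open>The first bound makes the Hausdorff sum small, the second one the diameters.\<close>
  define b where "b = min (e0 / D powr t) ((\<delta> / D) powr t)"
  have b: "0 < b" "b * D powr t \<le> e0" "b \<le> (\<delta> / D) powr t"
    using e0 D(1) \<delta> by (auto simp: b_def min_mult_distrib_right pos_le_divide_eq[symmetric])
  have "net_content A < ennreal b" using assms b(1) by simp
  then obtain \<C>0 where \<C>0: "covers \<C>0 A" "cost \<C>0 < ennreal b"
    unfolding net_content_def INF_less_iff by auto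
  define Nodes where "Nodes = (\<Union>k. range (node q k))"
  define \<C> where "\<C> = \<C>0 \<inter> Nodes"
  have cov: "covers \<C> A" using \<C>0(1) unfolding covers_def \<C>_def Nodes_def by blast
  have "cost \<C> \<le> cost \<C>0"
    unfolding cost_def by (intro nn_integral_mono mult_left_mono) (auto simp: \<C>_def indicator_def)
  with \<C>0(2) have cost: "cost \<C> < ennreal b" by simp
  have "countable Nodes" unfolding Nodes_def using finite_nodes by (intro countable_UN) (auto intro: countable_finite)
  then have cnt: "countable \<C>" by (simp add: \<C>_def)
  let ?n = "to_nat_on \<C>"
  have inj: "inj_on ?n \<C>" using cnt by (rule inj_on_to_nat_on)
  define cell where "cell v = {x. node q (length v) x = v}" for v
  have small: "a ^ length v \<le> \<delta> / D" if "v \<in> \<C>" for v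
  proof -
    have "ennreal (weight v) = cost {v}" by (simp add: cost_finite)
    also have "\<dots> \<le> cost \<C>"
      unfolding cost_def using that by (intro nn_integral_mono mult_left_mono) (auto simp: indicator_def)
    finally have "ennreal (weight v) < ennreal b" using cost by (rule le_less_trans)
    then have "(a ^ length v) powr t < b" by (simp add: ennreal_less_iff weight_def)
    then have "(a ^ length v) powr t \<le> (\<delta> / D) powr t" using b(3) by simp
    moreover have "(\<delta> / D) powr t < (a ^ length v) powr t" if "\<delta> / D < a ^ length v"
      using that \<delta> D(1) t_pos by (intro powr_less_mono2) auto
    ultimately show ?thesis by linarith
  qed
  have diam: "diameter (cell v) \<le> D * a ^ length v" for v
  proof (cases "length v")
    case 0
    show ?thesis using D 0 by (intro diameter_le_metric) auto
  next
    case (Suc k)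
    show ?thesis
    proof (rule diameter_le_metric)
      show "0 \<le> D * a ^ length v" using D a by simp
      fix x y assume "x \<in> cell v" "y \<in> cell v"
      then have "node q (Suc k) x = node q (Suc k) y" using Suc by (simp add: cell_def)
      then have "q k x = q k y" by (simp add: node_Suc)
      then have "dist x y \<le> 2 * a ^ Suc k"
        using Z(3)[of x k] Z(3)[of y k] dist_triangle2[of x y "q k x"] by simp
      also have "\<dots> \<le> D * a ^ length v" unfolding Suc using D(1) a by (intro mult_right_mono) auto
      finally show "dist x y \<le> D * a ^ length v" .
    qed
  qed
  define U where "U i = (if i \<in> ?n ` \<C> then cell (the_inv_into \<C> ?n i) else {})" for i
  have U: "U (?n v) = cell v" if "v \<in> \<C>" for v
    using that inj by (simp add: U_def the_inv_into_f_f)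
  have bnd: "bounded (U i)" for i by (rule bounded_subset[OF bdd]) simp
  show "\<exists>U. (\<forall>i::nat. bounded (U i) \<and> diameter (U i) \<le> \<delta>) \<and> A \<subseteq> (\<Union>i. U i) \<and> (\<Sum>i. diam_pow t (U i)) < \<eta>"
  proof (intro exI[of _ U] conjI allI bnd)
    fix i
    show "diameter (U i) \<le> \<delta>"
    proof (cases "i \<in> ?n ` \<C>")
      case True
      then obtain v where v: "v \<in> \<C>" "i = ?n v" by blast
      have "diameter (U i) \<le> D * a ^ length v" using diam[of v] U[OF v(1)] v(2) by simp
      also have "\<dots> \<le> \<delta>" using small[OF v(1)] D(1) by (simp add: field_simps)
      finally show ?thesis .
    qed (use \<delta> in \<open>simp add: U_def\<close>)
  next
    show "A \<subseteq> (\<Union>i. U i)"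
    proof
      fix x assume "x \<in> A"
      then obtain k where k: "node q k x \<in> \<C>" using cov by (auto simp: covers_def)
      then have "x \<in> U (?n (node q k x))" by (simp add: U cell_def)
      then show "x \<in> (\<Union>i. U i)" by blast
    qed
  next
    have "(\<Sum>i. diam_pow t (U i)) = (\<integral>\<^sup>+i. diam_pow t (U i) \<partial>count_space UNIV)"
      by (simp add: nn_integral_count_space_nat)
    also have "\<dots> = (\<integral>\<^sup>+i. diam_pow t (U i) * indicator (?n ` \<C>) i \<partial>count_space UNIV)"
      by (intro nn_integral_cong) (auto simp: U_def diam_pow_def indicator_def)
    also have "\<dots> = (\<integral>\<^sup>+i. diam_pow t (U i) \<partial>count_space (?n ` \<C>))"
      by (rule nn_integral_count_space_indicator[symmetric]) simp
    also have "\<dots> = (\<integral>\<^sup>+v. diam_pow t (U (?n v)) \<partial>count_space \<C>)"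
      using inj by (intro nn_integral_bij_count_space[symmetric] inj_on_imp_bij_betw)
    also have "\<dots> \<le> (\<integral>\<^sup>+v. ennreal (D powr t) * ennreal (weight v) \<partial>count_space \<C>)"
    proof (rule nn_integral_mono)
      fix v assume "v \<in> space (count_space \<C>)"
      then have v: "v \<in> \<C>" by simp
      have "diameter (cell v) powr t \<le> (D * a ^ length v) powr t"
        using diam[of v] t_pos diameter_ge_0[OF bounded_subset[OF bdd], of "cell v"] by (intro powr_mono2) auto
      also have "\<dots> = D powr t * weight v" using D(1) a by (simp add: powr_mult weight_def)
      finally show "diam_pow t (U (?n v)) \<le> ennreal (D powr t) * ennreal (weight v)"
        using t_pos by (auto simp: U[OF v] diam_pow_def ennreal_mult[symmetric] intro: ennreal_leI)
    qed
    also have "\<dots> = ennreal (D powr t) * (\<integral>\<^sup>+v. ennreal (weight v) \<partial>count_space \<C>)"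
      by (rule nn_integral_cmult) simp
    also have "(\<integral>\<^sup>+v. ennreal (weight v) \<partial>count_space \<C>) = cost \<C>"
      unfolding cost_def by (rule nn_integral_count_space_indicator) simp
    also have "ennreal (D powr t) * cost \<C> \<le> ennreal (D powr t) * ennreal b"
      using cost by (intro mult_left_mono) auto
    also have "\<dots> = ennreal (b * D powr t)" by (simp add: ennreal_mult'' mult.commute)
    also have "\<dots> \<le> ennreal e0" by (intro ennreal_leI b)
    also have "\<dots> < \<eta>" by (rule e0)
    finally show "(\<Sum>i. diam_pow t (U i)) < \<eta>" .
  qed
qed

end

text \<open>Neither \<open>k\<close> nor \<open>Cf\<close> depends on the resolution. The weights for the pair
  \<open>n, \<rho>0\<close> live on the image of the \<open>n\<close>-th box, which is larger than the image of the limiting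
  compact box, but close to it for large \<open>n\<close>.\<close>

lemma (in covering_process) frostman_on_boxes:
  fixes f :: "(nat \<Rightarrow> nat) \<Rightarrow> 'a"
  assumes cpt: "compact (UNIV :: 'a set)" and t: "0 < t'" "t' < t"
    and pos: "hausdorff_measure t (range f) \<noteq> 0"
  obtains k :: "nat \<Rightarrow> nat" and Cf :: real where "0 < Cf"
    "\<And>n \<rho>0. 0 < \<rho>0 \<Longrightarrow> \<exists>P w. P \<subseteq> f ` {\<sigma>. \<forall>i<n. \<sigma> i \<le> k i} \<and> frostman_weights P w \<rho>0 Cf t'"
proof -
  define N where "N = Suc (nat \<lfloor>c\<^sup>2 * 8 powr s\<rfloor>)"
  \<comment> \<open>The ratio for which a power \<open>N ^ k\<close> costs at most the factor \<open>(a ^ k) powr (t' - t)\<close>.\<close>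
  define a where "a = real (Suc N) powr (- 1 / (t - t'))"
  have "1 \<le> N" by (simp add: N_def)
  then have "1 < real (Suc N)" by simp
  then have a: "0 < a" "a < 1"
    unfolding a_def using t by (auto intro!: powr_less_one simp del: of_nat_Suc)
  have "a powr (t - t') = real (Suc N) powr (- 1)"
    unfolding a_def using t by (simp add: powr_powr)
  then have Na: "real N * a powr (t - t') \<le> 1" by (simp add: powr_minus_divide)
  have "\<exists>Z. finite Z \<and> pairwise (\<lambda>x y. a ^ Suc j < dist x y) Z \<and> (\<forall>x::'a. \<exists>z\<in>Z. dist x z \<le> a ^ Suc j)" for j
    using maximal_separated_net[OF cpt, of "a ^ Suc j"] a by (metis zero_less_power)
  then obtain Z where Z: "\<And>j. finite (Z j)" "\<And>j. pairwise (\<lambda>x y. a ^ Suc j < dist x y) (Z j)"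
      "\<And>j x. \<exists>z\<in>Z j. dist (x::'a) z \<le> a ^ Suc j" by metis
  then obtain q where q: "\<And>j x. q j x \<in> Z j" "\<And>j x. dist x (q j x) \<le> a ^ Suc j" by metis
  have card: "card {z \<in> Z j. dist x z \<le> 3 * a ^ Suc j} \<le> N" for j x
  proof -
    have "real (card {z \<in> Z j. dist x z \<le> 3 * a ^ Suc j}) \<le> c\<^sup>2 * 8 powr s"
      using a by (intro card_separated_le Z power_le_one) (auto simp: mult_le_one power_le_one)
    then have "card {z \<in> Z j. dist x z \<le> 3 * a ^ Suc j} \<le> nat \<lfloor>c\<^sup>2 * 8 powr s\<rfloor>" by (rule le_nat_floor)
    then show ?thesis by (simp add: N_def)
  qed
  interpret net_cell_tree q a t Z N t'
    using a t Z(1) q card Na compact_imp_bounded[OF cpt] by unfold_locales auto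
  have "0 < net_content (range f)"
    using hausdorff_null_if_net_content_0[of "range f"] pos by (auto simp: zero_less_iff_neq_zero)
  then obtain L where L: "0 < L" "ennreal L < net_content (range f)" by (rule ennreal_pos_obtain_real)
  obtain k where k: "\<And>n. ennreal L < net_content (f ` {\<sigma>. \<forall>i<n. \<sigma> i \<le> k i})"
    using net_content_compact_boxes[OF L(2)] by blast
  have "\<exists>P w. P \<subseteq> f ` {\<sigma>. \<forall>i<n. \<sigma> i \<le> k i} \<and> frostman_weights P w \<rho>0 (a powr (- t') / L) t'"
    if \<rho>0: "0 < \<rho>0" for n \<rho>0
  proof -
    obtain m where m: "a ^ m < \<rho>0" using real_arch_pow_inv[OF \<rho>0 a(2)] by blast
    obtain P w where P: "finite P" "P \<subseteq> f ` {\<sigma>. \<forall>i<n. \<sigma> i \<le> k i}" "\<And>x. (0::real) \<le> w x"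
        "net_content (f ` {\<sigma>. \<forall>i<n. \<sigma> i \<le> k i}) \<le> ennreal (\<Sum>x\<in>P. w x)"
        "\<And>k v. k \<le> m \<Longrightarrow> (\<Sum>x | x \<in> P \<and> node q k x = v. w x) \<le> (a ^ k) powr t"
      by (rule discrete_frostman[OF finite_nodes, where m=m and A="f ` {\<sigma>. \<forall>i<n. \<sigma> i \<le> k i}"]) blast
    define W where "W = (\<Sum>x\<in>P. w x)"
    have "ennreal L < ennreal W" using less_le_trans[OF k P(4)] by (simp add: W_def)
    then have W: "L < W" using L(1) by (simp add: ennreal_less_iff)
    show ?thesis
      unfolding frostman_weights_def
    proof (intro exI[of _ P] exI[of _ "\<lambda>x. w x / W"] conjI allI impI P(1,2))
      show "0 \<le> w x / W" for x using P(3) W L(1) by simp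
      show "(\<Sum>x\<in>P. w x / W) = 1" using W L(1) by (simp add: sum_divide_distrib[symmetric] W_def)
      fix x r assume r: "\<rho>0 \<le> r" "r \<le> (1::real)"
      have "(\<Sum>y | y \<in> P \<and> dist x y \<le> 2 * r. w y / W) = (\<Sum>y | y \<in> P \<and> dist x y \<le> 2 * r. w y) / W"
        by (simp add: sum_divide_distrib)
      also have "\<dots> \<le> (a powr (- t') * r powr t') / L"
        using frostman_ball_bound[OF P(1,3,5), of m r x] m r W L(1) P(3)
        by (intro frac_le) (auto intro: sum_nonneg)
      finally show "(\<Sum>y | y \<in> P \<and> dist x y \<le> 2 * r. w y / W) \<le> a powr (- t') / L * r powr t'" by simp
    qed
  qed
  then show ?thesis using that[of "a powr (- t') / L" k] a(1) L(1) by simp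
qed


section \<open>Sparse blocks of times with large balls\<close>

text \<open>A set of times after \<open>N\<close> that are more than \<open>g\<close> apart, at least \<open>r\<^sup>-\<^sup>\<beta>\<close> in number, and at which
  the random balls have radius at least \<open>r\<close>.\<close>

definition spaced_block :: "(nat \<Rightarrow> real) \<Rightarrow> real \<Rightarrow> nat \<Rightarrow> real \<Rightarrow> nat set \<Rightarrow> nat \<Rightarrow> bool" where
  "spaced_block l \<beta> N r T g \<longleftrightarrow> 0 < r \<and> finite T \<and> T \<noteq> {} \<and> (\<forall>n\<in>T. N < n \<and> r \<le> l n) \<and>
     (\<forall>i\<in>T. \<forall>j\<in>T. i < j \<longrightarrow> i + g < j) \<and> r powr (- \<beta>) \<le> real (card T) \<and> 1 \<le> g"

text \<open>Otherwise \<open>l n \<le> n powr (- 1 / b)\<close> eventually, and \<open>u / b > 1\<close> would make the series converge.\<close>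

lemma not_summable_imp_frequently_large:
  fixes l :: "nat \<Rightarrow> real"
  assumes pos: "\<And>n. 1 \<le> n \<Longrightarrow> 0 < l n" and ns: "\<not> summable (\<lambda>n. l (Suc n) powr u)"
    and b: "0 < b" "b < u"
  shows "\<exists>n\<ge>N. 1 \<le> n \<and> l n powr (- b) < real n"
proof (rule ccontr)
  assume "\<not> ?thesis"
  then have le: "real n \<le> l n powr (- b)" if "n \<ge> N" "1 \<le> n" for n using that by (auto simp: not_less)
  have "summable (\<lambda>n. l (Suc n) powr u)"
  proof (rule summable_comparison_test_ev)
    have "summable (\<lambda>n. real (Suc n) powr (- u / b))"
      using b by (subst summable_Suc_iff) (simp add: summable_real_powr_iff field_simps)
    then show "summable (\<lambda>n. real (Suc n) powr (- u / b))" .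
    show "eventually (\<lambda>n. norm (l (Suc n) powr u) \<le> real (Suc n) powr (- u / b)) sequentially"
      unfolding eventually_sequentially
    proof (intro exI[of _ N] allI impI)
      fix n assume n: "n \<ge> N"
      have "real (Suc n) \<le> l (Suc n) powr (- b)" using le[of "Suc n"] n by simp
      then have "(l (Suc n) powr (- b)) powr (- u / b) \<le> real (Suc n) powr (- u / b)"
        using b by (intro powr_mono2') auto
      also have "(l (Suc n) powr (- b)) powr (- u / b) = l (Suc n) powr u"
        using b by (simp add: powr_powr)
      finally show "norm (l (Suc n) powr u) \<le> real (Suc n) powr (- u / b)" by simp
    qed
  qed
  with ns show False by contradiction
qed

text \<open>With \<open>r = l n\<close> for one of the times \<open>n > r\<^sup>-\<^sup>b\<close>, where \<open>\<beta> < b\<close>, all times up to \<open>n\<close> carry balls of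
  radius at least \<open>r\<close>. Keeping every \<open>(g + 1)\<close>-st of them, with \<open>g\<close> of order \<open>ln (1 / r)\<close>, still
  leaves \<open>r\<^sup>-\<^sup>\<beta>\<close> times.\<close>

lemma exists_spaced_block:
  fixes l :: "nat \<Rightarrow> real"
  assumes pos: "\<And>n. 1 \<le> n \<Longrightarrow> 0 < l n" and dec: "\<And>n. 1 \<le> n \<Longrightarrow> l (Suc n) \<le> l n" and lim: "l \<longlonglongrightarrow> 0"
    and ns: "\<not> summable (\<lambda>n. l (Suc n) powr u)" and \<beta>: "0 < \<beta>" "\<beta> < u" and "0 < r0" and A: "0 < A"
  obtains r T g where "spaced_block l \<beta> N r T g" "r < r0" "A * ln (1 / r) \<le> real g"
proof -
  obtain b where b: "\<beta> < b" "b < u" using dense[OF \<beta>(2)] by auto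
  have b0: "0 < b" using b \<beta> by simp
  have "eventually (\<lambda>r::real. real N + (r powr (- \<beta>) + 1) * (A * ln (1 / r) + 3) \<le> r powr (- b)) (at_right 0)"
    using b(1) \<beta>(1) A by real_asymp
  moreover have "eventually (\<lambda>r::real. 0 \<le> A * ln (1 / r)) (at_right 0)"
    using A by real_asymp
  moreover have "eventually (\<lambda>r::real. r < r0) (at_right 0)"
    using \<open>0 < r0\<close> by (auto simp: eventually_at_right_field)
  ultimately have "eventually (\<lambda>r::real. real N + (r powr (- \<beta>) + 1) * (A * ln (1 / r) + 3) \<le> r powr (- b)
      \<and> 0 \<le> A * ln (1 / r) \<and> r < r0) (at_right 0)"
    by eventually_elim simp
  then obtain r1 where r1: "0 < r1" "\<And>r. 0 < r \<Longrightarrow> r < r1 \<Longrightarrow>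
      real N + (r powr (- \<beta>) + 1) * (A * ln (1 / r) + 3) \<le> r powr (- b) \<and> 0 \<le> A * ln (1 / r) \<and> r < r0"
    by (auto simp: eventually_at_right_field)
  have "eventually (\<lambda>n. l n < r1) sequentially" using lim r1(1) by (rule order_tendstoD)
  then obtain N1 where N1: "\<And>n. n \<ge> N1 \<Longrightarrow> l n < r1" by (auto simp: eventually_sequentially)
  obtain n where n: "n \<ge> N1" "1 \<le> n" "l n powr (- b) < real n"
    using not_summable_imp_frequently_large[OF pos ns b0 b(2), of N1] by blast
  define r where "r = l n"
  have r: "0 < r" "r < r1" using pos[OF n(2)] N1[OF n(1)] by (auto simp: r_def)
  note R = r1(2)[OF r]
  define g where "g = Suc (nat \<lceil>A * ln (1 / r)\<rceil>)"
  define m where "m = nat \<lceil>r powr (- \<beta>)\<rceil>"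
  have g: "A * ln (1 / r) \<le> real g" "real (g + 1) \<le> A * ln (1 / r) + 3"
    using R by (auto simp: g_def) linarith+
  have m: "r powr (- \<beta>) \<le> real m" "real m \<le> r powr (- \<beta>) + 1" by (auto simp: m_def)
  have m0: "0 < m" using r(1) by (simp add: m_def)
  define T where "T = (\<lambda>i. N + 1 + i * (g + 1)) ` {..<m}"
  have inj: "inj_on (\<lambda>i. N + 1 + i * (g + 1)) {..<m}"
  proof (rule inj_onI)
    fix i j assume "N + 1 + i * (g + 1) = N + 1 + j * (g + 1)"
    then have "i * (g + 1) = j * (g + 1)" by (simp only: add_left_cancel)
    then show "i = j" by (simp only: mult_cancel2) simp
  qed
  have le_n: "k \<le> n" if k: "k \<in> T" for k
  proof -
    obtain i where i: "i < m" "k = N + 1 + i * (g + 1)" using k by (auto simp: T_def)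
    have "i * (g + 1) + 1 \<le> (i + 1) * (g + 1)" by simp
    also have "\<dots> \<le> m * (g + 1)" using i(1) by (intro mult_right_mono) auto
    finally have "k \<le> N + m * (g + 1)" using i(2) by simp
    then have "real k \<le> real N + real m * real (g + 1)" by (metis of_nat_add of_nat_le_iff of_nat_mult)
    also have "\<dots> \<le> real N + (r powr (- \<beta>) + 1) * (A * ln (1 / r) + 3)"
      using m g R by (intro add_left_mono mult_mono) auto
    also have "\<dots> \<le> r powr (- b)" using R by simp
    also have "\<dots> < real n" using n(3) by (simp add: r_def)
    finally show ?thesis by simp
  qed
  have anti: "l n \<le> l k" if "1 \<le> k" "k \<le> n" for k
    using that(2)
  proof (induction n rule: dec_induct)
    case (step j)
    then show ?case using dec[of j] that(1) by simp
  qed simp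
  show ?thesis
  proof (rule that[of r T g])
    show "r < r0" using R by simp
    show "A * ln (1 / r) \<le> real g" by (rule g)
    have N: "N < k" if "k \<in> T" for k using that by (auto simp: T_def)
    have large: "r \<le> l k" if "k \<in> T" for k unfolding r_def using N[OF that] le_n[OF that] by (intro anti) auto
    have gap: "i + g < j" if ij: "i \<in> T" "j \<in> T" "i < j" for i j
    proof -
      obtain p q where pq: "i = N + 1 + p * (g + 1)" "j = N + 1 + q * (g + 1)" using ij by (auto simp: T_def)
      have "p * (g + 1) < q * (g + 1)" using ij(3) by (simp only: pq add_less_cancel_left)
      then have "p < q" by (simp only: mult_less_cancel2)
      then have "(p + 1) * (g + 1) \<le> q * (g + 1)" by (intro mult_right_mono) auto
      then show ?thesis by (simp add: pq)
    qed
    have "r powr (- \<beta>) \<le> real (card T)" using m(1) inj by (simp add: T_def card_image)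
    moreover have "finite T" "T \<noteq> {}" using m0 by (auto simp: T_def)
    moreover have "1 \<le> g" by (simp add: g_def)
    ultimately show "spaced_block l \<beta> N r T g" using r(1) N large gap by (simp add: spaced_block_def)
  qed
qed


section \<open>Decoupling along the process\<close>

text \<open>An inequality between two measures on a sub-\<open>\<sigma>\<close>-algebra, given by densities that need not be
  measurable for it, extends from sets to nonnegative functions.\<close>

lemma nn_integral_le_of_sets:
  fixes f1 f2 :: "'w \<Rightarrow> ennreal"
  assumes sub: "space F = space M" "sets F \<subseteq> sets M"
    and f[measurable]: "f1 \<in> borel_measurable M" "f2 \<in> borel_measurable M"
    and le: "\<And>D. D \<in> sets F \<Longrightarrow> (\<integral>\<^sup>+\<omega>. f1 \<omega> * indicator D \<omega> \<partial>M) \<le> (\<integral>\<^sup>+\<omega>. f2 \<omega> * indicator D \<omega> \<partial>M)"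
    and u: "u \<in> borel_measurable F"
  shows "(\<integral>\<^sup>+\<omega>. f1 \<omega> * u \<omega> \<partial>M) \<le> (\<integral>\<^sup>+\<omega>. f2 \<omega> * u \<omega> \<partial>M)"
proof -
  have sub': "subalgebra M F" using sub by (simp add: subalgebra_def)
  show ?thesis
  using u
proof (induction u rule: borel_measurable_induct)
  case (cong f g)
  have "(\<integral>\<^sup>+\<omega>. f1 \<omega> * f \<omega> \<partial>M) = (\<integral>\<^sup>+\<omega>. f1 \<omega> * g \<omega> \<partial>M)" "(\<integral>\<^sup>+\<omega>. f2 \<omega> * f \<omega> \<partial>M) = (\<integral>\<^sup>+\<omega>. f2 \<omega> * g \<omega> \<partial>M)"
    using cong(3) sub(1) by (auto intro!: nn_integral_cong)
  with cong show ?case by simp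
next
  case (set A)
  then show ?case by (rule le)
next
  case (mult u c)
  have [measurable]: "u \<in> borel_measurable M" by (rule measurable_from_subalg[OF sub' mult(2)])
  have "(\<integral>\<^sup>+\<omega>. f \<omega> * (c * u \<omega>) \<partial>M) = c * (\<integral>\<^sup>+\<omega>. f \<omega> * u \<omega> \<partial>M)"
    if [measurable]: "f \<in> borel_measurable M" for f
    by (subst nn_integral_cmult[symmetric]) (auto simp: ac_simps)
  then show ?case using mult by (simp add: mult_left_mono)
next
  case (add u v)
  have [measurable]: "u \<in> borel_measurable M" "v \<in> borel_measurable M"
    by (rule measurable_from_subalg[OF sub'], fact)+
  show ?case using add by (simp add: distrib_left nn_integral_add add_mono)
next
  case (seq U)
  have [measurable]: "U i \<in> borel_measurable M" for i
    by (rule measurable_from_subalg[OF sub'], fact)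
  have sup: "(\<integral>\<^sup>+\<omega>. f \<omega> * (SUP i. U i) \<omega> \<partial>M) = (SUP i. \<integral>\<^sup>+\<omega>. f \<omega> * U i \<omega> \<partial>M)"
    if [measurable]: "f \<in> borel_measurable M" for f
  proof -
    have "(\<integral>\<^sup>+\<omega>. f \<omega> * (SUP i. U i) \<omega> \<partial>M) = (\<integral>\<^sup>+\<omega>. (SUP i. f \<omega> * U i \<omega>) \<partial>M)"
      by (simp add: SUP_mult_left_ennreal image_comp)
    also have "\<dots> = (SUP i. \<integral>\<^sup>+\<omega>. f \<omega> * U i \<omega> \<partial>M)"
      using seq(3) by (intro nn_integral_monotone_convergence_SUP)
        (auto simp: incseq_def le_fun_def intro!: mult_left_mono)
    finally show ?thesis .
  qed
  show ?case unfolding sup[OF f(1)] sup[OF f(2)] by (intro SUP_mono' seq)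
qed
qed

context covering_process
begin

text \<open>The \<open>\<sigma>\<close>-algebra of the process after time \<open>n\<close>.\<close>

definition fut :: "nat \<Rightarrow> 'w measure" where
  "fut n = sigma (space M) {\<xi> (n + i) -` A \<inter> space M | i A. 1 \<le> i \<and> A \<in> sets borel}"

lemma space_fut [simp]: "space (fut n) = space M"
  unfolding fut_def by (rule space_measure_of) auto

lemma sets_fut: "sets (fut n) = future_events M \<xi> n"
  unfolding fut_def future_events_def by (rule sets_measure_of) auto

lemma sets_fut_subset: "sets (fut n) \<subseteq> events"
  unfolding sets_fut future_events_def
  by (intro sets.sigma_sets_subset) (auto intro!: measurable_sets[OF measurable_process])

lemma sets_fut_antimono: "n \<le> m \<Longrightarrow> sets (fut m) \<subseteq> sets (fut n)"
  unfolding sets_fut future_events_def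
proof (intro sigma_sets_mono' subsetI)
  fix D assume "n \<le> m" and "D \<in> {\<xi> (m + i) -` A \<inter> space M | i A. 1 \<le> i \<and> A \<in> sets borel}"
  then obtain i A where D: "D = \<xi> (m + i) -` A \<inter> space M" "1 \<le> i" "A \<in> sets borel" by blast
  have "m + i = n + (i + (m - n))" using \<open>n \<le> m\<close> by simp
  then show "D \<in> {\<xi> (n + i) -` A \<inter> space M | i A. 1 \<le> i \<and> A \<in> sets borel}"
    using D \<open>n \<le> m\<close> by (intro CollectI exI[of _ "i + (m - n)"] exI[of _ A]) (simp add: add.commute)
qed

lemma measurable_process_fut: "n < k \<Longrightarrow> \<xi> k \<in> measurable (fut n) borel"
proof (rule measurableI)
  fix A :: "'a set" assume "n < k" "A \<in> sets borel"
  then show "\<xi> k -` A \<inter> space (fut n) \<in> sets (fut n)"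
    unfolding sets_fut future_events_def space_fut
    by (intro sigma_sets.Basic CollectI exI[of _ "k - n"] exI[of _ A]) auto
qed simp

text \<open>Bounded nonnegative functions of the future after time \<open>n\<close>: the class of functions from which an
  earlier hit can be split off.\<close>

definition fut_obs :: "nat \<Rightarrow> ('w \<Rightarrow> real) \<Rightarrow> bool" where
  "fut_obs n h \<longleftrightarrow> h \<in> borel_measurable (fut n) \<and> (\<forall>\<omega>. 0 \<le> h \<omega>) \<and> (\<exists>B. \<forall>\<omega>. h \<omega> \<le> B)"

lemma subalgebra_fut: "subalgebra M (fut n)"
  using sets_fut_subset by (simp add: subalgebra_def)

lemma subalgebra_fut_antimono: "n \<le> m \<Longrightarrow> subalgebra (fut n) (fut m)"
  using sets_fut_antimono by (simp add: subalgebra_def)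

lemma fut_obs_antimono: "fut_obs m h \<Longrightarrow> n \<le> m \<Longrightarrow> fut_obs n h"
  unfolding fut_obs_def by (blast intro: measurable_from_subalg[OF subalgebra_fut_antimono])

lemma fut_obs_measurable: "fut_obs n h \<Longrightarrow> h \<in> borel_measurable M"
  unfolding fut_obs_def by (blast intro: measurable_from_subalg[OF subalgebra_fut])

lemma fut_obs_integrable: "fut_obs n h \<Longrightarrow> integrable M h"
proof -
  assume h: "fut_obs n h"
  then obtain B where "\<And>\<omega>. 0 \<le> h \<omega>" "\<And>\<omega>. h \<omega> \<le> B" by (auto simp: fut_obs_def)
  then show "integrable M h"
    using fut_obs_measurable[OF h] by (intro integrable_const_bound[of _ B]) auto
qed

lemma fut_obs_const: "0 \<le> a \<Longrightarrow> fut_obs n (\<lambda>_. a)"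
  by (auto simp: fut_obs_def)

lemma fut_obs_mult: "fut_obs n f \<Longrightarrow> fut_obs n h \<Longrightarrow> fut_obs n (\<lambda>\<omega>. f \<omega> * h \<omega>)"
  unfolding fut_obs_def by (auto intro!: exI[of _ "_ * _"] mult_mono) (meson order_trans)

lemma fut_obs_sum:
  assumes "finite I" "\<And>i. i \<in> I \<Longrightarrow> fut_obs n (f i)"
  shows "fut_obs n (\<lambda>\<omega>. \<Sum>i\<in>I. f i \<omega>)"
proof -
  obtain B where "\<And>i \<omega>. i \<in> I \<Longrightarrow> f i \<omega> \<le> B i" using assms(2) unfolding fut_obs_def by metis
  then have "(\<Sum>i\<in>I. f i \<omega>) \<le> (\<Sum>i\<in>I. B i)" for \<omega> by (rule sum_mono)
  then show ?thesis
    using assms(2) unfolding fut_obs_def by (auto intro!: borel_measurable_sum sum_nonneg)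
qed

definition hit :: "'a \<Rightarrow> real \<Rightarrow> nat \<Rightarrow> 'w \<Rightarrow> real" where
  "hit x r n \<omega> = indicator (cball x r) (\<xi> n \<omega>)"

lemma fut_obs_hit:
  assumes "m < n"
  shows "fut_obs m (hit x r n)"
proof -
  have "(\<lambda>\<omega>. indicator (cball x r) (\<xi> n \<omega>) :: real) \<in> borel_measurable (fut m)"
    by (rule measurable_compose[OF measurable_process_fut[OF assms]]) (intro borel_measurable_indicator, simp)
  then show ?thesis
    unfolding fut_obs_def hit_def[abs_def] by (auto intro!: exI[of _ 1] simp: indicator_def)
qed

lemma fut_obs_integral_nonneg: "fut_obs n h \<Longrightarrow> 0 \<le> (\<integral>\<omega>. h \<omega> \<partial>M)"
  by (intro integral_nonneg_AE) (auto simp: fut_obs_def)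

text \<open>Mixing is an assertion about events and passes to functions of the future. Since it conditions an
  early time on later ones, hits are always split off in temporal order, the earliest one first.\<close>

lemma
  assumes n: "1 \<le> n" and g: "1 \<le> g" and r: "0 < r" and h: "fut_obs (n - 1 + g) h"
  shows decouple_upper: "(\<integral>\<omega>. hit x r n \<omega> * h \<omega> \<partial>M) \<le> (measure \<mu> (cball x r) + C * \<rho> ^ g) * (\<integral>\<omega>. h \<omega> \<partial>M)" (is ?U)
    and decouple_lower: "(measure \<mu> (cball x r) - C * \<rho> ^ g) * (\<integral>\<omega>. h \<omega> \<partial>M) \<le> (\<integral>\<omega>. hit x r n \<omega> * h \<omega> \<partial>M)" (is ?L)
proof -
  let ?p = "measure \<mu> (cball x r)"
  let ?A = "{\<omega> \<in> space M. \<xi> n \<omega> \<in> cball x r}"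
  have A[measurable]: "?A \<in> events" by (rule sets_ball_process[OF n])
  have err: "0 \<le> C * \<rho> ^ g" using C_pos \<rho> by simp
  have K0: "0 \<le> ?p + C * \<rho> ^ g" by (intro add_nonneg_nonneg err) simp
  have hM: "h \<in> borel_measurable M" by (rule fut_obs_measurable[OF h])
  have hit_obs: "fut_obs (n - 1) (hit x r n)" using n by (intro fut_obs_hit) simp
  have prod_obs: "fut_obs (n - 1) (\<lambda>\<omega>. hit x r n \<omega> * h \<omega>)"
    by (intro fut_obs_mult hit_obs fut_obs_antimono[OF h]) simp
  have h0: "\<And>\<omega>. 0 \<le> h \<omega>" and hit0: "\<And>\<omega>. 0 \<le> hit x r n \<omega>"
    using h by (auto simp: fut_obs_def hit_def)
  have hF: "(\<lambda>\<omega>. ennreal (h \<omega>)) \<in> borel_measurable (fut (n - 1 + g))"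
    using h by (auto simp: fut_obs_def)
  have [measurable]: "hit x r n \<in> borel_measurable M" by (rule fut_obs_measurable[OF hit_obs])
  have mix: "measure M (?A \<inter> D) \<le> (?p + C * \<rho> ^ g) * measure M D"
      "(?p - C * \<rho> ^ g) * measure M D \<le> measure M (?A \<inter> D)"
    if D: "D \<in> sets (fut (n - 1 + g))" for D
    using mixing[OF g r, of D "n - 1" x] D n unfolding sets_fut by (auto simp: algebra_simps abs_le_iff)
  have hitD: "(\<integral>\<^sup>+\<omega>. ennreal (hit x r n \<omega>) * indicator D \<omega> \<partial>M) = ennreal (measure M (?A \<inter> D))"
    if D: "D \<in> sets (fut (n - 1 + g))" for D
  proof -
    have "D \<in> events" using D sets_fut_subset by blast
    have "(\<integral>\<^sup>+\<omega>. ennreal (hit x r n \<omega>) * indicator D \<omega> \<partial>M) = (\<integral>\<^sup>+\<omega>. indicator (?A \<inter> D) \<omega> \<partial>M)"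
      by (intro nn_integral_cong) (auto simp: hit_def indicator_def)
    then show ?thesis using A \<open>D \<in> events\<close> by (simp add: emeasure_eq_measure del: mem_cball)
  qed
  have cD: "(\<integral>\<^sup>+\<omega>. ennreal K * indicator D \<omega> \<partial>M) = ennreal K * ennreal (measure M D)"
    if D: "D \<in> sets (fut (n - 1 + g))" for D K
    using D sets_fut_subset by (subst nn_integral_cmult_indicator) (auto simp: emeasure_eq_measure)
  have conv: "(\<integral>\<^sup>+\<omega>. ennreal (hit x r n \<omega>) * ennreal (h \<omega>) \<partial>M) = ennreal (\<integral>\<omega>. hit x r n \<omega> * h \<omega> \<partial>M)"
    using fut_obs_integrable[OF prod_obs] h0 hit0
    by (subst nn_integral_eq_integral[symmetric]) (auto simp: ennreal_mult)
  have conv': "(\<integral>\<^sup>+\<omega>. ennreal K * ennreal (h \<omega>) \<partial>M) = ennreal K * ennreal (\<integral>\<omega>. h \<omega> \<partial>M)" for K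
    using fut_obs_integrable[OF h] h0 hM
    by (subst nn_integral_cmult) (auto simp: nn_integral_eq_integral)
  have I0: "0 \<le> (\<integral>\<omega>. h \<omega> \<partial>M)" by (rule fut_obs_integral_nonneg[OF h])
  have I1: "0 \<le> (\<integral>\<omega>. hit x r n \<omega> * h \<omega> \<partial>M)" by (rule fut_obs_integral_nonneg[OF prod_obs])
  have "(\<integral>\<^sup>+\<omega>. ennreal (hit x r n \<omega>) * ennreal (h \<omega>) \<partial>M) \<le> (\<integral>\<^sup>+\<omega>. ennreal (?p + C * \<rho> ^ g) * ennreal (h \<omega>) \<partial>M)"
  proof (rule nn_integral_le_of_sets[OF _ _ _ _ _ hF])
    fix D assume D: "D \<in> sets (fut (n - 1 + g))"
    have "ennreal (measure M (?A \<inter> D)) \<le> ennreal ((?p + C * \<rho> ^ g) * measure M D)"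
      by (intro ennreal_leI mix D)
    then show "(\<integral>\<^sup>+\<omega>. ennreal (hit x r n \<omega>) * indicator D \<omega> \<partial>M) \<le> (\<integral>\<^sup>+\<omega>. ennreal (?p + C * \<rho> ^ g) * indicator D \<omega> \<partial>M)"
      unfolding hitD[OF D] cD[OF D] by (subst (asm) ennreal_mult'') auto
  qed (use sets_fut_subset in auto)
  then have "ennreal (\<integral>\<omega>. hit x r n \<omega> * h \<omega> \<partial>M) \<le> ennreal ((?p + C * \<rho> ^ g) * (\<integral>\<omega>. h \<omega> \<partial>M))"
    unfolding conv conv' ennreal_mult''[OF I0, symmetric] .
  then show ?U using mult_nonneg_nonneg[OF K0 I0] by (simp only: ennreal_le_iff)
  have "(\<integral>\<^sup>+\<omega>. ennreal (?p - C * \<rho> ^ g) * ennreal (h \<omega>) \<partial>M) \<le> (\<integral>\<^sup>+\<omega>. ennreal (hit x r n \<omega>) * ennreal (h \<omega>) \<partial>M)"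
  proof (rule nn_integral_le_of_sets[OF _ _ _ _ _ hF])
    fix D assume D: "D \<in> sets (fut (n - 1 + g))"
    have "ennreal ((?p - C * \<rho> ^ g) * measure M D) \<le> ennreal (measure M (?A \<inter> D))"
      by (intro ennreal_leI mix D)
    then show "(\<integral>\<^sup>+\<omega>. ennreal (?p - C * \<rho> ^ g) * indicator D \<omega> \<partial>M) \<le> (\<integral>\<^sup>+\<omega>. ennreal (hit x r n \<omega>) * indicator D \<omega> \<partial>M)"
      unfolding hitD[OF D] cD[OF D] by (subst (asm) ennreal_mult'') auto
  qed (use sets_fut_subset in auto)
  then show ?L
    unfolding conv conv' using I0 I1 by (subst (asm) ennreal_mult''[symmetric]) (auto simp: ennreal_le_iff)
qed

section \<open>Normalised hit counts of a block of times\<close>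

text \<open>Up to the mixing error, this has expectation 1 at every point \<open>x\<close>, and it vanishes at the points that lie
  in none of the balls of the block.\<close>

definition block_density :: "real \<Rightarrow> nat set \<Rightarrow> 'a \<Rightarrow> 'w \<Rightarrow> real" where
  "block_density r T x \<omega> = (\<Sum>n\<in>T. hit x r n \<omega>) / (real (card T) * measure \<mu> (cball x r))"

lemma fut_obs_block_density:
  assumes "finite T" "\<And>n. n \<in> T \<Longrightarrow> m < n"
  shows "fut_obs m (block_density r T x)"
proof -
  have "fut_obs m (\<lambda>\<omega>. (1 / (real (card T) * measure \<mu> (cball x r))) * (\<Sum>n\<in>T. hit x r n \<omega>))"
    using assms by (intro fut_obs_mult fut_obs_sum fut_obs_hit fut_obs_const) auto
  then show ?thesis by (simp add: block_density_def[abs_def])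
qed

lemma measure_ball_pos: "0 < r \<Longrightarrow> r \<le> 1 \<Longrightarrow> 0 < measure \<mu> (cball x r)"
  using ball_lower[of r x] c_ge_1 by (auto intro: less_le_trans[of _ "r powr s / c"])

lemma block_first_moment:
  assumes T: "finite T" "T \<noteq> {}" "\<And>n. n \<in> T \<Longrightarrow> 1 \<le> n" "\<And>n. n \<in> T \<Longrightarrow> n + g \<le> m"
    and g: "1 \<le> g" and r: "0 < r" "r \<le> 1" and e: "C * \<rho> ^ g \<le> e * measure \<mu> (cball x r)"
    and h: "fut_obs m h"
  shows "(1 - e) * (\<integral>\<omega>. h \<omega> \<partial>M) \<le> (\<integral>\<omega>. block_density r T x \<omega> * h \<omega> \<partial>M)"
proof -
  let ?p = "measure \<mu> (cball x r)" and ?H = "\<integral>\<omega>. h \<omega> \<partial>M"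
  have p: "0 < ?p" by (rule measure_ball_pos[OF r])
  have H: "0 \<le> ?H" by (rule fut_obs_integral_nonneg[OF h])
  have card: "0 < real (card T)" using T by (simp add: card_gt_0_iff)
  have obs: "fut_obs 0 (\<lambda>\<omega>. hit x r n \<omega> * h \<omega>)" if "n \<in> T" for n
    using T(3)[OF that] by (intro fut_obs_mult fut_obs_hit fut_obs_antimono[OF h]) auto
  have "(1 - e) * ?H = (\<Sum>n\<in>T. (1 - e) * ?p * ?H) / (real (card T) * ?p)"
    using card p by (simp add: field_simps)
  also have "\<dots> \<le> (\<Sum>n\<in>T. \<integral>\<omega>. hit x r n \<omega> * h \<omega> \<partial>M) / (real (card T) * ?p)"
  proof (intro divide_right_mono sum_mono)
    fix n assume n: "n \<in> T"
    have "(1 - e) * ?p * ?H \<le> (?p - C * \<rho> ^ g) * ?H"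
      using e H by (intro mult_right_mono) (auto simp: algebra_simps)
    also have "\<dots> \<le> (\<integral>\<omega>. hit x r n \<omega> * h \<omega> \<partial>M)"
      using T(3,4)[OF n] by (intro decouple_lower g r fut_obs_antimono[OF h]) auto
    finally show "(1 - e) * ?p * ?H \<le> (\<integral>\<omega>. hit x r n \<omega> * h \<omega> \<partial>M)" .
  qed (use p in auto)
  also have "\<dots> = (\<integral>\<omega>. (\<Sum>n\<in>T. hit x r n \<omega> * h \<omega>) / (real (card T) * ?p) \<partial>M)"
    using fut_obs_integrable[OF obs] by (subst Bochner_Integration.integral_sum[symmetric]) auto
  also have "\<dots> = (\<integral>\<omega>. block_density r T x \<omega> * h \<omega> \<partial>M)"
    by (simp add: block_density_def sum_distrib_right)
  finally show ?thesis .
qed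

text \<open>Hits at two different times decouple: the earlier one is split off first. Hits of two points
  at the same time require the points to be within \<open>2 * r\<close>; the diagonal terms of the double sum
  are fewer by the factor \<open>card T\<close>, which yields the correction term.\<close>

lemma block_second_moment:
  assumes T: "finite T" "T \<noteq> {}" "\<And>n. n \<in> T \<Longrightarrow> 1 \<le> n" "\<And>n. n \<in> T \<Longrightarrow> n + g \<le> m"
    and gap: "\<And>i j. i \<in> T \<Longrightarrow> j \<in> T \<Longrightarrow> i < j \<Longrightarrow> i + g < j"
    and g: "1 \<le> g" and r: "0 < r" "r \<le> 1" and e: "0 \<le> e" "\<And>x. C * \<rho> ^ g \<le> e * measure \<mu> (cball x r)"
    and h: "fut_obs m h"
  shows "(\<integral>\<omega>. block_density r T x \<omega> * block_density r T y \<omega> * h \<omega> \<partial>M)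
    \<le> (1 + e)\<^sup>2 * (1 + (if dist x y \<le> 2 * r then 1 / (real (card T) * measure \<mu> (cball y r)) else 0)) * (\<integral>\<omega>. h \<omega> \<partial>M)"
proof -
  let ?p = "\<lambda>x. measure \<mu> (cball x r)" and ?H = "\<integral>\<omega>. h \<omega> \<partial>M"
  let ?d = "if dist x y \<le> 2 * r then 1 else 0 :: real"
  have p: "0 < ?p z" for z by (rule measure_ball_pos[OF r])
  have H: "0 \<le> ?H" by (rule fut_obs_integral_nonneg[OF h])
  have card: "0 < real (card T)" using T by (simp add: card_gt_0_iff)
  have obs: "fut_obs 0 (\<lambda>\<omega>. hit x r i \<omega> * (hit y r j \<omega> * h \<omega>))" if "i \<in> T" "j \<in> T" for i j
    using T(3)[OF that(1)] T(3)[OF that(2)]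
    by (intro fut_obs_mult fut_obs_hit fut_obs_antimono[OF h]) auto
  have up: "(\<integral>\<omega>. hit z r n \<omega> * k \<omega> \<partial>M) \<le> (1 + e) * ?p z * (\<integral>\<omega>. k \<omega> \<partial>M)"
    if n: "n \<in> T" and k: "fut_obs (n - 1 + g) k" for z n k
  proof -
    have "(\<integral>\<omega>. hit z r n \<omega> * k \<omega> \<partial>M) \<le> (?p z + C * \<rho> ^ g) * (\<integral>\<omega>. k \<omega> \<partial>M)"
      by (intro decouple_upper T(3) n g r k)
    also have "\<dots> \<le> (1 + e) * ?p z * (\<integral>\<omega>. k \<omega> \<partial>M)"
      using e(2)[of z] by (intro mult_right_mono fut_obs_integral_nonneg[OF k]) (auto simp: algebra_simps)
    finally show ?thesis .
  qed
  have up2: "(\<integral>\<omega>. hit z r i \<omega> * (hit z' r j \<omega> * h \<omega>) \<partial>M) \<le> (1 + e)\<^sup>2 * ?p z * ?p z' * ?H"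
    if ij: "i \<in> T" "j \<in> T" "i < j" for i j z z'
  proof -
    have k: "fut_obs (i - 1 + g) (\<lambda>\<omega>. hit z' r j \<omega> * h \<omega>)"
      using gap[OF ij] T(4)[OF ij(1)] by (intro fut_obs_mult fut_obs_hit fut_obs_antimono[OF h]) auto
    have "(\<integral>\<omega>. hit z r i \<omega> * (hit z' r j \<omega> * h \<omega>) \<partial>M) \<le> (1 + e) * ?p z * (\<integral>\<omega>. hit z' r j \<omega> * h \<omega> \<partial>M)"
      by (rule up[OF ij(1) k])
    also have "\<dots> \<le> (1 + e) * ?p z * ((1 + e) * ?p z' * ?H)"
      using T(4)[OF ij(2)] e(1) p[of z]
      by (intro mult_left_mono up ij fut_obs_antimono[OF h]) auto
    finally show ?thesis by (simp add: power2_eq_square mult_ac)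
  qed
  have pair: "(\<integral>\<omega>. hit x r i \<omega> * (hit y r j \<omega> * h \<omega>) \<partial>M)
      \<le> (1 + e)\<^sup>2 * ?p x * ?H * (?p y + (if i = j then ?d else 0))" if ij: "i \<in> T" "j \<in> T" for i j
  proof -
    consider "i < j" | "j < i" | "i = j" by linarith
    then show ?thesis
    proof cases
      case 1
      then show ?thesis using up2[OF ij 1, of x y] by (simp add: mult_ac)
    next
      case 2
      then show ?thesis using up2[OF ij(2,1) 2, of y x] by (simp add: mult_ac)
    next
      case 3
      have "(\<integral>\<omega>. hit x r i \<omega> * (hit y r i \<omega> * h \<omega>) \<partial>M) \<le> (\<integral>\<omega>. hit x r i \<omega> * (?d * h \<omega>) \<partial>M)"
      proof (rule integral_mono)
        show "integrable M (\<lambda>\<omega>. hit x r i \<omega> * (hit y r i \<omega> * h \<omega>))"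
          by (rule fut_obs_integrable[OF obs[OF ij(1,1)]])
        have "fut_obs 0 (\<lambda>\<omega>. hit x r i \<omega> * (?d * h \<omega>))"
          using T(3)[OF ij(1)] by (intro fut_obs_mult fut_obs_hit fut_obs_const fut_obs_antimono[OF h]) auto
        then show "integrable M (\<lambda>\<omega>. hit x r i \<omega> * (?d * h \<omega>))" by (rule fut_obs_integrable)
        fix \<omega>
        have "0 \<le> h \<omega>" using h by (simp add: fut_obs_def)
        moreover have "dist x y \<le> 2 * r" if "dist x (\<xi> i \<omega>) \<le> r" "dist y (\<xi> i \<omega>) \<le> r"
          using that dist_triangle2[of x y "\<xi> i \<omega>"] by simp
        ultimately show "hit x r i \<omega> * (hit y r i \<omega> * h \<omega>) \<le> hit x r i \<omega> * (?d * h \<omega>)"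
          by (auto simp: hit_def indicator_def)
      qed
      also have "\<dots> \<le> (1 + e) * ?p x * (\<integral>\<omega>. ?d * h \<omega> \<partial>M)"
        using T(4)[OF ij(1)] by (intro up ij fut_obs_mult fut_obs_const fut_obs_antimono[OF h]) auto
      also have "\<dots> = (1 + e) * (?p x * ?H * ?d)" by simp
      also have "\<dots> \<le> (1 + e)\<^sup>2 * (?p x * ?H * ?d)"
        using e(1) p[of x] H by (intro mult_right_mono) (auto simp: power2_eq_square)
      also have "\<dots> \<le> (1 + e)\<^sup>2 * (?p x * ?H * (?p y + ?d))"
        using e(1) p[of x] p[of y] H by (intro mult_left_mono) auto
      finally show ?thesis using 3 by (simp add: mult_ac)
    qed
  qed
  have "(\<integral>\<omega>. block_density r T x \<omega> * block_density r T y \<omega> * h \<omega> \<partial>M)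
      = (\<integral>\<omega>. (\<Sum>i\<in>T. \<Sum>j\<in>T. hit x r i \<omega> * (hit y r j \<omega> * h \<omega>)) / ((real (card T))\<^sup>2 * ?p x * ?p y) \<partial>M)"
  proof (intro Bochner_Integration.integral_cong refl)
    fix \<omega>
    have "(\<Sum>i\<in>T. \<Sum>j\<in>T. hit x r i \<omega> * hit y r j \<omega> * h \<omega>) = (\<Sum>i\<in>T. hit x r i \<omega>) * (\<Sum>j\<in>T. hit y r j \<omega>) * h \<omega>"
      unfolding sum_product by (simp only: sum_distrib_right)
    then show "block_density r T x \<omega> * block_density r T y \<omega> * h \<omega>
        = (\<Sum>i\<in>T. \<Sum>j\<in>T. hit x r i \<omega> * (hit y r j \<omega> * h \<omega>)) / ((real (card T))\<^sup>2 * ?p x * ?p y)"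
      by (simp add: block_density_def power2_eq_square mult.assoc)
  qed
  also have "\<dots> = (\<Sum>i\<in>T. \<Sum>j\<in>T. \<integral>\<omega>. hit x r i \<omega> * (hit y r j \<omega> * h \<omega>) \<partial>M) / ((real (card T))\<^sup>2 * ?p x * ?p y)"
    using fut_obs_integrable[OF obs]
    by (simp add: Bochner_Integration.integral_sum Bochner_Integration.integrable_sum)
  also have "\<dots> \<le> (\<Sum>i\<in>T. \<Sum>j\<in>T. (1 + e)\<^sup>2 * ?p x * ?H * (?p y + (if i = j then ?d else 0))) / ((real (card T))\<^sup>2 * ?p x * ?p y)"
    using p[of x] p[of y] by (intro divide_right_mono sum_mono pair) auto
  also have "(\<Sum>i\<in>T. \<Sum>j\<in>T. (1 + e)\<^sup>2 * ?p x * ?H * (?p y + (if i = j then ?d else 0)))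
      = (1 + e)\<^sup>2 * ?p x * ?H * ((real (card T))\<^sup>2 * ?p y + real (card T) * ?d)"
    using T(1) by (simp add: sum_distrib_left[symmetric] sum.distrib sum.delta power2_eq_square del: sum_distrib_left) (simp add: algebra_simps)
  also have "\<dots> / ((real (card T))\<^sup>2 * ?p x * ?p y)
      = (1 + e)\<^sup>2 * (1 + ?d / (real (card T) * ?p y)) * ?H"
    using p[of x] p[of y] card by (simp add: field_simps power2_eq_square)
  also have "?d / (real (card T) * ?p y) = (if dist x y \<le> 2 * r then 1 / (real (card T) * ?p y) else 0)"
    by simp
  finally show ?thesis .
qed

end


section \<open>Products over independent blocks\<close>

text \<open>Blocks in temporal order. The gap \<open>g j\<close> belongs to the earlier of two times, and \<open>e j\<close>
  bounds the mixing error relative to the measure of a ball of radius \<open>r j\<close>.\<close>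

locale block_sequence = covering_process M \<xi> \<mu> s C \<rho> c
  for M :: "'w measure" and \<xi> :: "nat \<Rightarrow> 'w \<Rightarrow> 'a::metric_space" and \<mu> :: "'a measure" and s C \<rho> c :: real +
  fixes r :: "nat \<Rightarrow> real" and T :: "nat \<Rightarrow> nat set" and g :: "nat \<Rightarrow> nat" and e :: "nat \<Rightarrow> real"
  assumes T: "\<And>j. finite (T j)" "\<And>j. T j \<noteq> {}" "\<And>j n. n \<in> T j \<Longrightarrow> 1 \<le> n"
    and r: "\<And>j. 0 < r j" "\<And>j. r j \<le> 1" and g: "\<And>j. 1 \<le> g j"
    and e: "\<And>j. 0 \<le> e j" "\<And>j. e j \<le> 1" "\<And>j x. C * \<rho> ^ g j \<le> e j * measure \<mu> (cball x (r j))"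
    and gap_within: "\<And>j m n. m \<in> T j \<Longrightarrow> n \<in> T j \<Longrightarrow> m < n \<Longrightarrow> m + g j < n"
    and gap_between: "\<And>i j m n. i < j \<Longrightarrow> m \<in> T i \<Longrightarrow> n \<in> T j \<Longrightarrow> m + g i < n"
begin

text \<open>The excess, over independence, of the correlation between two points in the \<open>j\<close>-th block.\<close>

definition overlap :: "nat \<Rightarrow> 'a \<Rightarrow> 'a \<Rightarrow> real" where
  "overlap j x y = (if dist x y \<le> 2 * r j then 1 / (real (card (T j)) * measure \<mu> (cball y (r j))) else 0)"

text \<open>Density, with respect to a deterministic measure, of a random measure carried by the points that are covered in each
  of the first \<open>J\<close> blocks.\<close>

definition density :: "nat \<Rightarrow> 'a \<Rightarrow> 'w \<Rightarrow> real" where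
  "density J x \<omega> = (\<Prod>j<J. block_density (r j) (T j) x \<omega>)"

lemma overlap_nonneg: "0 \<le> overlap j x y"
  using measure_ball_pos[OF r(1,2)[of j], of y] by (simp add: overlap_def)

lemma fut_obs_tail:
  assumes "\<And>j n. i \<le> j \<Longrightarrow> j < J \<Longrightarrow> n \<in> T j \<Longrightarrow> m < n"
  shows "fut_obs m (\<lambda>\<omega>. \<Prod>j\<in>{i..<J}. block_density (r j) (T j) x \<omega>)"
  using assms
proof (induction J)
  case 0
  then show ?case by (simp add: fut_obs_const)
next
  case (Suc J)
  show ?case
  proof (cases "i \<le> J")
    case True
    have "fut_obs m (\<lambda>\<omega>. block_density (r J) (T J) x \<omega> * (\<Prod>j\<in>{i..<J}. block_density (r j) (T j) x \<omega>))"
      using Suc T(1) True by (intro fut_obs_mult fut_obs_block_density Suc.IH) auto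
    then show ?thesis using True by (simp add: mult.commute)
  qed (simp add: fut_obs_const)
qed

lemma fut_obs_density: "fut_obs 0 (density J x)"
  unfolding density_def[abs_def] lessThan_atLeast0 using T(3) by (intro fut_obs_tail) fastforce

lemma density_nonneg: "0 \<le> density J x \<omega>"
  using fut_obs_density[of J x] by (simp add: fut_obs_def)

text \<open>Blocks are removed one at a time, beginning with the earliest.\<close>

lemma density_first_moment: "(\<Prod>j<J. 1 - e j) \<le> (\<integral>\<omega>. density J x \<omega> \<partial>M)"
proof -
  have "(\<Prod>j\<in>{i..<J}. 1 - e j) \<le> (\<integral>\<omega>. (\<Prod>j\<in>{i..<J}. block_density (r j) (T j) x \<omega>) \<partial>M)" if "i \<le> J" for i
    using that
  proof (induction i rule: inc_induct)
    case base
    then show ?case by (simp add: prob_space)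
  next
    case (step i)
    define m where "m = Max (T i) + g i"
    let ?h = "\<lambda>\<omega>. \<Prod>j\<in>{Suc i..<J}. block_density (r j) (T j) x \<omega>"
    have h: "fut_obs m ?h"
      using gap_between[of i _ "Max (T i)"] Max_in[OF T(1,2)] unfolding m_def
      by (intro fut_obs_tail) (auto simp: Suc_le_eq)
    have "(\<Prod>j\<in>{i..<J}. 1 - e j) = (1 - e i) * (\<Prod>j\<in>{Suc i..<J}. 1 - e j)"
      using step by (subst prod.atLeast_Suc_lessThan) auto
    also have "\<dots> \<le> (1 - e i) * (\<integral>\<omega>. ?h \<omega> \<partial>M)"
      using step e(2)[of i] by (intro mult_left_mono) auto
    also have "\<dots> \<le> (\<integral>\<omega>. block_density (r i) (T i) x \<omega> * ?h \<omega> \<partial>M)"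
      by (intro block_first_moment[where m = m, OF T(1,2,3) _ g r e(3) h])
        (auto simp: m_def T(1))
    also have "\<dots> = (\<integral>\<omega>. (\<Prod>j\<in>{i..<J}. block_density (r j) (T j) x \<omega>) \<partial>M)"
      using step by (subst prod.atLeast_Suc_lessThan) auto
    finally show ?case .
  qed
  from this[of 0] show ?thesis by (simp add: density_def lessThan_atLeast0)
qed

lemma density_second_moment:
  "(\<integral>\<omega>. density J x \<omega> * density J y \<omega> \<partial>M) \<le> (\<Prod>j<J. (1 + e j)\<^sup>2 * (1 + overlap j x y))"
proof -
  have "(\<integral>\<omega>. (\<Prod>j\<in>{i..<J}. block_density (r j) (T j) x \<omega>) * (\<Prod>j\<in>{i..<J}. block_density (r j) (T j) y \<omega>) \<partial>M)
      \<le> (\<Prod>j\<in>{i..<J}. (1 + e j)\<^sup>2 * (1 + overlap j x y))" if "i \<le> J" for i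
    using that
  proof (induction i rule: inc_induct)
    case base
    then show ?case by (simp add: prob_space)
  next
    case (step i)
    define m where "m = Max (T i) + g i"
    let ?h = "\<lambda>z \<omega>. \<Prod>j\<in>{Suc i..<J}. block_density (r j) (T j) z \<omega>"
    have h: "fut_obs m (\<lambda>\<omega>. ?h x \<omega> * ?h y \<omega>)"
      using gap_between[of i _ "Max (T i)"] Max_in[OF T(1,2)] unfolding m_def
      by (intro fut_obs_mult fut_obs_tail) (auto simp: Suc_le_eq)
    have "(\<integral>\<omega>. (\<Prod>j\<in>{i..<J}. block_density (r j) (T j) x \<omega>) * (\<Prod>j\<in>{i..<J}. block_density (r j) (T j) y \<omega>) \<partial>M)
        = (\<integral>\<omega>. block_density (r i) (T i) x \<omega> * block_density (r i) (T i) y \<omega> * (?h x \<omega> * ?h y \<omega>) \<partial>M)"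
      using step by (intro Bochner_Integration.integral_cong) (auto simp: prod.atLeast_Suc_lessThan)
    also have "\<dots> \<le> (1 + e i)\<^sup>2 * (1 + overlap i x y) * (\<integral>\<omega>. ?h x \<omega> * ?h y \<omega> \<partial>M)"
      unfolding overlap_def
      by (intro block_second_moment[where m = m and g = "g i", OF T(1,2,3) _ gap_within g r e(1,3) h])
        (auto simp: m_def T(1))
    also have "\<dots> \<le> (1 + e i)\<^sup>2 * (1 + overlap i x y) * (\<Prod>j\<in>{Suc i..<J}. (1 + e j)\<^sup>2 * (1 + overlap j x y))"
      using step overlap_nonneg[of i x y] by (intro mult_left_mono) auto
    also have "\<dots> = (\<Prod>j\<in>{i..<J}. (1 + e j)\<^sup>2 * (1 + overlap j x y))"
      using step by (subst (2) prod.atLeast_Suc_lessThan) auto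
    finally show ?case .
  qed
  from this[of 0] show ?thesis by (simp add: density_def lessThan_atLeast0)
qed

text \<open>Telescoping. For nested conditions on the distance of two points, this turns the product over the
  blocks into a sum in which every scale occurs only once.\<close>

lemma prod_one_plus_expand:
  fixes a :: "nat \<Rightarrow> real"
  shows "(\<Prod>j<J. 1 + a j) = 1 + (\<Sum>j<J. a j * (\<Prod>i<j. 1 + a i))"
  by (induction J) (auto simp: algebra_simps)

text \<open>The second moment of the random measure, tested against a kernel. The main term is the value for the
  deterministic weights; the pairs that are close at the scale of block \<open>j\<close> contribute at most
  \<open>\<delta> / 2 * (1/2) ^ j\<close>, by the hypothesis \<open>near\<close>, which is met by choosing the scales to
  decrease rapidly. It is used for the Riesz kernel and for the constant kernel.\<close>

lemma weighted_pair_sum: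
  fixes \<kappa> :: "'a \<Rightarrow> 'a \<Rightarrow> real" and A :: "nat \<Rightarrow> real"
  assumes P: "finite P" and w: "\<And>x. 0 \<le> w x" and \<kappa>: "\<And>x y. 0 \<le> \<kappa> x y" and "0 \<le> \<delta>"
    and e_small: "\<And>j. e j \<le> \<delta> / 2 * (1/2) ^ j" and base: "(\<Sum>x\<in>P. \<Sum>y\<in>P. w x * w y * \<kappa> x y) \<le> K"
    and A: "\<And>j x y. overlap j x y * (\<Prod>i<j. 1 + overlap i x y) \<le> A j * (if dist x y \<le> 2 * r j then 1 else 0)"
    and near: "\<And>j. j < J \<Longrightarrow> A j * (\<Sum>x\<in>P. \<Sum>y\<in>P. w x * w y * \<kappa> x y * (if dist x y \<le> 2 * r j then 1 else 0)) \<le> \<delta> / 2 * (1/2) ^ j"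
  shows "(\<Sum>x\<in>P. \<Sum>y\<in>P. w x * w y * \<kappa> x y * (\<integral>\<omega>. density J x \<omega> * density J y \<omega> \<partial>M)) \<le> exp (2 * \<delta>) * (K + \<delta>)"
proof -
  let ?d = "\<lambda>j x y. if dist x y \<le> 2 * r j then 1 else 0 :: real"
  have geo: "(\<Sum>j<J. \<delta> / 2 * (1/2) ^ j) \<le> \<delta>" using \<open>0 \<le> \<delta>\<close> by (rule sum_half_powers_le)
  have "(\<Prod>j<J. 1 + e j) \<le> (\<Prod>j<J. exp (e j))"
    using e(1) by (intro prod_mono) (auto intro: add_nonneg_nonneg)
  also have "\<dots> = exp (\<Sum>j<J. e j)" by (simp add: exp_sum)
  also have "\<dots> \<le> exp \<delta>"
    using geo sum_mono[of "{..<J}" e "\<lambda>j. \<delta> / 2 * (1/2) ^ j"] e_small by (simp del: times_divide_eq_left)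
  finally have pe: "(\<Prod>j<J. 1 + e j) \<le> exp \<delta>" .
  have pe2: "(\<Prod>j<J. (1 + e j)\<^sup>2) \<le> exp (2 * \<delta>)"
  proof -
    have "(\<Prod>j<J. (1 + e j)\<^sup>2) = (\<Prod>j<J. 1 + e j)\<^sup>2" by (simp add: prod_power_distrib)
    also have "\<dots> \<le> (exp \<delta>)\<^sup>2" using pe e(1) by (intro power_mono prod_nonneg) (auto intro: add_nonneg_nonneg)
    finally show ?thesis by (simp add: exp_double)
  qed
  have "(\<integral>\<omega>. density J x \<omega> * density J y \<omega> \<partial>M) \<le> exp (2 * \<delta>) * (1 + (\<Sum>j<J. A j * ?d j x y))" for x y
  proof -
    have "(\<integral>\<omega>. density J x \<omega> * density J y \<omega> \<partial>M) \<le> (\<Prod>j<J. (1 + e j)\<^sup>2) * (\<Prod>j<J. 1 + overlap j x y)"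
      using density_second_moment[of J x y] by (simp add: prod.distrib)
    also have "\<dots> \<le> exp (2 * \<delta>) * (1 + (\<Sum>j<J. A j * ?d j x y))"
    proof (intro mult_mono pe2)
      show "(\<Prod>j<J. 1 + overlap j x y) \<le> 1 + (\<Sum>j<J. A j * ?d j x y)"
        by (subst prod_one_plus_expand) (intro add_left_mono sum_mono A)
      show "0 \<le> (\<Prod>j<J. 1 + overlap j x y)"
        using overlap_nonneg by (intro prod_nonneg) (auto intro: add_nonneg_nonneg)
    qed simp
    finally show ?thesis .
  qed
  then have "(\<Sum>x\<in>P. \<Sum>y\<in>P. w x * w y * \<kappa> x y * (\<integral>\<omega>. density J x \<omega> * density J y \<omega> \<partial>M))
      \<le> (\<Sum>x\<in>P. \<Sum>y\<in>P. w x * w y * \<kappa> x y * (exp (2 * \<delta>) * (1 + (\<Sum>j<J. A j * ?d j x y))))"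
    using w \<kappa> by (intro sum_mono mult_left_mono) auto
  also have "\<dots> = (\<Sum>x\<in>P. \<Sum>y\<in>P. exp (2 * \<delta>) * (w x * w y * \<kappa> x y + (\<Sum>j<J. A j * (w x * w y * \<kappa> x y * ?d j x y))))"
    by (intro sum.cong refl) (simp add: sum_distrib_left distrib_left mult_ac)
  also have "\<dots> = exp (2 * \<delta>) * ((\<Sum>x\<in>P. \<Sum>y\<in>P. w x * w y * \<kappa> x y)
      + (\<Sum>x\<in>P. \<Sum>y\<in>P. \<Sum>j<J. A j * (w x * w y * \<kappa> x y * ?d j x y)))"
    by (simp only: sum_distrib_left[symmetric] sum.distrib)
  also have "(\<Sum>x\<in>P. \<Sum>y\<in>P. \<Sum>j<J. A j * (w x * w y * \<kappa> x y * ?d j x y))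
      = (\<Sum>x\<in>P. \<Sum>j<J. \<Sum>y\<in>P. A j * (w x * w y * \<kappa> x y * ?d j x y))"
    by (intro sum.cong refl sum.swap)
  also have "\<dots> = (\<Sum>j<J. \<Sum>x\<in>P. \<Sum>y\<in>P. A j * (w x * w y * \<kappa> x y * ?d j x y))"
    by (rule sum.swap)
  also have "\<dots> = (\<Sum>j<J. A j * (\<Sum>x\<in>P. \<Sum>y\<in>P. w x * w y * \<kappa> x y * ?d j x y))"
    by (simp only: sum_distrib_left)
  also have "exp (2 * \<delta>) * ((\<Sum>x\<in>P. \<Sum>y\<in>P. w x * w y * \<kappa> x y) + \<dots>) \<le> exp (2 * \<delta>) * (K + \<delta>)"
  proof (intro mult_left_mono add_mono base)
    have "(\<Sum>j<J. A j * (\<Sum>x\<in>P. \<Sum>y\<in>P. w x * w y * \<kappa> x y * ?d j x y)) \<le> (\<Sum>j<J. \<delta> / 2 * (1/2) ^ j)"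
      using near by (intro sum_mono) auto
    then show "(\<Sum>j<J. A j * (\<Sum>x\<in>P. \<Sum>y\<in>P. w x * w y * \<kappa> x y * ?d j x y)) \<le> \<delta>"
      using geo by (rule order_trans)
  qed simp
  finally show ?thesis .
qed

end


section \<open>From energy bounds to positive Hausdorff measure\<close>

text \<open>A discretised Riesz kernel, for \<open>\<theta> > 0\<close> comparable to \<open>max (dist x y) ((1/2) ^ m) powr (- \<theta>)\<close> at
  distances up to 2. The cut-off at the resolution \<open>(1/2) ^ m\<close> keeps the energy of point masses
  finite.\<close>

definition dyadic_kernel :: "real \<Rightarrow> nat \<Rightarrow> 'a::metric_space \<Rightarrow> 'a \<Rightarrow> real" where
  "dyadic_kernel \<theta> m x y = (\<Sum>k\<le>m. (2 ^ k) powr \<theta> * (if dist x y \<le> 2 * (1/2) ^ k then 1 else 0))"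

lemma dyadic_kernel_nonneg: "0 \<le> dyadic_kernel \<theta> m x y"
  unfolding dyadic_kernel_def by (intro sum_nonneg) auto

text \<open>On a ball of radius \<open>r\<close> the kernel is at least \<open>(2 * r) powr (- \<theta>)\<close>, provided that \<open>r\<close> is above the
  resolution.\<close>

lemma mass_ball_le_energy:
  fixes v :: "'a::metric_space \<Rightarrow> real"
  assumes D: "finite D" "D \<subseteq> ball z r" and v: "\<And>x. 0 \<le> v x" and r: "(1/2) ^ m \<le> r" "r \<le> 1" and \<theta>: "0 \<le> \<theta>"
  shows "(\<Sum>x\<in>D. v x)\<^sup>2 \<le> (2 * r) powr \<theta> * (\<Sum>x\<in>D. \<Sum>y\<in>D. v x * v y * dyadic_kernel \<theta> m x y)"
proof -
  obtain k where k: "k \<le> m" "r \<le> (1/2) ^ k" "(1/2) ^ Suc k \<le> r"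
    using geometric_scale[OF _ _ r] by auto
  have r0: "0 < r" using r(1) by (meson half_gt_zero_iff less_le_trans zero_less_one zero_less_power)
  have one: "1 \<le> (2 * r) powr \<theta> * dyadic_kernel \<theta> m x y" if "x \<in> D" "y \<in> D" for x y
  proof -
    have "dist z x < r" "dist z y < r" using that D(2) by auto
    then have "dist x y \<le> 2 * (1/2) ^ k"
      using dist_triangle3[of x y z] k(2) by linarith
    then have "(2 ^ k) powr \<theta> = (2 ^ k) powr \<theta> * (if dist x y \<le> 2 * (1/2) ^ k then 1 else 0)" by simp
    also have "\<dots> \<le> dyadic_kernel \<theta> m x y"
      unfolding dyadic_kernel_def using k(1)
      by (intro member_le_sum[where f="\<lambda>k. (2 ^ k) powr \<theta> * (if dist x y \<le> 2 * (1/2) ^ k then 1 else 0)"]) auto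
    finally have le: "(2 ^ k) powr \<theta> \<le> dyadic_kernel \<theta> m x y" .
    have "1 \<le> 2 * r * 2 ^ k" using k(3) by (simp add: power_one_over field_simps)
    then have "1 \<le> (2 * r * 2 ^ k) powr \<theta>" using \<theta> by (simp add: ge_one_powr_ge_zero)
    also have "\<dots> = (2 * r) powr \<theta> * (2 ^ k) powr \<theta>" using r0 by (simp add: powr_mult)
    also have "\<dots> \<le> (2 * r) powr \<theta> * dyadic_kernel \<theta> m x y" using le by (intro mult_left_mono) auto
    finally show ?thesis .
  qed
  have "(\<Sum>x\<in>D. v x)\<^sup>2 = (\<Sum>x\<in>D. \<Sum>y\<in>D. v x * v y * 1)"
    by (simp add: power2_eq_square sum_product)
  also have "\<dots> \<le> (\<Sum>x\<in>D. \<Sum>y\<in>D. v x * v y * ((2 * r) powr \<theta> * dyadic_kernel \<theta> m x y))"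
    using one v by (intro sum_mono mult_left_mono) auto
  also have "\<dots> = (2 * r) powr \<theta> * (\<Sum>x\<in>D. \<Sum>y\<in>D. v x * v y * dyadic_kernel \<theta> m x y)"
    by (simp add: sum_distrib_left mult_ac)
  finally show ?thesis .
qed

text \<open>The mass distribution principle in energy form: split the mass disjointly among the balls and
  apply the Cauchy-Schwarz inequality.\<close>

lemma mass_le_energy_cover:
  fixes v :: "'a::metric_space \<Rightarrow> real" and I :: nat
  assumes P: "finite P" and v: "\<And>x. 0 \<le> v x" and cov: "\<And>x. x \<in> P \<Longrightarrow> v x \<noteq> 0 \<Longrightarrow> \<exists>i<I. x \<in> ball (z i) (r i)"
    and r: "\<And>i. i < I \<Longrightarrow> (1/2) ^ m \<le> r i" "\<And>i. i < I \<Longrightarrow> r i \<le> 1" and \<theta>: "0 \<le> \<theta>"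
    and en: "(\<Sum>x\<in>P. \<Sum>y\<in>P. v x * v y * dyadic_kernel \<theta> m x y) \<le> K"
  shows "(\<Sum>x\<in>P. v x)\<^sup>2 \<le> 2 powr \<theta> * (\<Sum>i<I. r i powr \<theta>) * K"
proof -
  define \<iota> where "\<iota> x = (LEAST i. x \<in> ball (z i) (r i))" for x
  define D where "D i = {x \<in> P. v x \<noteq> 0 \<and> \<iota> x = i}" for i
  let ?E = "\<lambda>A. \<Sum>x\<in>A. \<Sum>y\<in>A. v x * v y * dyadic_kernel \<theta> m x y"
  have \<iota>: "\<iota> x < I" "x \<in> ball (z (\<iota> x)) (r (\<iota> x))" if x: "x \<in> P" "v x \<noteq> 0" for x
  proof -
    obtain i where i: "i < I" "x \<in> ball (z i) (r i)" using cov[OF x] by blast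
    show "x \<in> ball (z (\<iota> x)) (r (\<iota> x))" unfolding \<iota>_def by (rule LeastI[of _ i]) (rule i)
    have "\<iota> x \<le> i" unfolding \<iota>_def using i(2) by (rule Least_le)
    then show "\<iota> x < I" using i(1) by simp
  qed
  have fin: "finite (D i)" for i using P by (simp add: D_def)
  have sub: "D i \<subseteq> ball (z i) (r i)" for i using \<iota>(2) by (auto simp: D_def simp del: mem_ball)
  have disj: "disjoint_family_on D {..<I}" by (auto simp: disjoint_family_on_def D_def)
  have un: "(\<Union>i<I. D i) = {x \<in> P. v x \<noteq> 0}" using \<iota>(1) by (auto simp: D_def)
  have E0: "0 \<le> ?E A" for A
    using v dyadic_kernel_nonneg by (intro sum_nonneg mult_nonneg_nonneg) auto
  have "(\<Sum>x\<in>P. v x) = (\<Sum>x\<in>{x \<in> P. v x \<noteq> 0}. v x)"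
    using P by (intro sum.mono_neutral_right) auto
  also have "\<dots> = (\<Sum>i<I. \<Sum>x\<in>D i. v x)"
    unfolding un[symmetric] using fin disj by (intro sum.UNION_disjoint) (auto simp: disjoint_family_on_def)
  finally have eq: "(\<Sum>x\<in>P. v x) = (\<Sum>i<I. \<Sum>x\<in>D i. v x)" .
  have "(\<Sum>x\<in>D i. v x) \<le> sqrt ((2 * r i) powr \<theta>) * sqrt (?E (D i))" if "i < I" for i
    using mass_ball_le_energy[where v=v, OF fin[of i] sub[of i] v r(1,2)[OF that] \<theta>]
    by (simp only: real_sqrt_mult[symmetric]) (rule real_le_rsqrt)
  then have "(\<Sum>x\<in>P. v x) \<le> (\<Sum>i<I. sqrt ((2 * r i) powr \<theta>) * sqrt (?E (D i)))"
    unfolding eq by (intro sum_mono) auto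
  then have "(\<Sum>x\<in>P. v x)\<^sup>2 \<le> (\<Sum>i<I. sqrt ((2 * r i) powr \<theta>) * sqrt (?E (D i)))\<^sup>2"
    using v by (intro power_mono sum_nonneg) auto
  also have "\<dots> \<le> (\<Sum>i<I. (sqrt ((2 * r i) powr \<theta>))\<^sup>2) * (\<Sum>i<I. (sqrt (?E (D i)))\<^sup>2)"
    by (rule Cauchy_Schwarz_ineq_sum)
  also have "\<dots> = (\<Sum>i<I. (2 * r i) powr \<theta>) * (\<Sum>i<I. ?E (D i))"
    using E0 by simp
  also have "\<dots> \<le> (2 powr \<theta> * (\<Sum>i<I. r i powr \<theta>)) * K"
  proof (rule mult_mono)
    have "(2 * r i) powr \<theta> = 2 powr \<theta> * r i powr \<theta>" if "i < I" for i
      using order_trans[OF _ r(1)[OF that], of 0] by (simp add: powr_mult)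
    then show "(\<Sum>i<I. (2 * r i) powr \<theta>) \<le> 2 powr \<theta> * (\<Sum>i<I. r i powr \<theta>)"
      by (simp add: sum_distrib_left)
    have "(\<Sum>i<I. ?E (D i)) \<le> (\<Sum>i<I. \<Sum>x\<in>D i. \<Sum>y\<in>P. v x * v y * dyadic_kernel \<theta> m x y)"
      using P v dyadic_kernel_nonneg
      by (intro sum_mono sum_mono2 mult_nonneg_nonneg) (auto simp: D_def)
    also have "\<dots> = (\<Sum>x\<in>(\<Union>i<I. D i). \<Sum>y\<in>P. v x * v y * dyadic_kernel \<theta> m x y)"
      using fin disj by (intro sum.UNION_disjoint[symmetric]) (auto simp: disjoint_family_on_def)
    also have "\<dots> \<le> ?E P"
      using P v dyadic_kernel_nonneg unfolding un
      by (intro sum_mono2 sum_nonneg mult_nonneg_nonneg) auto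
    finally show "(\<Sum>i<I. ?E (D i)) \<le> K" using en by simp
    show "0 \<le> (\<Sum>i<I. ?E (D i))" by (rule sum_nonneg) (rule E0)
  qed (intro mult_nonneg_nonneg sum_nonneg; simp)
  finally show ?thesis .
qed

text \<open>The covering sets are enlarged to open balls, so that compactness applies. The radius is chosen to
  make \<open>r\<^sup>\<theta>\<close> exceed \<open>diam\<^sup>\<theta>\<close> by a summable error, which works for sets of diameter 0 as well.\<close>

lemma hausdorff_null_ball_cover:
  fixes A :: "'a::metric_space set"
  assumes null: "hausdorff_measure \<theta> A = 0" and \<theta>: "0 < \<theta>" and \<eta>: "0 < \<eta>"
  obtains z :: "nat \<Rightarrow> 'a" and r :: "nat \<Rightarrow> real"
  where "\<And>i. 0 < r i" "A \<subseteq> (\<Union>i. ball (z i) (r i))" "\<And>I. (\<Sum>i<I. r i powr \<theta>) \<le> \<eta>"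
proof -
  obtain U where U: "\<And>i::nat. bounded (U i)" "A \<subseteq> (\<Union>i. U i)" "(\<Sum>i. diam_pow \<theta> (U i)) < ennreal (\<eta> / 2)"
    using null \<eta> unfolding hausdorff_measure_eq_0_iff by (metis ennreal_less_zero_iff half_gt_zero_iff zero_less_one)
  define r where "r i = (diameter (U i) powr \<theta> + \<eta> / 4 * (1/2) ^ i) powr (1 / \<theta>)" for i
  define z where "z i = (SOME x. x \<in> U i)" for i
  have pos: "0 < diameter (U i) powr \<theta> + \<eta> / 4 * (1/2) ^ i" for i
    using \<eta> by (intro add_nonneg_pos) auto
  have r0: "0 < r i" for i using pos[of i] by (simp add: r_def)
  have rp: "r i powr \<theta> = diameter (U i) powr \<theta> + \<eta> / 4 * (1/2) ^ i" for i
    using pos[of i] \<theta> by (simp add: r_def powr_powr)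
  have less: "diameter (U i) < r i" for i
  proof (rule ccontr)
    assume "\<not> diameter (U i) < r i"
    then have "r i powr \<theta> \<le> diameter (U i) powr \<theta>" using r0[of i] \<theta> by (intro powr_mono2) auto
    moreover have "0 < \<eta> / 4 * (1/2) ^ i" using \<eta> by simp
    ultimately show False using rp[of i] by linarith
  qed
  have sub: "U i \<subseteq> ball (z i) (r i)" for i
  proof
    fix x assume x: "x \<in> U i"
    then have "z i \<in> U i" unfolding z_def by (rule someI)
    then have "dist (z i) x \<le> diameter (U i)" using U(1) x by (intro diameter_bounded_bound)
    then show "x \<in> ball (z i) (r i)" using less[of i] by simp
  qed
  have "(\<Sum>i<I. r i powr \<theta>) \<le> \<eta>" for I
  proof -
    have "ennreal (\<Sum>i<I. diameter (U i) powr \<theta>) = (\<Sum>i<I. ennreal (diameter (U i) powr \<theta>))" by simp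
    also have "\<dots> = (\<Sum>i<I. diam_pow \<theta> (U i))"
      using \<theta> by (intro sum.cong refl) (auto simp: diam_pow_def)
    also have "\<dots> \<le> (\<Sum>i. diam_pow \<theta> (U i))" by (intro sum_le_suminf) auto
    also have "\<dots> < ennreal (\<eta> / 2)" by (rule U(3))
    finally have 1: "(\<Sum>i<I. diameter (U i) powr \<theta>) < \<eta> / 2" by (simp add: ennreal_less_iff sum_nonneg)
    have 2: "(\<Sum>i<I. \<eta> / 4 * (1/2) ^ i) \<le> \<eta> / 2"
      using sum_half_powers_le[of "\<eta> / 2" I] \<eta> by simp
    show ?thesis unfolding rp sum.distrib using 1 2 by simp
  qed
  moreover have "A \<subseteq> (\<Union>i. ball (z i) (r i))" using U(2) sub by blast
  ultimately show ?thesis using that[of r z] r0 by simp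
qed

section \<open>Compactness in Baire space\<close>

lemma tendsto_coordinatewise:
  fixes f :: "'b \<Rightarrow> 'i \<Rightarrow> 'c::topological_space"
  shows "(f \<longlongrightarrow> l) F \<longleftrightarrow> (\<forall>i. ((\<lambda>n. f n i) \<longlongrightarrow> l i) F)"
  using limitin_componentwise[of "\<lambda>_. euclidean" UNIV f l F]
  by (simp add: euclidean_product_topology limitin_canonical_iff extensional_def)

text \<open>If the compact set obtained from all the constraints is covered by open sets, then finitely many
  constraints and finitely many of the open sets suffice. Counterexamples \<open>\<sigma> n\<close> would, after
  truncation at \<open>k\<close>, accumulate at a point of the box, which satisfies all the constraints but lies in no \<open>V i\<close>.\<close>

lemma baire_box_limit:
  fixes f :: "(nat \<Rightarrow> nat) \<Rightarrow> 'a::metric_space" and B :: "nat \<Rightarrow> 'a set"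
  assumes f: "continuous_on UNIV f" and closed: "\<And>j. closed (B j)" and opn: "\<And>i::nat. open (V i)"
    and inner: "range f \<inter> (\<Inter>j. B j) \<subseteq> (\<Union>i. V i)"
  shows "\<exists>n. f ` {\<sigma>. \<forall>i<n. \<sigma> i \<le> k i} \<inter> (\<Inter>j<n. B j) \<subseteq> (\<Union>i<n. V i)"
proof (rule ccontr)
  assume "\<not> ?thesis"
  then have no: "\<not> f ` {\<sigma>. \<forall>i<n. \<sigma> i \<le> k i} \<inter> (\<Inter>j<n. B j) \<subseteq> (\<Union>i<n. V i)" for n
    by (rule contrapos_nn) (rule exI)
  have "\<exists>\<sigma>. (\<forall>i<n. \<sigma> i \<le> k i) \<and> (\<forall>j<n. f \<sigma> \<in> B j) \<and> (\<forall>i<n. f \<sigma> \<notin> V i)" for n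
    using no[of n] unfolding subset_eq by auto
  then have "\<forall>n. \<exists>\<sigma>. (\<forall>i<n. \<sigma> i \<le> k i) \<and> (\<forall>j<n. f \<sigma> \<in> B j) \<and> (\<forall>i<n. f \<sigma> \<notin> V i)" ..
  from choice[OF this] obtain \<sigma>
    where "\<forall>n. (\<forall>i<n. \<sigma> n i \<le> k i) \<and> (\<forall>j<n. f (\<sigma> n) \<in> B j) \<and> (\<forall>i<n. f (\<sigma> n) \<notin> V i)"
    by (elim exE)
  then have \<sigma>: "i < n \<Longrightarrow> \<sigma> n i \<le> k i" "i < n \<Longrightarrow> f (\<sigma> n) \<in> B i" "i < n \<Longrightarrow> f (\<sigma> n) \<notin> V i" for n i
    by simp_all
  define \<tau> where "\<tau> n = (\<lambda>i. min (\<sigma> n i) (k i))" for n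
  have "compact (PiE UNIV (\<lambda>i. {..k i}))"
    using compactin_PiE[of "\<lambda>_. euclidean" UNIV "\<lambda>i. {..k i}"]
    by (auto simp: euclidean_product_topology compactin_euclidean_iff finite_imp_compact)
  then have "seq_compact (PiE UNIV (\<lambda>i. {..k i}))" by (rule compact_imp_seq_compact)
  moreover have "\<forall>n. \<tau> n \<in> PiE UNIV (\<lambda>i. {..k i})" by (auto simp: \<tau>_def)
  ultimately obtain \<tau>' h where h: "strict_mono (h :: nat \<Rightarrow> nat)" "(\<tau> \<circ> h) \<longlonglongrightarrow> \<tau>'"
    unfolding seq_compact_def by blast
  have hn: "n \<le> h n" for n by (rule seq_suble[OF h(1)])
  have "((\<lambda>n. \<sigma> (h n)) \<longlonglongrightarrow> \<tau>')"
  proof (rule tendsto_coordinatewise[THEN iffD2, rule_format])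
    fix i
    have "(\<lambda>n. (\<tau> \<circ> h) n i) \<longlonglongrightarrow> \<tau>' i" using h(2) by (rule tendsto_coordinatewise[THEN iffD1, rule_format])
    moreover have "eventually (\<lambda>n. (\<tau> \<circ> h) n i = \<sigma> (h n) i) sequentially"
      unfolding eventually_sequentially
    proof (intro exI[of _ "Suc i"] allI impI)
      fix n assume "Suc i \<le> n"
      then have "i < h n" using hn[of n] by simp
      then show "(\<tau> \<circ> h) n i = \<sigma> (h n) i" using \<sigma>(1)[of i "h n"] by (simp add: \<tau>_def)
    qed
    ultimately show "(\<lambda>n. \<sigma> (h n) i) \<longlonglongrightarrow> \<tau>' i" by (rule Lim_transform_eventually)
  qed
  then have lim: "(\<lambda>n. f (\<sigma> (h n))) \<longlonglongrightarrow> f \<tau>'"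
    by (rule continuous_on_tendsto_compose[OF f]) auto
  have "f \<tau>' \<in> B j" for j
  proof (rule Lim_in_closed_set[OF closed[of j] _ sequentially_bot lim])
    show "eventually (\<lambda>n. f (\<sigma> (h n)) \<in> B j) sequentially"
      unfolding eventually_sequentially using hn \<sigma>(2) by (metis Suc_le_lessD order_trans less_le_trans)
  qed
  then obtain i where i: "f \<tau>' \<in> V i" using inner by blast
  have "eventually (\<lambda>n. f (\<sigma> (h n)) \<in> V i) sequentially"
    by (rule topological_tendstoD[OF lim opn i])
  then obtain n0 where n0: "\<And>n. n \<ge> n0 \<Longrightarrow> f (\<sigma> (h n)) \<in> V i" by (auto simp: eventually_sequentially)
  define n where "n = max n0 (Suc i)"
  have "f (\<sigma> (h n)) \<in> V i" by (rule n0) (simp add: n_def)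
  moreover have "i < h n" using hn[of n] by (simp add: n_def)
  ultimately show False using \<sigma>(3) by blast
qed

text \<open>A finitely supported measure of mass bounded below and energy bounded above.\<close>

definition energetic :: "'a::metric_space set \<Rightarrow> ('a \<Rightarrow> real) \<Rightarrow> real \<Rightarrow> nat \<Rightarrow> real \<Rightarrow> bool" where
  "energetic P v \<theta> m K \<longleftrightarrow> finite P \<and> (\<forall>x. 0 \<le> v x) \<and> 1 / 2 \<le> (\<Sum>x\<in>P. v x) \<and>
     (\<Sum>x\<in>P. \<Sum>y\<in>P. v x * v y * dyadic_kernel \<theta> m x y) \<le> K"

text \<open>The measures for the \<open>n\<close>-th stage need only be carried by the \<open>n\<close>-th box and the first \<open>n\<close> sets
  \<open>B j\<close>. A covering of the limit set by balls of small total \<open>\<theta>\<close>-weight covers the support of a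
  late stage by finitely many of these balls, all of them above the resolution \<open>m\<close> once the stage is late enough, and
  then contradicts the energy bound.\<close>

lemma hausdorff_measure_pos_of_energy:
  fixes f :: "(nat \<Rightarrow> nat) \<Rightarrow> 'a::metric_space" and B :: "nat \<Rightarrow> 'a set"
  assumes f: "continuous_on UNIV f" and closed: "\<And>j. closed (B j)" and sub: "(\<Inter>j. B j) \<subseteq> E"
    and \<theta>: "0 < \<theta>" and K: "0 < K"
    and inf: "\<exists>\<^sub>\<infinity>n. \<exists>P v m. n \<le> m \<and> P \<subseteq> f ` {\<sigma>. \<forall>i<n. \<sigma> i \<le> k i} \<and>
      (\<forall>x. v x \<noteq> 0 \<longrightarrow> (\<forall>j<n. x \<in> B j)) \<and> energetic P v \<theta> m K"
  shows "hausdorff_measure \<theta> (E \<inter> range f) \<noteq> 0"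
proof
  assume null: "hausdorff_measure \<theta> (E \<inter> range f) = 0"
  define \<eta> where "\<eta> = min (1 / (8 * 2 powr \<theta> * K)) 1"
  have \<eta>: "0 < \<eta>" "\<eta> \<le> 1" "2 powr \<theta> * \<eta> * K \<le> 1 / 8"
  proof -
    have "2 powr \<theta> * K * \<eta> \<le> 2 powr \<theta> * K * (1 / (8 * 2 powr \<theta> * K))"
      unfolding \<eta>_def using K by (intro mult_left_mono) auto
    then show "2 powr \<theta> * \<eta> * K \<le> 1 / 8" using K by (simp add: mult_ac)
  qed (use K in \<open>auto simp: \<eta>_def\<close>)
  obtain z :: "nat \<Rightarrow> 'a" and r :: "nat \<Rightarrow> real" where zr: "\<And>i. 0 < r i" "E \<inter> range f \<subseteq> (\<Union>i. ball (z i) (r i))" "\<And>I. (\<Sum>i<I. r i powr \<theta>) \<le> \<eta>"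
    by (rule hausdorff_null_ball_cover[OF null \<theta> \<eta>(1)]) (rule that)
  have r1: "r i \<le> 1" for i
  proof (rule ccontr)
    assume "\<not> r i \<le> 1"
    then have "1 < r i powr \<theta>" using \<theta> by (simp add: gr_one_powr)
    also have "\<dots> \<le> (\<Sum>i<Suc i. r i powr \<theta>)" by (intro member_le_sum) auto
    also have "\<dots> \<le> \<eta>" by (rule zr(3))
    finally show False using \<eta>(2) by simp
  qed
  have "range f \<inter> (\<Inter>j. B j) \<subseteq> (\<Union>i. ball (z i) (r i))" 
  proof (rule order_trans[OF _ zr(2)])
    show "range f \<inter> (\<Inter>j. B j) \<subseteq> E \<inter> range f"
      unfolding Int_commute[of "range f"] by (rule Int_mono[OF sub order_refl])
  qed
  from baire_box_limit[OF f closed _ this, of k]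
  obtain n0 where n0: "f ` {\<sigma>. \<forall>i<n0. \<sigma> i \<le> k i} \<inter> (\<Inter>j<n0. B j) \<subseteq> (\<Union>i<n0. ball (z i) (r i))"
    by auto
  obtain N where N: "\<And>i. i < n0 \<Longrightarrow> (1/2) ^ N \<le> r i"
    using exists_half_power_below[of r n0] zr(1) by metis
  obtain n P v m where n: "n \<ge> max n0 N" and nm: "n \<le> m" "P \<subseteq> f ` {\<sigma>. \<forall>i<n. \<sigma> i \<le> k i}"
      "\<forall>x. v x \<noteq> 0 \<longrightarrow> (\<forall>j<n. x \<in> B j)" and en: "energetic P v \<theta> m K"
    using inf[unfolded INFM_nat_le, rule_format, of "max n0 N"] by (elim exE conjE) (rule that)
  have P: "finite P" "P \<subseteq> f ` {\<sigma>. \<forall>i<n. \<sigma> i \<le> k i}" and m: "n \<le> m" and v: "\<And>x. 0 \<le> v x"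
      "\<And>x j. v x \<noteq> 0 \<Longrightarrow> j < n \<Longrightarrow> x \<in> B j" "1 / 2 \<le> (\<Sum>x\<in>P. v x)"
      "(\<Sum>x\<in>P. \<Sum>y\<in>P. v x * v y * dyadic_kernel \<theta> m x y) \<le> K"
    using en nm by (simp_all add: energetic_def)
  have "(\<Sum>x\<in>P. v x)\<^sup>2 \<le> 2 powr \<theta> * (\<Sum>i<n0. r i powr \<theta>) * K"
  proof (rule mass_le_energy_cover[OF P(1) v(1) _ _ r1 _ v(4)])
    fix x assume x: "x \<in> P" "v x \<noteq> 0"
    have "x \<in> f ` {\<sigma>. \<forall>i<n0. \<sigma> i \<le> k i}" using P(2) x(1) n by fastforce
    moreover have "x \<in> (\<Inter>j<n0. B j)" using v(2)[OF x(2)] n by auto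
    ultimately have "x \<in> (\<Union>i<n0. ball (z i) (r i))" using n0 by blast
    then show "\<exists>i<n0. x \<in> ball (z i) (r i)" by blast
  next
    fix i assume "i < n0"
    have "(1/2::real) ^ m \<le> (1/2) ^ N" using n m by (intro power_decreasing) auto
    then show "(1/2) ^ m \<le> r i" using N[OF \<open>i < n0\<close>] by (rule order_trans)
  qed (use \<theta> in auto)
  also have "\<dots> \<le> 2 powr \<theta> * \<eta> * K"
    using K zr(3)[of n0] by (intro mult_right_mono mult_left_mono) auto
  also have "\<dots> \<le> 1 / 8" by (rule \<eta>)
  finally have "(\<Sum>x\<in>P. v x)\<^sup>2 \<le> 1 / 8" .
  moreover have "(1 / 2)\<^sup>2 \<le> (\<Sum>x\<in>P. v x)\<^sup>2" using v(3) by (intro power_mono) auto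
  ultimately show False by (simp add: power2_eq_square)
qed


section \<open>Energy of Frostman weights\<close>

text \<open>The sum of the geometric series with ratio \<open>(1/2) powr \<eta>\<close>.\<close>

definition geom_const :: "real \<Rightarrow> real" where
  "geom_const \<eta> = 1 / (1 - (1/2) powr \<eta>)"

lemma geom_const_sum:
  assumes "0 < \<eta>"
  shows "(\<Sum>k\<le>m. ((1/2) ^ k) powr \<eta>) \<le> geom_const \<eta>" "1 \<le> geom_const \<eta>"
proof -
  define q :: real where "q = (1/2) powr \<eta>"
  have q: "0 < q" "q < 1" using assms by (auto simp: q_def powr01_less_one)
  have eq: "((1/2) ^ k) powr \<eta> = q ^ k" for k
    by (simp add: q_def powr_realpow[symmetric] powr_powr mult.commute)
  have "(\<Sum>k\<le>m. q ^ k) = (1 - q ^ Suc m) / (1 - q)"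
    using q sum_gp_strict[of q "Suc m"] by (simp add: lessThan_Suc_atMost)
  also have "\<dots> \<le> 1 / (1 - q)" using q by (intro divide_right_mono) auto
  finally show "(\<Sum>k\<le>m. ((1/2) ^ k) powr \<eta>) \<le> geom_const \<eta>" unfolding eq by (simp add: geom_const_def q_def)
  show "1 \<le> geom_const \<eta>" using q by (simp add: geom_const_def q_def[symmetric] field_simps)
qed

text \<open>The minimum of the kernel scale \<open>(1/2) ^ k\<close> and \<open>R\<close>, raised to the Frostman exponent \<open>t'\<close>, is split as
  \<open>((1/2) ^ k) powr (\<theta> + \<eta>) * R powr (t' - \<theta> - \<eta>)\<close>: the first factor makes the sum over \<open>k\<close> converge,
  the second one gives the gain for near pairs.\<close>

lemma kernel_sum_near:
  fixes w :: "'a::metric_space \<Rightarrow> real"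
  assumes fw: "frostman_weights P w ((1/2) ^ m) Cf t'" and Cf: "0 < Cf" and \<eta>: "0 < \<eta>" and \<theta>: "0 \<le> \<theta>" "\<theta> + \<eta> \<le> t'" and R: "(1/2) ^ m \<le> R" "R \<le> 1"
  shows "(\<Sum>x\<in>P. \<Sum>y\<in>P. w x * w y * dyadic_kernel \<theta> m x y * (if dist x y \<le> 2 * R then 1 else 0))
    \<le> geom_const \<eta> * Cf * R powr (t' - \<theta> - \<eta>)"
    and "(\<Sum>x\<in>P. \<Sum>y\<in>P. w x * w y * 1 * (if dist x y \<le> 2 * R then 1 else 0))
    \<le> geom_const \<eta> * Cf * R powr (t' - \<theta> - \<eta>)"
proof -
  have P: "finite P" and w: "\<And>x. 0 \<le> w x" "(\<Sum>x\<in>P. w x) = 1"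
    and frost: "\<And>x r. (1/2) ^ m \<le> r \<Longrightarrow> r \<le> 1 \<Longrightarrow> (\<Sum>y | y \<in> P \<and> dist x y \<le> 2 * r. w y) \<le> Cf * r powr t'"
    using fw by (auto simp: frostman_weights_def)
  have R0: "0 < R" using R(1) by (rule less_le_trans[rotated]) simp
  have average: "(\<Sum>x\<in>P. \<Sum>y\<in>P. w x * w y * h x y) \<le> B" if "\<And>x. (\<Sum>y\<in>P. w y * h x y) \<le> B" for h B
  proof -
    have "(\<Sum>x\<in>P. \<Sum>y\<in>P. w x * w y * h x y) = (\<Sum>x\<in>P. w x * (\<Sum>y\<in>P. w y * h x y))"
      by (simp add: sum_distrib_left mult_ac)
    also have "\<dots> \<le> (\<Sum>x\<in>P. w x * B)" using w that by (intro sum_mono mult_left_mono) auto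
    also have "\<dots> = B" using w(2) by (simp add: sum_distrib_right[symmetric])
    finally show ?thesis .
  qed
  have ind: "(\<Sum>y\<in>P. w y * (if Q y then 1 else 0)) = (\<Sum>y | y \<in> P \<and> Q y. w y)" for Q
    using P by (simp add: sum.inter_filter[symmetric] if_distrib cong: if_cong)
  show "(\<Sum>x\<in>P. \<Sum>y\<in>P. w x * w y * dyadic_kernel \<theta> m x y * (if dist x y \<le> 2 * R then 1 else 0))
    \<le> geom_const \<eta> * Cf * R powr (t' - \<theta> - \<eta>)"
    unfolding mult.assoc[of "_ * _"]
  proof (rule average)
    fix x
    have "(\<Sum>y\<in>P. w y * (dyadic_kernel \<theta> m x y * (if dist x y \<le> 2 * R then 1 else 0)))
        = (\<Sum>y\<in>P. \<Sum>k\<le>m. (2 ^ k) powr \<theta> * (w y * (if dist x y \<le> 2 * min ((1/2) ^ k) R then 1 else 0)))"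
      by (auto simp: dyadic_kernel_def sum_distrib_left sum_distrib_right intro!: sum.cong)
    also have "\<dots> = (\<Sum>k\<le>m. \<Sum>y\<in>P. (2 ^ k) powr \<theta> * (w y * (if dist x y \<le> 2 * min ((1/2) ^ k) R then 1 else 0)))"
      by (rule sum.swap)
    also have "\<dots> = (\<Sum>k\<le>m. (2 ^ k) powr \<theta> * (\<Sum>y | y \<in> P \<and> dist x y \<le> 2 * min ((1/2) ^ k) R. w y))"
      by (simp only: sum_distrib_left[symmetric] ind)
    also have "\<dots> \<le> (\<Sum>k\<le>m. ((1/2) ^ k) powr \<eta> * (Cf * R powr (t' - \<theta> - \<eta>)))"
    proof (rule sum_mono)
      fix k assume k: "k \<in> {..m}"
      define \<rho> where "\<rho> = min ((1/2) ^ k) R"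
      have "(1/2::real) ^ m \<le> (1/2) ^ k" using k by (intro power_decreasing) auto
      then have \<rho>: "(1/2) ^ m \<le> \<rho>" "\<rho> \<le> 1" "0 < \<rho>" "\<rho> \<le> (1/2) ^ k" "\<rho> \<le> R"
        using R R0 by (auto simp: \<rho>_def)
      have "(\<Sum>y | y \<in> P \<and> dist x y \<le> 2 * \<rho>. w y) \<le> Cf * \<rho> powr t'" by (rule frost[OF \<rho>(1,2)])
      also have "\<rho> powr t' = \<rho> powr (\<theta> + \<eta>) * \<rho> powr (t' - \<theta> - \<eta>)"
        using \<rho>(3) by (simp add: powr_add[symmetric])
      also have "\<dots> \<le> ((1/2) ^ k) powr (\<theta> + \<eta>) * R powr (t' - \<theta> - \<eta>)"
        using \<rho> \<theta> \<eta> by (intro mult_mono powr_mono2) auto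
      finally have "(\<Sum>y | y \<in> P \<and> dist x y \<le> 2 * \<rho>. w y) \<le> Cf * (((1/2) ^ k) powr (\<theta> + \<eta>) * R powr (t' - \<theta> - \<eta>))"
        using Cf by simp
      then have "(2 ^ k) powr \<theta> * (\<Sum>y | y \<in> P \<and> dist x y \<le> 2 * \<rho>. w y)
          \<le> (2 ^ k) powr \<theta> * (Cf * (((1/2) ^ k) powr (\<theta> + \<eta>) * R powr (t' - \<theta> - \<eta>)))"
        by (intro mult_left_mono) auto
      also have "\<dots> = ((2 ^ k) powr \<theta> * ((1/2) ^ k) powr \<theta>) * ((1/2) ^ k) powr \<eta> * (Cf * R powr (t' - \<theta> - \<eta>))"
        by (simp add: powr_add mult_ac)
      also have "(2 ^ k) powr \<theta> * ((1/2) ^ k) powr \<theta> = (1::real)"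
        by (simp add: powr_mult[symmetric] power_mult_distrib[symmetric])
      finally show "(2 ^ k) powr \<theta> * (\<Sum>y | y \<in> P \<and> dist x y \<le> 2 * min ((1/2) ^ k) R. w y)
          \<le> ((1/2) ^ k) powr \<eta> * (Cf * R powr (t' - \<theta> - \<eta>))" by (simp add: \<rho>_def)
    qed
    also have "\<dots> \<le> geom_const \<eta> * (Cf * R powr (t' - \<theta> - \<eta>))"
      unfolding sum_distrib_right[symmetric] using Cf by (intro mult_right_mono geom_const_sum(1)[OF \<eta>]) auto
    finally show "(\<Sum>y\<in>P. w y * (dyadic_kernel \<theta> m x y * (if dist x y \<le> 2 * R then 1 else 0)))
        \<le> geom_const \<eta> * Cf * R powr (t' - \<theta> - \<eta>)" by (simp add: mult.assoc)
  qed
  have "(\<Sum>x\<in>P. \<Sum>y\<in>P. w x * w y * (if dist x y \<le> 2 * R then 1 else 0)) \<le> geom_const \<eta> * Cf * R powr (t' - \<theta> - \<eta>)"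
  proof (rule average)
    fix x
    have "(\<Sum>y\<in>P. w y * (if dist x y \<le> 2 * R then 1 else 0)) \<le> Cf * R powr t'"
      unfolding ind by (rule frost[OF R])
    also have "\<dots> \<le> Cf * R powr (t' - \<theta> - \<eta>)"
      using Cf R0 R(2) \<theta> \<eta> by (intro mult_left_mono powr_mono') auto
    also have "\<dots> \<le> geom_const \<eta> * (Cf * R powr (t' - \<theta> - \<eta>))"
      using mult_right_mono[OF geom_const_sum(2)[OF \<eta>], of "Cf * R powr (t' - \<theta> - \<eta>)"] Cf by simp
    finally show "(\<Sum>y\<in>P. w y * (if dist x y \<le> 2 * R then 1 else 0)) \<le> geom_const \<eta> * Cf * R powr (t' - \<theta> - \<eta>)"
      by (simp add: mult.assoc)
  qed
  then show "(\<Sum>x\<in>P. \<Sum>y\<in>P. w x * w y * 1 * (if dist x y \<le> 2 * R then 1 else 0))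
    \<le> geom_const \<eta> * Cf * R powr (t' - \<theta> - \<eta>)" by simp
qed

context block_sequence
begin

definition mass :: "'a set \<Rightarrow> ('a \<Rightarrow> real) \<Rightarrow> nat \<Rightarrow> 'w \<Rightarrow> real" where
  "mass P w J \<omega> = (\<Sum>x\<in>P. w x * density J x \<omega>)"

definition energy :: "real \<Rightarrow> nat \<Rightarrow> 'a set \<Rightarrow> ('a \<Rightarrow> real) \<Rightarrow> nat \<Rightarrow> 'w \<Rightarrow> real" where
  "energy \<theta> m P w J \<omega> = (\<Sum>x\<in>P. \<Sum>y\<in>P. w x * density J x \<omega> * (w y * density J y \<omega>) * dyadic_kernel \<theta> m x y)"

lemma fut_obs_density_mult: "fut_obs 0 (\<lambda>\<omega>. density J x \<omega> * density J y \<omega>)"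
  by (intro fut_obs_mult fut_obs_density)

lemma measurable_density [measurable]: "density J x \<in> borel_measurable M"
  by (rule fut_obs_measurable[OF fut_obs_density])

lemma measurable_mass [measurable]: "mass P w J \<in> borel_measurable M"
  unfolding mass_def[abs_def] by measurable

lemma measurable_energy [measurable]: "energy \<theta> m P w J \<in> borel_measurable M"
  unfolding energy_def[abs_def] by measurable

text \<open>The mass has mean at least \<open>1 - \<delta>\<close> and second moment at most \<open>1 + 5 * \<delta>\<close>, so it deviates from 1 by 1/2
  with probability at most \<open>28 * \<delta>\<close>; Markov's inequality for the energy costs another \<open>\<delta>\<close>.
  Neither bound depends on the number \<open>J\<close> of blocks.\<close>

lemma mass_energy_high_probability:
  assumes fw: "frostman_weights P w ((1/2) ^ m) Cf t'" and Cf: "0 < Cf" and \<eta>: "0 < \<eta>" and \<theta>: "0 \<le> \<theta>" "\<theta> + \<eta> \<le> t'"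
    and m: "\<And>j. j < J \<Longrightarrow> (1/2) ^ m \<le> r j"
    and \<delta>: "0 < \<delta>" "\<delta> \<le> 1 / 4" and e_small: "\<And>j. e j = \<delta> / 2 * (1/2) ^ j"
    and A: "\<And>j x y. overlap j x y * (\<Prod>i<j. 1 + overlap i x y) \<le> A j * (if dist x y \<le> 2 * r j then 1 else 0)"
    and near: "\<And>j. A j * (geom_const \<eta> * Cf * r j powr (t' - \<theta> - \<eta>)) \<le> \<delta> / 2 * (1/2) ^ j" and A0: "\<And>j. 0 \<le> A j"
  shows "1 - 29 * \<delta> \<le> prob {\<omega> \<in> space M. 1 / 2 \<le> mass P w J \<omega> \<and> energy \<theta> m P w J \<omega> \<le> 2 * (geom_const \<eta> * Cf + 1) / \<delta>}"
proof -
  have P: "finite P" and w: "\<And>x. 0 \<le> w x" "(\<Sum>x\<in>P. w x) = 1"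
    using fw by (auto simp: frostman_weights_def)
  let ?m = "mass P w J" and ?E = "energy \<theta> m P w J"
  let ?K = "geom_const \<eta> * Cf"
  let ?d = "\<lambda>j x y. if dist x y \<le> 2 * r j then 1 else 0 :: real"
  have K0: "0 < ?K" using Cf geom_const_sum(2)[OF \<eta>] by (intro mult_pos_pos) auto
  have int2: "integrable M (\<lambda>\<omega>. density J x \<omega> * density J y \<omega>)" for x y
    by (rule fut_obs_integrable[OF fut_obs_density_mult])
  have int1: "integrable M (density J x)" for x by (rule fut_obs_integrable[OF fut_obs_density])
  have E_eq: "?E \<omega> = (\<Sum>x\<in>P. \<Sum>y\<in>P. w x * w y * dyadic_kernel \<theta> m x y * (density J x \<omega> * density J y \<omega>))" for \<omega>
    unfolding energy_def by (intro sum.cong refl) (simp add: mult_ac)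
  have m2_eq: "(?m \<omega>)\<^sup>2 = (\<Sum>x\<in>P. \<Sum>y\<in>P. w x * w y * 1 * (density J x \<omega> * density J y \<omega>))" for \<omega>
    unfolding mass_def power2_eq_square sum_product by (intro sum.cong refl) (simp add: mult_ac)
  have intE: "integrable M ?E" unfolding E_eq[abs_def] using int2 by (intro Bochner_Integration.integrable_sum integrable_mult_right)
  have intm: "integrable M ?m" unfolding mass_def[abs_def] using int1 by (intro Bochner_Integration.integrable_sum integrable_mult_right)
  have intm2: "integrable M (\<lambda>\<omega>. (?m \<omega>)\<^sup>2)" unfolding m2_eq using int2 by (intro Bochner_Integration.integrable_sum integrable_mult_right)
  have E0: "0 \<le> ?E \<omega>" for \<omega>
    unfolding energy_def using w(1) density_nonneg dyadic_kernel_nonneg by (intro sum_nonneg mult_nonneg_nonneg) auto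
  have exp: "exp (2 * \<delta>) \<le> 1 + 3 * \<delta>"
  proof -
    have "exp (2 * \<delta>) \<le> 1 + 2 * \<delta> + (2 * \<delta>)\<^sup>2" using \<delta> by (intro exp_bound) auto
    also have "(2 * \<delta>)\<^sup>2 \<le> \<delta>" using \<delta> by (simp add: power2_eq_square)
    finally show ?thesis by simp
  qed
  have "(\<integral>\<omega>. ?E \<omega> \<partial>M) = (\<Sum>x\<in>P. \<Sum>y\<in>P. w x * w y * dyadic_kernel \<theta> m x y * (\<integral>\<omega>. density J x \<omega> * density J y \<omega> \<partial>M))"
    unfolding E_eq using int2 by (simp add: Bochner_Integration.integral_sum)
  also have "\<dots> \<le> exp (2 * \<delta>) * (?K + \<delta>)"
  proof (rule weighted_pair_sum[OF P w(1) dyadic_kernel_nonneg _ _ _ A])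
    \<comment> \<open>The kernel vanishes beyond distance 2, so the full energy is the sum over near pairs for \<open>R = 1\<close>.\<close>
    have "(\<Sum>x\<in>P. \<Sum>y\<in>P. w x * w y * dyadic_kernel \<theta> m x y)
        = (\<Sum>x\<in>P. \<Sum>y\<in>P. w x * w y * dyadic_kernel \<theta> m x y * (if dist x y \<le> 2 * 1 then 1 else 0))"
    proof (intro sum.cong refl)
      fix x y :: 'a
      have "dyadic_kernel \<theta> m x y = 0" if "\<not> dist x y \<le> 2"
      proof -
        have "\<not> dist x y \<le> 2 * (1/2) ^ k" for k
          using that power_le_one[of "1/2::real" k] by (auto simp: not_le)
        then show ?thesis by (simp add: dyadic_kernel_def)
      qed
      then show "w x * w y * dyadic_kernel \<theta> m x y = w x * w y * dyadic_kernel \<theta> m x y * (if dist x y \<le> 2 * 1 then 1 else 0)"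
        by auto
    qed
    also have "\<dots> \<le> geom_const \<eta> * Cf * 1 powr (t' - \<theta> - \<eta>)"
      by (rule kernel_sum_near(1)[OF fw Cf \<eta> \<theta>]) (auto intro: power_le_one)
    finally show "(\<Sum>x\<in>P. \<Sum>y\<in>P. w x * w y * dyadic_kernel \<theta> m x y) \<le> ?K" by simp
  next
    fix j assume j: "j < J"
    have "A j * (\<Sum>x\<in>P. \<Sum>y\<in>P. w x * w y * dyadic_kernel \<theta> m x y * ?d j x y) \<le> A j * (geom_const \<eta> * Cf * r j powr (t' - \<theta> - \<eta>))"
      by (intro mult_left_mono A0 kernel_sum_near(1)[OF fw Cf \<eta> \<theta> m[OF j] r(2)])
    then show "A j * (\<Sum>x\<in>P. \<Sum>y\<in>P. w x * w y * dyadic_kernel \<theta> m x y * ?d j x y) \<le> \<delta> / 2 * (1/2) ^ j"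
      using near[of j] by (rule order_trans)
  qed (use \<delta> e_small in auto)
  also have "\<dots> \<le> 2 * (?K + 1)"
    using exp \<delta> K0 by (intro mult_mono) auto
  finally have EE: "(\<integral>\<omega>. ?E \<omega> \<partial>M) \<le> 2 * (?K + 1)" .
  have "(\<integral>\<omega>. (?m \<omega>)\<^sup>2 \<partial>M) = (\<Sum>x\<in>P. \<Sum>y\<in>P. w x * w y * 1 * (\<integral>\<omega>. density J x \<omega> * density J y \<omega> \<partial>M))"
    unfolding m2_eq using int2 by (simp add: Bochner_Integration.integral_sum)
  also have "\<dots> \<le> exp (2 * \<delta>) * (1 + \<delta>)"
  proof (rule weighted_pair_sum[OF P w(1) _ _ _ _ A])
    show "(\<Sum>x\<in>P. \<Sum>y\<in>P. w x * w y * 1) \<le> 1"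
      using w(2) by (simp add: sum_product[symmetric])
  next
    fix j assume j: "j < J"
    have "A j * (\<Sum>x\<in>P. \<Sum>y\<in>P. w x * w y * 1 * ?d j x y) \<le> A j * (geom_const \<eta> * Cf * r j powr (t' - \<theta> - \<eta>))"
      by (intro mult_left_mono A0 kernel_sum_near(2)[OF fw Cf \<eta> \<theta> m[OF j] r(2)])
    then show "A j * (\<Sum>x\<in>P. \<Sum>y\<in>P. w x * w y * 1 * ?d j x y) \<le> \<delta> / 2 * (1/2) ^ j"
      using near[of j] by (rule order_trans)
  qed (use \<delta> e_small in auto)
  also have "\<dots> \<le> (1 + 3 * \<delta>) * (1 + \<delta>)" using exp \<delta> by (intro mult_right_mono) auto
  also have "\<dots> \<le> 1 + 5 * \<delta>"
    using \<delta> mult_left_mono[of \<delta> "1/4" "3 * \<delta>"] by (simp add: algebra_simps)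
  finally have Em2: "(\<integral>\<omega>. (?m \<omega>)\<^sup>2 \<partial>M) \<le> 1 + 5 * \<delta>" .
  have Em: "1 - \<delta> \<le> (\<integral>\<omega>. ?m \<omega> \<partial>M)"
  proof -
    have se: "(\<Sum>j<J. e j) \<le> \<delta>" unfolding e_small using \<delta>(1) by (intro sum_half_powers_le) simp
    have "1 - (\<Sum>j<J. e j) \<le> (\<Prod>j<J. 1 - e j)"
    proof (induction J)
      case (Suc J)
      have "1 - (\<Sum>j<Suc J. e j) \<le> (\<Prod>j<J. 1 - e j) - e J" using Suc by simp
      also have "\<dots> \<le> (\<Prod>j<J. 1 - e j) - e J * (\<Prod>j<J. 1 - e j)"
      proof -
        have "(\<Prod>j<J. 1 - e j) \<le> 1" using e(1,2) by (intro prod_le_1) auto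
        then show ?thesis using e(1)[of J] mult_left_mono[of "\<Prod>j<J. 1 - e j" 1 "e J"] by simp
      qed
      finally show ?case by (simp add: algebra_simps)
    qed simp
    then have "1 - \<delta> \<le> (\<Prod>j<J. 1 - e j)" using se by simp
    also have "\<dots> = (\<Sum>x\<in>P. w x * (\<Prod>j<J. 1 - e j))" using w(2) by (simp add: sum_distrib_right[symmetric])
    also have "\<dots> \<le> (\<Sum>x\<in>P. w x * (\<integral>\<omega>. density J x \<omega> \<partial>M))"
      using w(1) by (intro sum_mono mult_left_mono density_first_moment) auto
    also have "\<dots> = (\<integral>\<omega>. ?m \<omega> \<partial>M)"
      unfolding mass_def using int1 by (simp add: Bochner_Integration.integral_sum)
    finally show ?thesis .
  qed
  define F1 where "F1 = {\<omega> \<in> space M. 1 / 4 \<le> (?m \<omega> - 1)\<^sup>2}"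
  define F2 where "F2 = {\<omega> \<in> space M. 2 * (?K + 1) / \<delta> \<le> ?E \<omega>}"
  have F: "F1 \<in> events" "F2 \<in> events" by (auto simp: F1_def F2_def)
  have sq: "(?m \<omega> - 1)\<^sup>2 = (?m \<omega>)\<^sup>2 - 2 * ?m \<omega> + 1" for \<omega> by (simp add: power2_eq_square algebra_simps)
  have intsq: "integrable M (\<lambda>\<omega>. (?m \<omega> - 1)\<^sup>2)" unfolding sq using intm intm2 by simp
  have "(\<integral>\<omega>. (?m \<omega> - 1)\<^sup>2 \<partial>M) = (\<integral>\<omega>. (?m \<omega>)\<^sup>2 \<partial>M) - 2 * (\<integral>\<omega>. ?m \<omega> \<partial>M) + 1"
    unfolding sq using intm intm2 by (simp add: prob_space)
  also have "\<dots> \<le> 7 * \<delta>" using Em Em2 by simp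
  finally have var: "(\<integral>\<omega>. (?m \<omega> - 1)\<^sup>2 \<partial>M) \<le> 7 * \<delta>" .
  have "prob F1 \<le> (\<integral>\<omega>. (?m \<omega> - 1)\<^sup>2 \<partial>M) / (1 / 4)"
    unfolding F1_def by (rule integral_Markov_inequality_measure[where A = "{}", OF intsq]) auto
  then have p1: "prob F1 \<le> 28 * \<delta>" using var by simp
  have "prob F2 \<le> (\<integral>\<omega>. ?E \<omega> \<partial>M) / (2 * (?K + 1) / \<delta>)"
    unfolding F2_def using K0 \<delta> E0 by (intro integral_Markov_inequality_measure[where A = "{}", OF intE]) auto
  also have "\<dots> \<le> (2 * (?K + 1)) / (2 * (?K + 1) / \<delta>)" using EE K0 \<delta> by (intro divide_right_mono) auto
  also have "\<dots> = \<delta>" using K0 \<delta> by simp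
  finally have p2: "prob F2 \<le> \<delta>" .
  have "1 - 29 * \<delta> \<le> 1 - prob (F1 \<union> F2)"
    using p1 p2 measure_Un_le[OF F] by simp
  also have "\<dots> = prob (space M - (F1 \<union> F2))" using F by (simp add: prob_compl)
  also have "\<dots> \<le> prob {\<omega> \<in> space M. 1 / 2 \<le> ?m \<omega> \<and> ?E \<omega> \<le> 2 * (?K + 1) / \<delta>}"
  proof (rule finite_measure_mono)
    show "space M - (F1 \<union> F2) \<subseteq> {\<omega> \<in> space M. 1 / 2 \<le> ?m \<omega> \<and> ?E \<omega> \<le> 2 * (?K + 1) / \<delta>}"
    proof
      fix \<omega> assume \<omega>: "\<omega> \<in> space M - (F1 \<union> F2)"
      have "1 / 2 \<le> ?m \<omega>"
      proof (rule ccontr)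
        assume "\<not> 1 / 2 \<le> ?m \<omega>"
        then have "(1/2)\<^sup>2 \<le> (1 - ?m \<omega>)\<^sup>2" by (intro power_mono) auto
        then have "1 / 4 \<le> (?m \<omega> - 1)\<^sup>2" by (simp add: power2_commute[of 1] power_divide)
        then show False using \<omega> by (auto simp: F1_def)
      qed
      then show "\<omega> \<in> {\<omega> \<in> space M. 1 / 2 \<le> ?m \<omega> \<and> ?E \<omega> \<le> 2 * (?K + 1) / \<delta>}"
        using \<omega> by (auto simp: F2_def)
    qed
  qed measurable
  finally show ?thesis .
qed

end


section \<open>The lower bound\<close>

lemma (in prob_space) AE_of_high_probability:
  assumes "\<And>\<epsilon>. 0 < \<epsilon> \<Longrightarrow> \<epsilon> \<le> 1 / 4 \<Longrightarrow> \<exists>L\<in>events. 1 - 29 * \<epsilon> \<le> prob L \<and> (\<forall>\<omega>\<in>L. Q \<omega>)"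
  shows "AE \<omega> in M. Q \<omega>"
proof -
  have "\<exists>L\<in>events. 1 - 29 * (1 / real (i + 4)) \<le> prob L \<and> (\<forall>\<omega>\<in>L. Q \<omega>)" for i
    by (rule assms) auto
  then obtain L where L: "\<And>i. L i \<in> events" "\<And>i. 1 - 29 * (1 / real (i + 4)) \<le> prob (L i)" "\<And>i \<omega>. \<omega> \<in> L i \<Longrightarrow> Q \<omega>"
    by metis
  define U where "U = (\<Union>i. L i)"
  have U: "U \<in> events" using L(1) by (auto simp: U_def)
  have "1 - 29 * (1 / real (i + 4)) \<le> prob U" for i
    using L(2)[of i] finite_measure_mono[of "L i" U] U by (auto simp: U_def intro: order_trans)
  moreover have "(\<lambda>i. 1 - 29 * (1 / real (i + 4))) \<longlonglongrightarrow> 1" by real_asymp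
  ultimately have "1 \<le> prob U" by (intro LIMSEQ_le_const2) auto
  then have "prob U = 1" using prob_le_1[of U] by simp
  then have "AE \<omega> in M. \<omega> \<in> U" using U by (simp add: AE_in_set_eq_1)
  then show ?thesis by eventually_elim (use L(3) in \<open>auto simp: U_def\<close>)
qed

context covering_process
begin

lemma exists_block:
  fixes l :: "nat \<Rightarrow> real"
  assumes l: "\<And>n. 1 \<le> n \<Longrightarrow> 0 < l n" "\<And>n. 1 \<le> n \<Longrightarrow> l (Suc n) \<le> l n" "l \<longlonglongrightarrow> 0"
    and ns: "\<not> summable (\<lambda>n. l (Suc n) powr u)" and \<beta>: "0 < \<beta>" "\<beta> < u"
    and pos: "0 < \<epsilon>" "0 < K" "0 < \<eta>"
  obtains r T g where "spaced_block l \<beta> N r T g" "r \<le> 1"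
    "C * \<rho> ^ g \<le> \<epsilon> * (r powr s / c)" "K * r powr \<eta> \<le> \<epsilon>"
proof -
  \<comment> \<open>With \<open>g \<ge> A * ln (1 / r)\<close>, the mixing error \<open>\<rho> ^ g\<close> is at most \<open>r powr (s + 1)\<close>, smaller by the factor \<open>r\<close>
    than the measure of a ball.\<close>
  define A where "A = (s + 1) / ln (1 / \<rho>)"
  have ln: "0 < ln (1 / \<rho>)" using \<rho> by simp
  have A: "0 < A" using ln s_pos by (simp add: A_def)
  define r0 where "r0 = min 1 (min (\<epsilon> / (C * c)) ((\<epsilon> / K) powr (1 / \<eta>)))"
  have r0: "0 < r0" using pos C_pos c_ge_1 by (simp add: r0_def)
  obtain r T g where block: "spaced_block l \<beta> N r T g" and r: "r < r0" and g: "A * ln (1 / r) \<le> real g"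
    by (rule exists_spaced_block[OF l ns \<beta> r0 A, where N = N]) (assumption | rule that)+
  have b: "0 < r" "r < r0" using block r by (simp_all add: spaced_block_def)
  have "\<rho> ^ g = \<rho> powr real g" using \<rho> by (simp add: powr_realpow)
  also have "\<dots> \<le> \<rho> powr (A * ln (1 / r))" using \<rho> g by (intro powr_mono') auto
  also have "\<dots> = r powr (s + 1)"
    using \<rho> b(1) ln by (simp add: powr_def A_def ln_div field_simps)
  finally have "C * \<rho> ^ g \<le> C * r powr (s + 1)" using C_pos by simp
  also have "\<dots> = C * r * r powr s" using b(1) by (simp add: powr_add)
  also have "\<dots> \<le> \<epsilon> / c * r powr s"
    using b(2) C_pos c_ge_1 by (intro mult_right_mono) (auto simp: r0_def field_simps)
  finally have 1: "C * \<rho> ^ g \<le> \<epsilon> * (r powr s / c)" by simp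
  have "r powr \<eta> \<le> ((\<epsilon> / K) powr (1 / \<eta>)) powr \<eta>" using b(1,2) pos by (intro powr_mono2) (auto simp: r0_def)
  also have "\<dots> = \<epsilon> / K" using pos by (simp add: powr_powr)
  finally have 2: "K * r powr \<eta> \<le> \<epsilon>" using pos by (simp add: field_simps)
  have "r \<le> 1" using b(2) by (simp add: r0_def)
  then show ?thesis using that[of r T g] block 1 2 by blast
qed

text \<open>The blocks are chosen one after the other. In the state \<open>(r, T, g, A, N)\<close>, the number \<open>A\<close> is the
  product over all earlier blocks, which has to be compensated by the smallness of \<open>r\<close>, and \<open>N\<close> is the
  time up to which the process has been used.\<close>

lemma exists_block_sequence:
  fixes l :: "nat \<Rightarrow> real"
  assumes l: "\<And>n. 1 \<le> n \<Longrightarrow> 0 < l n" "\<And>n. 1 \<le> n \<Longrightarrow> l (Suc n) \<le> l n" "l \<longlonglongrightarrow> 0"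
    and ns: "\<not> summable (\<lambda>n. l (Suc n) powr u)" and \<beta>: "0 < \<beta>" "\<beta> < u"
    and pos: "0 < \<delta>" "0 < K" "0 < \<eta>" and \<delta>1: "\<delta> \<le> 1"
  obtains r T g where "block_sequence M \<xi> \<mu> s C \<rho> c r T g (\<lambda>j. \<delta> / 2 * (1/2) ^ j)"
    "\<And>j. r j powr (- \<beta>) \<le> real (card (T j))" "\<And>j n. n \<in> T j \<Longrightarrow> r j \<le> l n" "\<And>j n. n \<in> T j \<Longrightarrow> j < n"
    "\<And>j. K * (\<Prod>i<j. 1 + c * r i powr (\<beta> - s)) * r j powr \<eta> \<le> \<delta> / 2 * (1/2) ^ j"
proof -
  let ?e = "\<lambda>j::nat. \<delta> / 2 * (1/2) ^ j"
  have e0: "0 < ?e j" for j using pos by simp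
  define P :: "nat \<Rightarrow> real \<times> nat set \<times> nat \<times> real \<times> nat \<Rightarrow> bool" where
    "P j x = (case x of (r, T, g, A, N) \<Rightarrow> spaced_block l \<beta> N r T g \<and> r \<le> 1 \<and>
      C * \<rho> ^ g \<le> ?e j * (r powr s / c) \<and> K * A * r powr \<eta> \<le> ?e j \<and> 0 < A \<and> (j = 0 \<longrightarrow> A = 1) \<and> j \<le> N)" for j x
  define Q :: "nat \<Rightarrow> real \<times> nat set \<times> nat \<times> real \<times> nat \<Rightarrow> real \<times> nat set \<times> nat \<times> real \<times> nat \<Rightarrow> bool" where
    "Q j x y = (case x of (r, T, g, A, N) \<Rightarrow> case y of (r', T', g', A', N') \<Rightarrow>
      A' = A * (1 + c * r powr (\<beta> - s)) \<and> N' = Max T + g)" for j x y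
  have ex: "\<exists>r T g. P j (r, T, g, A, N)" if AN: "0 < A" "j = 0 \<longrightarrow> A = 1" "j \<le> N" for j A N
  proof -
    have KA: "0 < K * A" using pos AN by simp
    obtain r T g where "spaced_block l \<beta> N r T g" "r \<le> 1" "C * \<rho> ^ g \<le> ?e j * (r powr s / c)" "K * A * r powr \<eta> \<le> ?e j"
      by (rule exists_block[OF l ns \<beta> e0[of j] KA pos(3), where N = N]) (assumption | rule that)+
    then show ?thesis using AN unfolding P_def by (intro exI[of _ r] exI[of _ T] exI[of _ g]) simp
  qed
  have "\<exists>f. \<forall>j. P j (f j) \<and> Q j (f j) (f (Suc j))"
  proof (rule dependent_nat_choice)
    obtain r T g where "P 0 (r, T, g, 1, 0)" using ex[of 1 0 0] by auto
    then show "\<exists>x. P 0 x" by (rule exI)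
  next
    fix x j assume "P j x"
    obtain r T g A N where x: "x = (r, T, g, A, N)" by (cases x)
    note p = \<open>P j x\<close>[unfolded x P_def spaced_block_def, simplified]
    have "Max T \<in> T" using p by (intro Max_in) auto
    then have "N < Max T" using p by blast
    moreover have "j \<le> N" using p by simp
    ultimately have N': "Suc j \<le> Max T + g" by linarith
    have "0 < 1 + c * r powr (\<beta> - s)" using c_ge_1 by (intro add_pos_nonneg) auto
    then have A': "0 < A * (1 + c * r powr (\<beta> - s))" using p by simp
    obtain r' T' g' where "P (Suc j) (r', T', g', A * (1 + c * r powr (\<beta> - s)), Max T + g)"
      using ex[OF A' _ N'] by auto
    then show "\<exists>y. P (Suc j) y \<and> Q j x y" unfolding x Q_def by (intro exI conjI) auto
  qed
  then obtain f where f: "\<And>j. P j (f j)" "\<And>j. Q j (f j) (f (Suc j))" by blast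
  define r where "r j = fst (f j)" for j
  define T where "T j = fst (snd (f j))" for j
  define g where "g j = fst (snd (snd (f j)))" for j
  define A where "A j = fst (snd (snd (snd (f j))))" for j
  define N where "N j = snd (snd (snd (snd (f j))))" for j
  have fj: "f j = (r j, T j, g j, A j, N j)" for j by (simp add: r_def T_def g_def A_def N_def)
  have p: "0 < r j" "r j \<le> 1" "finite (T j)" "T j \<noteq> {}" "\<And>n. n \<in> T j \<Longrightarrow> N j < n" "\<And>n. n \<in> T j \<Longrightarrow> r j \<le> l n"
      "\<And>m n. m \<in> T j \<Longrightarrow> n \<in> T j \<Longrightarrow> m < n \<Longrightarrow> m + g j < n" "r j powr (- \<beta>) \<le> real (card (T j))" "1 \<le> g j"
      "C * \<rho> ^ g j \<le> ?e j * (r j powr s / c)" "K * A j * r j powr \<eta> \<le> ?e j" "j = 0 \<longrightarrow> A j = 1" "j \<le> N j" for j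
    using f(1)[of j] unfolding fj P_def spaced_block_def by simp_all
  have q: "A (Suc j) = A j * (1 + c * r j powr (\<beta> - s))" "N (Suc j) = Max (T j) + g j" for j
    using f(2)[of j] unfolding fj[of j] fj[of "Suc j"] Q_def by simp_all
  have A: "A j = (\<Prod>i<j. 1 + c * r i powr (\<beta> - s))" for j
  proof (induction j)
    case 0
    then show ?case using p(12)[of 0] by simp
  next
    case (Suc j)
    then show ?case by (simp add: q(1))
  qed
  have Nmono: "N i \<le> N j" if "i \<le> j" for i j
    using that
  proof (induction j rule: dec_induct)
    case (step j)
    have "N j < Max (T j)" using p(3,4) by (intro p(5) Max_in)
    then show ?case using step q(2)[of j] by simp
  qed simp
  have between: "m + g i < n" if "i < j" "m \<in> T i" "n \<in> T j" for i j m n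
  proof -
    have "m + g i \<le> N (Suc i)" unfolding q(2) using p(3) that(2) by simp
    also have "\<dots> \<le> N j" using that(1) by (intro Nmono) simp
    also have "\<dots> < n" by (rule p(5)[OF that(3)])
    finally show ?thesis .
  qed
  have "block_sequence M \<xi> \<mu> s C \<rho> c r T g ?e"
  proof (intro block_sequence.intro covering_process_axioms block_sequence_axioms.intro)
    show "1 \<le> n" if "n \<in> T j" for j n using p(5)[OF that] by simp
    show "?e j \<le> 1" for j
    proof -
      have "\<delta> / 2 * (1/2) ^ j \<le> 1 * 1" using \<delta>1 pos by (intro mult_mono power_le_one) auto
      then show ?thesis by simp
    qed
    show "C * \<rho> ^ g j \<le> ?e j * measure \<mu> (cball x (r j))" for j x
    proof -
      have "?e j * (r j powr s / c) \<le> ?e j * measure \<mu> (cball x (r j))"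
        using e0[of j] by (intro mult_left_mono ball_lower p) auto
      with p(10)[of j] show ?thesis by (rule order_trans)
    qed
    show "0 \<le> ?e j" for j using e0[of j] by (rule less_imp_le)
  qed (fact p between)+
  moreover have "j < n" if "n \<in> T j" for j n using p(5)[OF that] p(13)[of j] by simp
  moreover have "K * (\<Prod>i<j. 1 + c * r i powr (\<beta> - s)) * r j powr \<eta> \<le> ?e j" for j
    using p(11)[of j] unfolding A .
  ultimately show ?thesis using p(6,8) by (intro that[of r T g])
qed

text \<open>For every \<open>\<delta>\<close> there is a sequence of blocks such that each stage \<open>J\<close> succeeds, i.e. has large mass
  and small energy, with probability at least \<open>1 - 29 * \<delta>\<close>. Then infinitely many stages succeed with at least this probability, and on
  this event the points of \<open>range f\<close> that are covered in every block, all of which belong to the limsup set, form a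
  set of positive measure.\<close>

lemma AE_hausdorff_pos:
  fixes f :: "(nat \<Rightarrow> nat) \<Rightarrow> 'a" and l :: "nat \<Rightarrow> real"
  assumes cpt: "compact (UNIV :: 'a set)" and f: "continuous_on UNIV f"
    and Ht: "hausdorff_measure t (range f) \<noteq> 0"
    and l: "\<And>n. 1 \<le> n \<Longrightarrow> 0 < l n" "\<And>n. 1 \<le> n \<Longrightarrow> l (Suc n) \<le> l n" "l \<longlonglongrightarrow> 0"
    and ns: "\<not> summable (\<lambda>n. l (Suc n) powr u)" and \<beta>: "0 < \<beta>" "\<beta> < u" "u \<le> s"
    and \<theta>: "0 < \<theta>" "\<theta> + s - \<beta> < t"
  shows "AE \<omega> in M. hausdorff_measure \<theta> (limsup_balls \<xi> l \<omega> \<inter> range f) \<noteq> 0"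
proof (rule AE_of_high_probability)
  fix \<delta> :: real assume \<delta>: "0 < \<delta>" "\<delta> \<le> 1 / 4"
  \<comment> \<open>The available room \<open>t - (\<theta> + s - \<beta>)\<close> is divided into four: two parts for the passage from \<open>t\<close> to \<open>t'\<close>,
    one for the convergence of the energy, one for the decay of the near-pair terms.\<close>
  define \<eta> where "\<eta> = (t - (\<theta> + s - \<beta>)) / 4"
  define t' where "t' = \<theta> + s - \<beta> + 2 * \<eta>"
  have \<eta>: "0 < \<eta>" using \<theta> by (simp add: \<eta>_def)
  have t': "0 < t'" "t' < t" "\<theta> + \<eta> \<le> t'" "\<beta> - s + (t' - \<theta> - \<eta>) = \<eta>"
    using \<theta> \<beta> \<eta> by (auto simp: t'_def) (simp add: \<eta>_def field_simps)
  obtain k Cf where Cf: "0 < Cf" and frost: "\<And>n \<rho>0. 0 < \<rho>0 \<Longrightarrow>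
      \<exists>P w. P \<subseteq> f ` {\<sigma>. \<forall>i<n. \<sigma> i \<le> k i} \<and> frostman_weights P w \<rho>0 Cf t'"
    by (rule frostman_on_boxes[OF cpt t'(1,2) Ht]) (rule that)
  have \<delta>1: "\<delta> \<le> 1" using \<delta>(2) by simp
  define K where "K = c * (geom_const \<eta> * Cf)"
  have K: "0 < K" using Cf geom_const_sum(2)[OF \<eta>] c_ge_1 by (simp add: K_def)
  obtain r T g where bs: "block_sequence M \<xi> \<mu> s C \<rho> c r T g (\<lambda>j. \<delta> / 2 * (1/2) ^ j)"
    and card: "\<And>j. r j powr (- \<beta>) \<le> real (card (T j))" and rl: "\<And>j n. n \<in> T j \<Longrightarrow> r j \<le> l n"
    and late: "\<And>j n. n \<in> T j \<Longrightarrow> j < n"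
    and growth: "\<And>j. K * (\<Prod>i<j. 1 + c * r i powr (\<beta> - s)) * r j powr \<eta> \<le> \<delta> / 2 * (1/2) ^ j"
    by (rule exists_block_sequence[OF l ns \<beta>(1,2) \<delta>(1) K \<eta> \<delta>1]) (assumption | rule that)+
  interpret block_sequence M \<xi> \<mu> s C \<rho> c r T g "\<lambda>j. \<delta> / 2 * (1/2) ^ j" by (rule bs)
  define A where "A j = c * r j powr (\<beta> - s) * (\<Prod>i<j. 1 + c * r i powr (\<beta> - s))" for j
  have ov: "overlap j x y \<le> c * r j powr (\<beta> - s) * (if dist x y \<le> 2 * r j then 1 else 0)" for j x y
  proof -
    have "r j powr (- \<beta>) * (r j powr s / c) \<le> real (card (T j)) * measure \<mu> (cball y (r j))"
      using r c_ge_1 by (intro mult_mono card ball_lower) auto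
    moreover have "0 < r j powr (- \<beta>) * (r j powr s / c)" using r[of j] c_ge_1 by simp
    ultimately have "1 / (real (card (T j)) * measure \<mu> (cball y (r j))) \<le> 1 / (r j powr (- \<beta>) * (r j powr s / c))"
      by (intro frac_le) auto
    also have "\<dots> = c * r j powr (\<beta> - s)"
      using r[of j] c_ge_1 by (simp add: powr_diff powr_minus field_simps)
    finally show ?thesis by (simp add: overlap_def)
  qed
  have c0: "0 \<le> c * r j powr (\<beta> - s)" for j using c_ge_1 by simp
  have ov': "overlap j x y * (\<Prod>i<j. 1 + overlap i x y) \<le> A j * (if dist x y \<le> 2 * r j then 1 else 0)" for j x y
  proof -
    have "overlap i x y \<le> c * r i powr (\<beta> - s)" for i using ov[of i x y] c0[of i] by (auto split: if_splits)
    then have "(\<Prod>i<j. 1 + overlap i x y) \<le> (\<Prod>i<j. 1 + c * r i powr (\<beta> - s))"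
      using overlap_nonneg by (intro prod_mono) (auto intro: add_nonneg_nonneg)
    then have "overlap j x y * (\<Prod>i<j. 1 + overlap i x y)
        \<le> (c * r j powr (\<beta> - s) * (if dist x y \<le> 2 * r j then 1 else 0)) * (\<Prod>i<j. 1 + c * r i powr (\<beta> - s))"
      using overlap_nonneg c0 by (intro mult_mono ov prod_nonneg) (auto intro: add_nonneg_nonneg)
    then show ?thesis by (simp add: A_def mult_ac)
  qed
  have A0: "0 \<le> A j" for j using c_ge_1 by (auto simp: A_def intro!: mult_nonneg_nonneg prod_nonneg add_nonneg_nonneg)
  have near: "A j * (geom_const \<eta> * Cf * r j powr (t' - \<theta> - \<eta>)) \<le> \<delta> / 2 * (1/2) ^ j" for j
  proof -
    have "r j powr (\<beta> - s) * r j powr (t' - \<theta> - \<eta>) = r j powr \<eta>"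
      by (simp add: powr_add[symmetric] t'(4))
    then have "A j * (geom_const \<eta> * Cf * r j powr (t' - \<theta> - \<eta>)) = K * (\<Prod>i<j. 1 + c * r i powr (\<beta> - s)) * r j powr \<eta>"
      by (simp add: A_def K_def mult_ac)
    then show ?thesis using growth[of j] by simp
  qed
  have "\<exists>m\<ge>J. \<forall>j<J. (1/2) ^ m \<le> r j" for J
    using exists_half_power_below[of r J] r(1) by metis
  then obtain m where m: "\<And>J. J \<le> m J" "\<And>J j. j < J \<Longrightarrow> (1/2) ^ m J \<le> r j" by metis
  have "\<forall>J. \<exists>Pw. fst Pw \<subseteq> f ` {\<sigma>. \<forall>i<J. \<sigma> i \<le> k i} \<and> frostman_weights (fst Pw) (snd Pw) ((1/2) ^ m J) Cf t'"
    using frost[of "(1/2) ^ m J" J for J] by auto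
  from choice[OF this] obtain Pw where Pw': "\<forall>J. fst (Pw J) \<subseteq> f ` {\<sigma>. \<forall>i<J. \<sigma> i \<le> k i} \<and>
      frostman_weights (fst (Pw J)) (snd (Pw J)) ((1/2) ^ m J) Cf t'" by (elim exE)
  define P w where "P J = fst (Pw J)" and "w J = snd (Pw J)" for J
  have Pw: "P J \<subseteq> f ` {\<sigma>. \<forall>i<J. \<sigma> i \<le> k i}" "frostman_weights (P J) (w J) ((1/2) ^ m J) Cf t'" for J
    using Pw' by (simp_all add: P_def w_def)
  have w0: "0 \<le> w J x" and finP: "finite (P J)" for J x using Pw(2)[of J] by (auto simp: frostman_weights_def)
  define Good where "Good J = {\<omega> \<in> space M. 1 / 2 \<le> mass (P J) (w J) J \<omega> \<and> energy \<theta> (m J) (P J) (w J) J \<omega> \<le> 2 * (geom_const \<eta> * Cf + 1) / \<delta>}" for J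
  have Good_events: "Good J \<in> events" for J unfolding Good_def by measurable
  have Good_prob: "1 - 29 * \<delta> \<le> prob (Good J)" for J
    unfolding Good_def
    by (rule mass_energy_high_probability[where A = A and Cf = Cf and t' = t'])
      (use Pw Cf \<eta> \<theta> t' m \<delta> ov' near A0 in auto)
  define L where "L = (\<Inter>N. \<Union>J\<in>{N..}. Good J)"
  have L_events: "L \<in> events" unfolding L_def using Good_events by auto
  have "1 - 29 * \<delta> \<le> prob L"
  proof (rule LIMSEQ_le_const)
    show "(\<lambda>N. prob (\<Union>J\<in>{N..}. Good J)) \<longlonglongrightarrow> prob L"
      unfolding L_def
    proof (rule finite_Lim_measure_decseq)
      show "range (\<lambda>N. \<Union>J\<in>{N..}. Good J) \<subseteq> events" using Good_events by auto
      show "decseq (\<lambda>N. \<Union>J\<in>{N..}. Good J)" unfolding decseq_def by (intro allI impI UN_mono) auto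
    qed
    have "prob (Good N) \<le> prob (\<Union>J\<in>{N..}. Good J)" for N
      using Good_events by (intro finite_measure_mono) auto
    then show "\<exists>N. \<forall>n\<ge>N. 1 - 29 * \<delta> \<le> prob (\<Union>J\<in>{n..}. Good J)"
      using Good_prob order_trans by blast
  qed
  moreover have "hausdorff_measure \<theta> (limsup_balls \<xi> l \<omega> \<inter> range f) \<noteq> 0" if \<omega>: "\<omega> \<in> L" for \<omega>
  proof -
    define B where "B j = (\<Union>n\<in>T j. cball (\<xi> n \<omega>) (r j))" for j
    have closed: "closed (B j)" for j unfolding B_def using T(1) by (intro closed_UN) auto
    have sub: "(\<Inter>j. B j) \<subseteq> limsup_balls \<xi> l \<omega>"
    proof
      fix y assume y: "y \<in> (\<Inter>j. B j)"
      have "\<exists>n\<ge>N. y \<in> cball (\<xi> n \<omega>) (l n)" for N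
      proof -
        obtain n where n: "n \<in> T N" "y \<in> cball (\<xi> n \<omega>) (r N)" using y by (auto simp: B_def)
        then show ?thesis using rl[OF n(1)] late[OF n(1)] by (intro exI[of _ n]) auto
      qed
      then show "y \<in> limsup_balls \<xi> l \<omega>" by (simp add: limsup_balls_def INFM_nat_le)
    qed
    have in_B: "x \<in> B j" if nz: "density J x \<omega> \<noteq> 0" and j: "j < J" for x j J
    proof -
      have "block_density (r j) (T j) x \<omega> \<noteq> 0" using nz j by (auto simp: density_def)
      then have "(\<Sum>n\<in>T j. hit x (r j) n \<omega>) \<noteq> 0" by (auto simp: block_density_def)
      then obtain n where "n \<in> T j" "hit x (r j) n \<omega> \<noteq> 0" by (rule sum.not_neutral_contains_not_neutral)
      then show ?thesis by (auto simp: B_def hit_def indicator_def dist_commute split: if_splits)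
    qed
    have inf: "\<exists>\<^sub>\<infinity>J. \<omega> \<in> Good J" using \<omega> by (auto simp: L_def INFM_nat_le)
    show ?thesis
    proof (rule hausdorff_measure_pos_of_energy[OF f closed sub \<theta>(1), where k = k and K = "2 * (geom_const \<eta> * Cf + 1) / \<delta>"])
      have "0 < geom_const \<eta> * Cf" using Cf geom_const_sum(2)[OF \<eta>] by simp
      then show "0 < 2 * (geom_const \<eta> * Cf + 1) / \<delta>" using \<delta> by simp
      show "\<exists>\<^sub>\<infinity>n. \<exists>P v m. n \<le> m \<and> P \<subseteq> f ` {\<sigma>. \<forall>i<n. \<sigma> i \<le> k i} \<and>
        (\<forall>x. v x \<noteq> 0 \<longrightarrow> (\<forall>j<n. x \<in> B j)) \<and> energetic P v \<theta> m (2 * (geom_const \<eta> * Cf + 1) / \<delta>)"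
        using inf
      proof (rule INFM_mono)
        fix J assume J: "\<omega> \<in> Good J"
        let ?v = "\<lambda>x. w J x * density J x \<omega>"
        have "J \<le> m J \<and> P J \<subseteq> f ` {\<sigma>. \<forall>i<J. \<sigma> i \<le> k i} \<and>
          (\<forall>x. ?v x \<noteq> 0 \<longrightarrow> (\<forall>j<J. x \<in> B j)) \<and> energetic (P J) ?v \<theta> (m J) (2 * (geom_const \<eta> * Cf + 1) / \<delta>)"
          using J Pw(1) finP w0 m(1) density_nonneg in_B unfolding Good_def mass_def energy_def energetic_def by auto
        then show "\<exists>P v m. J \<le> m \<and> P \<subseteq> f ` {\<sigma>. \<forall>i<J. \<sigma> i \<le> k i} \<and>
          (\<forall>x. v x \<noteq> 0 \<longrightarrow> (\<forall>j<J. x \<in> B j)) \<and> energetic P v \<theta> m (2 * (geom_const \<eta> * Cf + 1) / \<delta>)"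
          by (intro exI)
      qed
    qed
  qed
  ultimately show "\<exists>L\<in>events. 1 - 29 * \<delta> \<le> prob L \<and> (\<forall>\<omega>\<in>L. hausdorff_measure \<theta> (limsup_balls \<xi> l \<omega> \<inter> range f) \<noteq> 0)"
    using L_events by blast
qed

end


section \<open>Consequences of the hypotheses on the process\<close>

lemma stationary_shift:
  assumes st: "stationary_process M \<xi>" and S: "S \<in> sets (\<Pi>\<^sub>M i\<in>{1..}. borel)"
  shows "measure M {\<omega> \<in> space M. (\<lambda>i\<in>{1..}. \<xi> (i + k) \<omega>) \<in> S}
    = measure M {\<omega> \<in> space M. (\<lambda>i\<in>{1..}. \<xi> i \<omega>) \<in> S}"
proof -
  have meas: "(\<lambda>\<omega>. \<lambda>i\<in>{1..}. \<xi> (i + k) \<omega>) \<in> measurable M (\<Pi>\<^sub>M i\<in>{1..}. borel)" for k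
    using st unfolding stationary_process_def by (intro measurable_restrict) auto
  have "measure M {\<omega> \<in> space M. (\<lambda>i\<in>{1..}. \<xi> (i + k) \<omega>) \<in> S}
      = measure (distr M (\<Pi>\<^sub>M i\<in>{1..}. borel) (\<lambda>\<omega>. \<lambda>i\<in>{1..}. \<xi> (i + k) \<omega>)) S" for k
    using measure_distr[OF meas[of k] S] by (simp add: vimage_def Int_def conj_commute)
  from this[of k] this[of 0] show ?thesis
    using st unfolding stationary_process_def by simp
qed

text \<open>An event of the future after time \<open>k + g\<close> is a condition on the sequence started at time \<open>k + 1\<close>, and
  the same condition on the original sequence is an event of the future after time \<open>g\<close>.\<close>

lemma future_events_cylinder:
  fixes \<xi> :: "nat \<Rightarrow> 'w \<Rightarrow> 'a::topological_space"
  assumes "D \<in> future_events M \<xi> (k + g)"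
  shows "\<exists>S\<in>sets (\<Pi>\<^sub>M i\<in>{1..}. borel). D = {\<omega> \<in> space M. (\<lambda>i\<in>{1..}. \<xi> (i + k) \<omega>) \<in> S} \<and>
    {\<omega> \<in> space M. (\<lambda>i\<in>{1..}. \<xi> i \<omega>) \<in> S} \<in> future_events M \<xi> g"
  using assms unfolding future_events_def[of M \<xi> "k + g"]
proof (induction D rule: sigma_sets.induct)
  case (Basic D)
  then obtain i A where D: "D = \<xi> (k + g + i) -` A \<inter> space M" "1 \<le> i" "A \<in> sets borel" by blast
  let ?S = "(\<lambda>x. x (g + i)) -` A \<inter> space (\<Pi>\<^sub>M i\<in>{1..}. borel :: 'a measure)"
  have "(\<lambda>x. x (g + i)) \<in> measurable (\<Pi>\<^sub>M i\<in>{1..}. borel :: 'a measure) borel"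
    using D(2) by (intro measurable_component_singleton) auto
  then have S: "?S \<in> sets (\<Pi>\<^sub>M i\<in>{1..}. borel)" using D(3) by (rule measurable_sets)
  have eqD: "D = {\<omega> \<in> space M. (\<lambda>i\<in>{1..}. \<xi> (i + k) \<omega>) \<in> ?S}"
    using D(1,2) by (auto simp: space_PiM add_ac)
  have eq: "{\<omega> \<in> space M. (\<lambda>i\<in>{1..}. \<xi> i \<omega>) \<in> ?S} = \<xi> (g + i) -` A \<inter> space M"
    using D(2) by (auto simp: space_PiM)
  have "\<xi> (g + i) -` A \<inter> space M \<in> future_events M \<xi> g"
    unfolding future_events_def using D(2,3) by (intro sigma_sets.Basic) blast
  then show ?case using S eqD unfolding eq[symmetric] by (intro bexI[of _ ?S] conjI)
next
  case Empty
  show ?case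
    by (intro bexI[of _ "{}"]) (auto simp: future_events_def intro: sigma_sets.Empty)
next
  case (Compl D)
  then obtain S where S: "S \<in> sets (\<Pi>\<^sub>M i\<in>{1..}. borel)" "D = {\<omega> \<in> space M. (\<lambda>i\<in>{1..}. \<xi> (i + k) \<omega>) \<in> S}"
    "{\<omega> \<in> space M. (\<lambda>i\<in>{1..}. \<xi> i \<omega>) \<in> S} \<in> future_events M \<xi> g" by blast
  let ?S = "space (\<Pi>\<^sub>M i\<in>{1..}. borel) - S"
  have D: "space M - D = {\<omega> \<in> space M. (\<lambda>i\<in>{1..}. \<xi> (i + k) \<omega>) \<in> ?S}"
    unfolding S(2) by (auto simp: space_PiM)
  have eq: "{\<omega> \<in> space M. (\<lambda>i\<in>{1..}. \<xi> i \<omega>) \<in> ?S} = space M - {\<omega> \<in> space M. (\<lambda>i\<in>{1..}. \<xi> i \<omega>) \<in> S}"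
    by (auto simp: space_PiM)
  have "space M - {\<omega> \<in> space M. (\<lambda>i\<in>{1..}. \<xi> i \<omega>) \<in> S} \<in> future_events M \<xi> g"
    using S(3) unfolding future_events_def by (rule sigma_sets.Compl)
  moreover have "?S \<in> sets (\<Pi>\<^sub>M i\<in>{1..}. borel)" using S(1) by auto
  ultimately show ?case unfolding D eq[symmetric] by (intro bexI[of _ ?S] conjI refl)
next
  case (Union D)
  then have "\<forall>n. \<exists>S. S \<in> sets (\<Pi>\<^sub>M i\<in>{1..}. borel) \<and> D n = {\<omega> \<in> space M. (\<lambda>i\<in>{1..}. \<xi> (i + k) \<omega>) \<in> S} \<and>
    {\<omega> \<in> space M. (\<lambda>i\<in>{1..}. \<xi> i \<omega>) \<in> S} \<in> future_events M \<xi> g" by blast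
  from choice[OF this] obtain S where S: "\<forall>n. S n \<in> sets (\<Pi>\<^sub>M i\<in>{1..}. borel) \<and>
    D n = {\<omega> \<in> space M. (\<lambda>i\<in>{1..}. \<xi> (i + k) \<omega>) \<in> S n} \<and>
    {\<omega> \<in> space M. (\<lambda>i\<in>{1..}. \<xi> i \<omega>) \<in> S n} \<in> future_events M \<xi> g" by (elim exE)
  have D: "(\<Union>n. D n) = {\<omega> \<in> space M. (\<lambda>i\<in>{1..}. \<xi> (i + k) \<omega>) \<in> (\<Union>n. S n)}" using S by auto
  have eq: "{\<omega> \<in> space M. (\<lambda>i\<in>{1..}. \<xi> i \<omega>) \<in> (\<Union>n. S n)} = (\<Union>n. {\<omega> \<in> space M. (\<lambda>i\<in>{1..}. \<xi> i \<omega>) \<in> S n})"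
    by auto
  have "(\<Union>n. {\<omega> \<in> space M. (\<lambda>i\<in>{1..}. \<xi> i \<omega>) \<in> S n}) \<in> future_events M \<xi> g"
    using S unfolding future_events_def by (intro sigma_sets.Union) auto
  moreover have "(\<Union>n. S n) \<in> sets (\<Pi>\<^sub>M i\<in>{1..}. borel)" using S by auto
  ultimately show ?case unfolding D eq[symmetric] by (intro bexI[of _ "\<Union>n. S n"] conjI refl)
qed

text \<open>Stationarity moves the mixing inequality to any starting time; events of probability zero, which the
  conditional form leaves out, satisfy it trivially. The constant for the balls is enlarged by
  \<open>diam powr (- s)\<close> in order to cover radii beyond the diameter, which is positive since the space has two points.\<close>

lemma covering_process_of_mixing:
  fixes M :: "'w measure" and \<xi> :: "nat \<Rightarrow> 'w \<Rightarrow> 'a::metric_space"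
  assumes cpt: "compact (UNIV :: 'a set)" and nontrivial: "\<exists>x y :: 'a. x \<noteq> y"
    and M: "prob_space M" and st: "stationary_process M \<xi>" and mix: "exponentially_mixing M \<xi>"
    and \<mu>: "\<mu> = distr M borel (\<xi> 1)" and s: "0 < s" and reg: "ahlfors_regular \<mu> s"
  shows "\<exists>C \<rho> c. covering_process M \<xi> \<mu> s C \<rho> c"
proof -
  interpret prob_space M by (rule M)
  have meas: "\<xi> n \<in> measurable M borel" if "1 \<le> n" for n using st that by (simp add: stationary_process_def)
  interpret \<mu>: prob_space \<mu> unfolding \<mu> by (rule prob_space_distr[OF meas]) simp
  have space_\<mu>: "space \<mu> = UNIV" by (simp add: \<mu>)
  have meas1: "(\<lambda>x. x 1) \<in> measurable (\<Pi>\<^sub>M i\<in>{1::nat..}. borel :: 'a measure) borel"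
    by (intro measurable_component_singleton) auto
  have measX: "(\<lambda>\<omega>. \<lambda>i\<in>{1..}. \<xi> (i + k) \<omega>) \<in> measurable M (\<Pi>\<^sub>M i\<in>{1..}. borel)" for k
    using meas by (intro measurable_restrict) auto
  have "distr M borel (\<xi> (1 + k)) = distr M borel (\<xi> 1)" for k
  proof -
    have "distr M borel (\<xi> (1 + k)) = distr (distr M (\<Pi>\<^sub>M i\<in>{1..}. borel) (\<lambda>\<omega>. \<lambda>i\<in>{1..}. \<xi> (i + k) \<omega>)) borel (\<lambda>x. x 1)" for k
      by (subst distr_distr[OF meas1 measX]) (simp add: comp_def)
    from this[of k] this[of 0] show ?thesis using st unfolding stationary_process_def by simp
  qed
  then have dist: "distr M borel (\<xi> n) = \<mu>" if "1 \<le> n" for n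
    unfolding \<mu> using that by (metis le_add_diff_inverse)
  obtain C \<rho> where C: "0 < C" "0 < \<rho>" "\<rho> < 1"
    and mix': "\<And>n x r D. n \<ge> 1 \<Longrightarrow> r > 0 \<Longrightarrow> D \<in> future_events M \<xi> n \<Longrightarrow> measure M D > 0 \<Longrightarrow>
          \<bar>cond_prob M (\<lambda>\<omega>. \<xi> 1 \<omega> \<in> cball x r) (\<lambda>\<omega>. \<omega> \<in> D)
             - measure M {\<omega> \<in> space M. \<xi> 1 \<omega> \<in> cball x r}\<bar> \<le> C * \<rho> ^ n"
    using mix unfolding exponentially_mixing_def by blast
  have \<mu>_ball: "measure M {\<omega> \<in> space M. \<xi> 1 \<omega> \<in> cball x r} = measure \<mu> (cball x r)" for x r
    unfolding \<mu> using measure_distr[OF meas[of 1], of "cball x r"] by (simp add: vimage_def Int_def conj_commute)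
  have first: "\<bar>measure M ({\<omega> \<in> space M. \<xi> 1 \<omega> \<in> cball x r} \<inter> D) - measure \<mu> (cball x r) * measure M D\<bar>
      \<le> C * \<rho> ^ g * measure M D"
    if g: "1 \<le> g" and r: "0 < r" and D: "D \<in> future_events M \<xi> g" for g x r D
  proof -
    let ?A = "{\<omega> \<in> space M. \<xi> 1 \<omega> \<in> cball x r}"
    have "D \<subseteq> space M" using D unfolding future_events_def by (rule sigma_sets_into_sp[rotated]) auto
    have "D \<in> events"
      using D unfolding future_events_def
      by (rule sets.sigma_sets_subset[THEN subsetD, rotated]) (auto intro!: measurable_sets[OF meas])
    have eqD: "{\<omega> \<in> space M. \<omega> \<in> D} = D" "{\<omega> \<in> space M. \<xi> 1 \<omega> \<in> cball x r \<and> \<omega> \<in> D} = ?A \<inter> D"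
      using \<open>D \<subseteq> space M\<close> by auto
    show ?thesis
    proof (cases "prob D > 0")
      case True
      have "\<bar>prob (?A \<inter> D) / prob D - measure \<mu> (cball x r)\<bar> \<le> C * \<rho> ^ g"
        using mix'[OF g r D True, of x] unfolding cond_prob_def \<mu>_ball eqD .
      then have "\<bar>prob (?A \<inter> D) / prob D - measure \<mu> (cball x r)\<bar> * prob D
          \<le> C * \<rho> ^ g * prob D"
        using True by (intro mult_right_mono) auto
      also have "\<bar>prob (?A \<inter> D) / prob D - measure \<mu> (cball x r)\<bar> * prob D
          = \<bar>(prob (?A \<inter> D) / prob D - measure \<mu> (cball x r)) * prob D\<bar>"
        using True by (simp add: abs_mult)
      also have "(prob (?A \<inter> D) / prob D - measure \<mu> (cball x r)) * prob D
          = prob (?A \<inter> D) - measure \<mu> (cball x r) * prob D"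
        using True by (simp add: left_diff_distrib)
      finally show ?thesis .
    next
      case False
      then have 0: "prob D = 0" by (simp add: zero_less_measure_iff)
      have "prob (?A \<inter> D) \<le> prob D"
        using \<open>D \<in> events\<close> by (intro finite_measure_mono) auto
      then have "prob (?A \<inter> D) = 0" using 0 by (simp add: antisym)
      then show ?thesis using 0 by simp
    qed
  qed
  have shifted: "\<bar>measure M ({\<omega> \<in> space M. \<xi> (Suc k) \<omega> \<in> cball x r} \<inter> D) - measure \<mu> (cball x r) * measure M D\<bar>
      \<le> C * \<rho> ^ g * measure M D"
    if g: "1 \<le> g" and r: "0 < r" and D: "D \<in> future_events M \<xi> (k + g)" for k g x r D
  proof -
    obtain S where S: "S \<in> sets (\<Pi>\<^sub>M i\<in>{1..}. borel)" "D = {\<omega> \<in> space M. (\<lambda>i\<in>{1..}. \<xi> (i + k) \<omega>) \<in> S}"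
      "{\<omega> \<in> space M. (\<lambda>i\<in>{1..}. \<xi> i \<omega>) \<in> S} \<in> future_events M \<xi> g"
      using future_events_cylinder[OF D] by blast
    let ?B = "(\<lambda>z. z 1) -` cball x r \<inter> space (\<Pi>\<^sub>M i\<in>{1..}. borel :: 'a measure)"
    have B: "?B \<inter> S \<in> sets (\<Pi>\<^sub>M i\<in>{1..}. borel)"
      using measurable_sets[OF meas1, of "cball x r"] S(1) by auto
    have "{\<omega> \<in> space M. \<xi> (Suc k) \<omega> \<in> cball x r} \<inter> D = {\<omega> \<in> space M. (\<lambda>i\<in>{1..}. \<xi> (i + k) \<omega>) \<in> ?B \<inter> S}"
      unfolding S(2) by (auto simp: space_PiM)
    then have "measure M ({\<omega> \<in> space M. \<xi> (Suc k) \<omega> \<in> cball x r} \<inter> D)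
        = measure M {\<omega> \<in> space M. (\<lambda>i\<in>{1..}. \<xi> i \<omega>) \<in> ?B \<inter> S}"
      using stationary_shift[OF st B, of k] by simp
    also have "{\<omega> \<in> space M. (\<lambda>i\<in>{1..}. \<xi> i \<omega>) \<in> ?B \<inter> S}
        = {\<omega> \<in> space M. \<xi> 1 \<omega> \<in> cball x r} \<inter> {\<omega> \<in> space M. (\<lambda>i\<in>{1..}. \<xi> i \<omega>) \<in> S}"
      by (auto simp: space_PiM)
    finally show ?thesis
      using first[OF g r S(3), of x] stationary_shift[OF st S(1), of k] by (simp add: S(2))
  qed
  obtain c0 where c0: "1 \<le> c0" "\<And>x r. 0 < r \<Longrightarrow> r \<le> diameter (UNIV :: 'a set) \<Longrightarrow>
        inverse c0 * r powr s \<le> measure \<mu> (cball x r) \<and> measure \<mu> (cball x r) \<le> c0 * r powr s"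
    using reg unfolding ahlfors_regular_def by blast
  define d where "d = diameter (UNIV :: 'a set)"
  have le_d: "dist x y \<le> d" for x y :: 'a
    unfolding d_def using diameter_bounded_bound[OF compact_imp_bounded[OF cpt]] by blast
  obtain x0 y0 :: 'a where "x0 \<noteq> y0" using nontrivial by blast
  then have d: "0 < d" using le_d[of x0 y0] by (smt (verit) zero_less_dist_iff)
  have full: "cball x r = space \<mu>" if "d < r" for x r
  proof -
    have "dist x y \<le> r" for y using le_d[of x y] that by simp
    then show ?thesis by (auto simp: space_\<mu>)
  qed
  define c where "c = max c0 (d powr (- s))"
  have c: "1 \<le> c" "c0 \<le> c" "d powr (- s) \<le> c" using c0(1) by (auto simp: c_def)
  have upper: "measure \<mu> (cball x r) \<le> c * r powr s" if r: "0 < r" for x r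
  proof (cases "r \<le> d")
    case True
    have "measure \<mu> (cball x r) \<le> c0 * r powr s" using c0(2)[of r x] r True by (simp add: d_def)
    also have "\<dots> \<le> c * r powr s" by (intro mult_right_mono c) simp
    finally show ?thesis .
  next
    case False
    have "1 \<le> (r / d) powr s" using False d s by (intro ge_one_powr_ge_zero) auto
    also have "\<dots> = d powr (- s) * r powr s" using r d by (simp add: powr_divide powr_minus_divide)
    also have "\<dots> \<le> c * r powr s" by (intro mult_right_mono c) simp
    finally show ?thesis using \<mu>.prob_le_1[of "cball x r"] by linarith
  qed
  have lower: "r powr s / c \<le> measure \<mu> (cball x r)" if r: "0 < r" "r \<le> 1" for x r
  proof (cases "r \<le> d")
    case True
    have "r powr s / c \<le> r powr s / c0" using c c0(1) by (intro divide_left_mono) auto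
    also have "\<dots> \<le> measure \<mu> (cball x r)" using c0(2)[of r x] r True by (simp add: d_def field_simps)
    finally show ?thesis .
  next
    case False
    have "r powr s \<le> 1" using r s by (intro powr_le1) auto
    then have "r powr s / c \<le> 1" using c(1) by simp
    moreover have "measure \<mu> (cball x r) = 1" using False full[of r x] \<mu>.prob_space by simp
    ultimately show ?thesis by simp
  qed
  have "covering_process M \<xi> \<mu> s C \<rho> c"
    by (intro covering_process.intro covering_process_axioms.intro M meas dist s c C upper lower shifted)
  then show ?thesis by blast
qed

section \<open>Summability and the index\<close>

lemma not_summable_below_BT_index:
  assumes l: "\<And>n. 1 \<le> n \<Longrightarrow> 0 < l n" and s: "0 \<le> s" and \<beta>: "\<beta> < upper_BT_index s l"
  obtains u where "\<beta> < u" "u \<le> s" "\<not> summable (\<lambda>n. l (Suc n) powr u)"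
proof -
  have "(\<lambda>n. l (Suc n) powr 0) = (\<lambda>n. 1)" using l by (force simp: less_imp_neq[symmetric])
  then have "0 \<in> {t. t \<le> s \<and> \<not> summable (\<lambda>n. l (Suc n) powr t)}" using s by (simp add: summable_const_iff)
  then show ?thesis
    using \<beta> that unfolding upper_BT_index_def by (subst (asm) less_cSup_iff) auto
qed

lemma summable_above_BT_index:
  assumes l: "\<And>n. 1 \<le> n \<Longrightarrow> 0 < l n" "l \<longlonglongrightarrow> 0" and \<alpha>: "upper_BT_index s l < s" "upper_BT_index s l < e"
  shows "summable (\<lambda>n. l (Suc n) powr e)"
proof -
  have le_s: "summable (\<lambda>n. l (Suc n) powr t)" if "upper_BT_index s l < t" "t \<le> s" for t
  proof (rule ccontr)
    assume "\<not> ?thesis"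
    then have "t \<le> upper_BT_index s l" unfolding upper_BT_index_def using that by (intro cSup_upper) auto
    then show False using that by simp
  qed
  show ?thesis
  proof (rule summable_comparison_test_ev)
    show "summable (\<lambda>n. l (Suc n) powr (min e s))" using \<alpha> by (intro le_s) auto
    have "eventually (\<lambda>n. l n < 1) sequentially" using l(2) by (rule order_tendstoD) simp
    then have "eventually (\<lambda>n. l (Suc n) < 1) sequentially"
      by (rule eventually_compose_filterlim[OF _ filterlim_Suc])
    then show "eventually (\<lambda>n. norm (l (Suc n) powr e) \<le> l (Suc n) powr (min e s)) sequentially"
    proof eventually_elim
      case (elim n)
      then show ?case using powr_mono'[of "min e s" e "l (Suc n)"] l(1)[of "Suc n"] by simp
    qed
  qed
qed

section \<open>The dimension theorem\<close>

theorem theorem2p2: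
  fixes M :: "'w measure"
    and \<xi> :: "nat \<Rightarrow> 'w \<Rightarrow> 'a::metric_space"
    and \<mu> :: "'a measure"
    and l :: "nat \<Rightarrow> real"
    and s \<alpha> :: real
    and G :: "'a set"
  assumes "compact (UNIV :: 'a set)"
    and "\<exists>x y :: 'a. x \<noteq> y"
    and "prob_space M"
    and "stationary_process M \<xi>"
    and "exponentially_mixing M \<xi>"
    and "\<mu> = distr M borel (\<xi> 1)"
    and "0 < s"
    and "ahlfors_regular \<mu> s"
    and "\<forall>n\<ge>1. 0 < l n"
    and "\<forall>n\<ge>1. l (Suc n) \<le> l n"
    and "l \<longlonglongrightarrow> 0"
    and "\<alpha> = upper_BT_index s l"
    and "\<alpha> < s"
    and "analytic_set G"
  shows "AE \<omega> in M.
     (packing_dim G \<ge> ereal (s - \<alpha>) \<longrightarrow>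
        hausdorff_dim (limsup_balls \<xi> l \<omega> \<inter> G) \<le> packing_dim G + ereal \<alpha> - ereal s) \<and>
     (packing_dim G < ereal (s - \<alpha>) \<longrightarrow>
        hausdorff_dim (limsup_balls \<xi> l \<omega> \<inter> G) = - \<infinity>) \<and>
     (hausdorff_dim G > ereal (s - \<alpha>) \<longrightarrow>
        hausdorff_dim (limsup_balls \<xi> l \<omega> \<inter> G) \<ge> hausdorff_dim G + ereal \<alpha> - ereal s)"
proof (cases "G = {}")
  case True
  then show ?thesis by (simp add: packing_dim_def hausdorff_dim_def)
next
  case False
  obtain f :: "(nat \<Rightarrow> nat) \<Rightarrow> 'a" where f: "continuous_on UNIV f" "G = range f"
    using assms(14) False by (auto simp: analytic_set_def)
  obtain C \<rho> c where "covering_process M \<xi> \<mu> s C \<rho> c"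
    using covering_process_of_mixing[OF assms(1-8)] by blast
  then interpret covering_process M \<xi> \<mu> s C \<rho> c .
  let ?E = "\<lambda>\<omega>. limsup_balls \<xi> l \<omega> \<inter> G"
  have l: "\<And>n. 1 \<le> n \<Longrightarrow> 0 < l n" "\<And>n. 1 \<le> n \<Longrightarrow> l (Suc n) \<le> l n" using assms(9,10) by auto
  have upper: "AE \<omega> in M. hausdorff_measure \<theta> (?E \<omega>) = 0"
    if \<theta>: "0 \<le> \<theta>" "packing_dim G < ereal (\<theta> + s - \<alpha>)" for \<theta>
  proof -
    obtain t where t: "0 \<le> t" "ereal t < ereal (\<theta> + s - \<alpha>)" "packing_measure t G = 0"
      by (rule packing_dim_null[OF \<theta>(2) False]) (rule that)
    have sm: "summable (\<lambda>n. l (Suc n) powr (\<theta> + s - t))"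
      using summable_above_BT_index[OF l(1) assms(11), of s "\<theta> + s - t"] assms(12,13) t(2) by simp
    show ?thesis by (rule AE_hausdorff_null[OF l(1) assms(11) \<theta>(1) sm t(3)])
  qed
  have lower: "AE \<omega> in M. hausdorff_measure \<theta> (?E \<omega>) \<noteq> 0"
    if \<theta>: "0 < \<theta>" "ereal (\<theta> + s - \<alpha>) < hausdorff_dim G" for \<theta>
  proof -
    obtain t where t: "\<theta> + s - \<alpha> < t" "ereal t < hausdorff_dim G" using ereal_dense2[OF \<theta>(2)] by auto
    have t0: "0 \<le> t" using t(1) \<theta>(1) assms(13) by simp
    have Ht: "hausdorff_measure t (range f) \<noteq> 0"
      using hausdorff_measure_pos_if_less_dim[OF t0 t(2)] f(2) by simp
    \<comment> \<open>This gives \<open>0 < \<alpha>\<close>, hence a positive \<open>\<beta>\<close>.\<close>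
    have "t \<le> s"
    proof (rule ccontr)
      assume "\<not> t \<le> s"
      then have "hausdorff_measure t (UNIV :: 'a set) = 0"
        by (intro hausdorff_measure_UNIV_null assms(1)) simp
      then show False using hausdorff_measure_null_UN[of "range f" "\<lambda>_. UNIV" t] Ht by simp
    qed
    then have "max 0 (\<theta> + s - t) < \<alpha>" using t(1) \<theta>(1) by simp
    then obtain \<beta> where \<beta>: "max 0 (\<theta> + s - t) < \<beta>" "\<beta> < \<alpha>" using dense by blast
    have "\<beta> < upper_BT_index s l" using \<beta>(2) assms(12) by simp
    from not_summable_below_BT_index[OF l(1) less_imp_le[OF assms(7)] this]
    obtain u where u: "\<beta> < u" "u \<le> s" "\<not> summable (\<lambda>n. l (Suc n) powr u)" by blast
    show ?thesis unfolding f(2)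
      using \<beta>(1) by (intro AE_hausdorff_pos[OF assms(1) f(1) Ht l assms(11) u(3) _ u(1,2) \<theta>(1)]) auto
  qed
  \<comment> \<open>Rational exponents suffice and keep the union of the exceptional events null.\<close>
  have "AE \<omega> in M. 0 \<le> real_of_rat q \<longrightarrow> packing_dim G < ereal (real_of_rat q + s - \<alpha>) \<longrightarrow> hausdorff_measure (real_of_rat q) (?E \<omega>) = 0" for q
    using upper[of "real_of_rat q"] by (cases "0 \<le> real_of_rat q \<and> packing_dim G < ereal (real_of_rat q + s - \<alpha>)") auto
  then have U: "AE \<omega> in M. \<forall>q. 0 \<le> real_of_rat q \<longrightarrow> packing_dim G < ereal (real_of_rat q + s - \<alpha>) \<longrightarrow> hausdorff_measure (real_of_rat q) (?E \<omega>) = 0"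
    by (simp add: AE_all_countable)
  have "AE \<omega> in M. 0 < real_of_rat q \<longrightarrow> ereal (real_of_rat q + s - \<alpha>) < hausdorff_dim G \<longrightarrow> hausdorff_measure (real_of_rat q) (?E \<omega>) \<noteq> 0" for q
    using lower[of "real_of_rat q"] by (cases "0 < real_of_rat q \<and> ereal (real_of_rat q + s - \<alpha>) < hausdorff_dim G") auto
  then have L: "AE \<omega> in M. \<forall>q. 0 < real_of_rat q \<longrightarrow> ereal (real_of_rat q + s - \<alpha>) < hausdorff_dim G \<longrightarrow> hausdorff_measure (real_of_rat q) (?E \<omega>) \<noteq> 0"
    by (simp add: AE_all_countable)
  have shift_less: "d + ereal \<alpha> - ereal s < ereal \<theta> \<longleftrightarrow> d < ereal (\<theta> + s - \<alpha>)"
    "ereal \<theta> < d + ereal \<alpha> - ereal s \<longleftrightarrow> ereal (\<theta> + s - \<alpha>) < d" for d \<theta>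
    by (cases d; auto)+
  from U L show ?thesis
  proof eventually_elim
    case (elim \<omega>)
    have "hausdorff_dim (?E \<omega>) \<le> packing_dim G + ereal \<alpha> - ereal s" if "packing_dim G \<ge> ereal (s - \<alpha>)"
    proof (rule ccontr)
      assume "\<not> ?thesis"
      then obtain q where q: "packing_dim G + ereal \<alpha> - ereal s < ereal (real_of_rat q)" "ereal (real_of_rat q) < hausdorff_dim (?E \<omega>)"
        using ereal_dense3 by (metis not_le)
      have "ereal (s - \<alpha>) < ereal (real_of_rat q + s - \<alpha>)" using that q(1) unfolding shift_less by (rule le_less_trans)
      then have "0 \<le> real_of_rat q" by simp
      moreover from this have "hausdorff_measure (real_of_rat q) (?E \<omega>) = 0" using elim(1) q(1) unfolding shift_less by blast
      ultimately have "hausdorff_dim (?E \<omega>) \<le> ereal (real_of_rat q)" by (rule hausdorff_dim_le)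
      then show False using q(2) by simp
    qed
    moreover have "hausdorff_dim (?E \<omega>) = - \<infinity>" if "packing_dim G < ereal (s - \<alpha>)"
    proof -
      have "hausdorff_measure 0 (?E \<omega>) = 0" using elim(1)[rule_format, of 0] that by simp
      then have "?E \<omega> = {}" by (rule hausdorff_measure_0_eq_0)
      then show ?thesis by (simp add: hausdorff_dim_def)
    qed
    moreover have "hausdorff_dim (?E \<omega>) \<ge> hausdorff_dim G + ereal \<alpha> - ereal s" if "hausdorff_dim G > ereal (s - \<alpha>)"
    proof (rule hausdorff_dim_ge)
      show "0 < hausdorff_dim G + ereal \<alpha> - ereal s" using shift_less(2)[of 0] that by (simp add: zero_ereal_def)
      fix t assume t: "0 < t" "ereal t < hausdorff_dim G + ereal \<alpha> - ereal s"
      obtain q where q: "ereal t < ereal (real_of_rat q)" "ereal (real_of_rat q) < hausdorff_dim G + ereal \<alpha> - ereal s"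
        using ereal_dense3[OF t(2)] by blast
      have "0 < (real_of_rat q :: real)" using q(1) t(1) by (simp del: zero_less_of_rat_iff)
      with elim(2) have "hausdorff_measure (real_of_rat q) (?E \<omega>) \<noteq> 0"
        using q(2) unfolding shift_less by blast
      then show "hausdorff_measure t (?E \<omega>) \<noteq> 0"
        using hausdorff_measure_null_mono_exponent[of t "real_of_rat q" "?E \<omega>"] t(1) q(1) by auto
    qed
    ultimately show ?case by blast
  qed
qed

end
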